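(* (1) Let $K\subseteq\mathbb{R}^{n+m}$ be a compact regular partially convex set in $x\in\mathbb{R}^{n}$. Then $\mathcal{C}_{\mathrm{aff}}(K)$ is a free order unit module, and $K$ is isomorphic (as a partially convex set) to the partially convex coordinate state space $K_{\mathcal{C}_{\mathrm{aff}}(K)}$. (2) Let $A$ be a free order unit module (of type $(n,m)$). Then its partially convex coordinate state space $K_A\subseteq\mathbb{R}^{n+m}$ is a compact regular partially convex set, and $A$ is isomorphic to $\mathcal{C}_{\mathrm{aff}}(K_A)$ as a free order unit module.
   Context: **Partially convex sets.** Write elements of $\mathbb{R}^{n+m}$ as $(x,y)$, $x\in\mathbb{R}^n$, $y\in\mathbb{R}^m$. For $K\subseteq\mathbb{R}^{n+m}$ let $\pi_2(K)=\{y\in\mathbb{R}^m : \exists x\in\mathbb{R}^n,\ (x,y)\in K\}$ and, for $y\in\pi_2(K)$, $K_y=\{x\in\mathbb{R}^n : (x,y)\in K\}$. $K$ is partially convex in $x$ if $K_y$ is convex for every $y\in\pi_2(K)$. A closed set $K$ is a *regular partially convex set* if it is partially convex in $x$, the interior $\operatorname{int}(K_y)$ in $\mathbb{R}^n$ is nonempty for all $y\in\pi_2(K)$, and the set-valued map $y\mapsto\operatorname{int}(K_y)$ on $\pi_2(K)$ is lower hemicontinuous: for every $y\in\pi_2(K)$, every sequence $y_k\to y$ in $\pi_2(K)$ and every $x\in\operatorname{int}(K_y)$ there are $x_k\in\operatorname{int}(K_{y_k})$ with $x_k\to x$. Two partially convex sets $K,L\subseteq\mathbb{R}^{n+m}$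 are *isomorphic* if there is a homeomorphism $\Theta:K\to L$ of the form $\Theta(x,y)=(\theta_y(x),\phi(y))$ where $\phi:\pi_2(K)\to\pi_2(L)$ is a homeomorphism and, for every $y\in\pi_2(K)$, $\theta_y:K_y\to L_{\phi(y)}$ is an affine homeomorphism. $\mathcal{C}_{\mathrm{aff}}(K)$ denotes the space of continuous functions $f:K\to\mathbb{R}$ such that $x\mapsto f(x,y)$ is affine on $K_y$ for each fixed $y$, with supremum norm; it is ordered pointwise with order unit the constant function $1$. **AOU spaces.** An Archimedean order unit (AOU) space is a real vector space $A$ with a cone $A^+$, $A^+\cap(-A^+)=\{0\}$ (write $a\le b$ if $b-a\in A^+$), and an order unit $u$ (for each $a\in A$ there is $r>0$ with $-ru\le a\le ru$) such that $a\in A^+$ whenever $a+ru\in A^+$ for all $r>0$. Its norm is $\|a\|=\inf\{r>0: -ru\le a\le ru\}$. A state is a positive linear functional $\varphi:A\to\mathbb{R}$ with $\varphi(u)=1$; $\mathcal{S}(A)$ is the set of states with the weak-* topology, and $A$ embeds (Kadison embedding) in $C(\mathcal{S}(A))$ (real-valued functions) by $a\mapsto(\varphi\mapsto\varphi(a))$. An order ideal is a linear subspace $J$ such that $0\le a\le j$, $j\in J$ imply $a\in J$. **Free order unit modules.** A *free order unit module of type $(n,m)$* is a set $A$ with the following structure. 1. $A$ is an AOU space with order unit $u$ and cone $A^+$. 2. $A$ is a module over its multiplicative domain $\mathcal{M}_A=\{z\in A: z\cdot a\in A\ \forall a\in A\}$, the product being the pointwise product in $C(\mathcal{S}(A))$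 via the Kadison embedding. It is assumed that $\mathcal{M}_A$, with the norm inherited from $A$, is a unital commutative real $C^*$-algebra with unit $1_A$, generated as a unital $C^*$-algebra by $m$ elements $g_1,\dots,g_m$. The map $\chi\mapsto(\chi(g_1),\dots,\chi(g_m))$ embeds the character space of $\mathcal{M}_A$ homeomorphically onto a compact set $Y\subseteq\mathbb{R}^m$, giving an isometric $*$-isomorphism $\mathcal{M}_A\cong C(Y)$ (real-valued functions), used as an identification. 3. $A$ is a free $\mathcal{M}_A$-module of rank $n+1$: there is a basis $\{e_0,\dots,e_n\}$ such that each $a\in A$ is uniquely $a=\sum_{i=0}^n c_ie_i$ with $c_i\in\mathcal{M}_A$. 4. $u=e_0$. 5. For $y\in Y$ let $J_y$ be the closed order ideal of $A$ generated by $I_y=\{f\in\mathcal{M}_A\cong C(Y): f(y)=0\}$, $A_y=A/J_y$ with classes $[a]_y$, and $A_y^+=\{[a]_y: a\in A^+\}$. With this cone and the order unit $u_y=[u]_y$, $A_y$ is an AOU space of dimension $n+1$ (its order unit norm is denoted $\|\cdot\|_y$). Moreover $a\in A^+\iff[a]_y\in A_y^+$ for all $y\in Y$. 6. For every sequence $y_k\to y_0$ in $Y$ and $v_k\in A_{y_k}^+$ with $\sup_k\|v_k\|_{y_k}<\infty$, there are a subsequence $(v_{k_j})$, $v_0\in A_{y_0}^+$ and $a\in A$ with $[a]_{y_0}=v_0$ and $\lim_j\|v_{k_j}-[a]_{y_{k_j}}\|_{y_{k_j}}=0$. 7. For some (hence any) module basis with $e_0=u$, the linear isomorphism $A\to C(Y)^{n+1}$,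 $\sum c_ie_i\mapsto(c_0,\dots,c_n)$, is a homeomorphism from $A$ with the order unit norm onto $C(Y)^{n+1}$ with the product supremum norm topology. An *isomorphism of free order unit modules* $\varphi:A\to B$ (both of type $(n,m)$) is a linear bijection with $\varphi(u_A)=u_B$, $\varphi(A^+)=B^+$, whose restriction $\rho=\varphi|_{\mathcal{M}_A}$ maps into $\mathcal{M}_B$ and is an isometric $*$-isomorphism of $C^*$-algebras, and with $\varphi(z\cdot a)=\rho(z)\cdot\varphi(a)$ for all $z\in\mathcal{M}_A$, $a\in A$. **Coordinate state space.** For $y\in Y$, a $y$-state on $A$ is a state $\Phi$ on $A$ with $\Phi(g\cdot f)=g(y)\Phi(f)$ for all $g\in C(Y)\cong\mathcal{M}_A$, $f\in A$; $S_y(A)$ is the set of $y$-states, identified with the state space of $A_y$ (a $y$-state $\Phi$ corresponding to $\psi([a]_y)=\Phi(a)$). Fix a module basis $\{e_0=u,e_1,\dots,e_n\}$ and generators $g_1,\dots,g_m$ (hence $Y\subseteq\mathbb{R}^m$). Put $K_y=\{(\psi([e_1]_y),\dots,\psi([e_n]_y)):\psi\in S_y(A)\}\subseteq\mathbb{R}^n$. The *partially convex coordinate state space* of $A$ is $K_A=\bigcup_{y\in Y}(K_y\times\{y\})\subseteq\mathbb{R}^{n+m}$. Different choices of basis and generators give isomorphic sets; statements about $K_A$ are understood for any such choice.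
   Formalization: Products defining M_A are pointwise on a given compact set of states that determines the order (for C_aff(K): evaluations at points of K), not on all of S(A); with all of S(A), M_A consists only of multiples of u and (1) fails, e.g. for K=[0,1]×{0,1}. *)

theory Defs
  imports "HOL-Analysis.Analysis" "HOL-Library.Function_Algebras"
begin

section \<open>Partially convex sets\<close>

text \<open>The space \<open>R^(n+m)\<close> is the product type \<open>(real^'n) \<times> (real^'m)\<close>.\<close>

definition pi2 :: "('x \<times> 'y) set \<Rightarrow> 'y set" where
  "pi2 K = {y. \<exists>x. (x, y) \<in> K}"

definition fib :: "('x \<times> 'y) set \<Rightarrow> 'y \<Rightarrow> 'x set" where
  "fib K y = {x. (x, y) \<in> K}"

definition partially_convex :: "((real^'n) \<times> (real^'m)) set \<Rightarrow> bool" where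
  "partially_convex K \<longleftrightarrow> (\<forall>y\<in>pi2 K. convex (fib K y))"

definition regular_partially_convex :: "((real^'n) \<times> (real^'m)) set \<Rightarrow> bool" where
  "regular_partially_convex K \<longleftrightarrow>
     closed K \<and> partially_convex K \<and>
     (\<forall>y\<in>pi2 K. interior (fib K y) \<noteq> {}) \<and>
     (\<forall>y\<in>pi2 K. \<forall>s. (\<forall>k. s k \<in> pi2 K) \<and> s \<longlonglongrightarrow> y \<longrightarrow>
        (\<forall>x\<in>interior (fib K y).
           \<exists>t. (\<forall>k::nat. t k \<in> interior (fib K (s k))) \<and> t \<longlonglongrightarrow> x))"

definition affine_on :: "'a::real_vector set \<Rightarrow> ('a \<Rightarrow> 'b::real_vector) \<Rightarrow> bool" where
  "affine_on S f \<longleftrightarrow>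
     (\<forall>x\<in>S. \<forall>y\<in>S. \<forall>t\<in>{0..1}. f ((1 - t) *\<^sub>R x + t *\<^sub>R y) = (1 - t) *\<^sub>R f x + t *\<^sub>R f y)"

definition pc_isomorphic ::
  "((real^'n) \<times> (real^'m)) set \<Rightarrow> ((real^'n) \<times> (real^'m)) set \<Rightarrow> bool" where
  "pc_isomorphic K L \<longleftrightarrow>
     partially_convex K \<and> partially_convex L \<and>
     (\<exists>\<Theta> \<Theta>' \<theta> \<phi> \<phi>'.
        homeomorphism K L \<Theta> \<Theta>' \<and>
        homeomorphism (pi2 K) (pi2 L) \<phi> \<phi>' \<and>
        (\<forall>(x, y)\<in>K. \<Theta> (x, y) = (\<theta> y x, \<phi> y)) \<and>
        (\<forall>y\<in>pi2 K. affine_on (fib K y) (\<theta> y) \<and>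
           (\<exists>\<theta>'. homeomorphism (fib K y) (fib L (\<phi> y)) (\<theta> y) \<theta>')))"

section \<open>Archimedean order unit spaces\<close>

text \<open>A real vector space is given as a subspace \<open>vcarrier A\<close> of a type of class
  \<^class>\<open>real_vector\<close>.\<close>

record 'a ou_space =
  vcarrier :: "'a set"
  pos :: "'a set"
  ounit :: 'a

definition ou_le :: "('a::real_vector, 'z) ou_space_scheme \<Rightarrow> 'a \<Rightarrow> 'a \<Rightarrow> bool" where
  "ou_le A a b \<longleftrightarrow> b - a \<in> pos A"

definition aou_space :: "('a::real_vector, 'z) ou_space_scheme \<Rightarrow> bool" where
  "aou_space A \<longleftrightarrow>
     subspace (vcarrier A) \<and>
     pos A \<subseteq> vcarrier A \<and> convex_cone (pos A) \<and> pos A \<inter> uminus ` pos A = {0} \<and>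
     ounit A \<in> vcarrier A \<and>
     (\<forall>a\<in>vcarrier A. \<exists>r>0. ou_le A (- (r *\<^sub>R ounit A)) a \<and> ou_le A a (r *\<^sub>R ounit A)) \<and>
     (\<forall>a\<in>vcarrier A. (\<forall>r>0. a + r *\<^sub>R ounit A \<in> pos A) \<longrightarrow> a \<in> pos A)"

text \<open>The value \<open>0\<close> outside the carrier is a dummy; it makes \<open>\<lambda>a b. ou_norm A (a - b)\<close>
  nonnegative and symmetric on the whole type, as the locale \<^locale>\<open>Metric_space\<close> requires.\<close>

definition ou_norm :: "('a::real_vector, 'z) ou_space_scheme \<Rightarrow> 'a \<Rightarrow> real" where
  "ou_norm A a =
     (if a \<in> vcarrier A
      then Inf {r. r > 0 \<and> ou_le A (- (r *\<^sub>R ounit A)) a \<and> ou_le A a (r *\<^sub>R ounit A)}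
      else 0)"

definition ou_topology :: "('a::real_vector, 'z) ou_space_scheme \<Rightarrow> 'a topology" where
  "ou_topology A = Metric_space.mtopology (vcarrier A) (\<lambda>a b. ou_norm A (a - b))"

definition linear_on :: "'a::real_vector set \<Rightarrow> ('a \<Rightarrow> 'b::real_vector) \<Rightarrow> bool" where
  "linear_on V f \<longleftrightarrow>
     (\<forall>a\<in>V. \<forall>b\<in>V. f (a + b) = f a + f b) \<and> (\<forall>r. \<forall>a\<in>V. f (r *\<^sub>R a) = r *\<^sub>R f a)"

text \<open>Functionals on a subspace are extensional functions on the ambient type. The weak-*
  topology is then the one inherited from the product topology on \<open>'a \<Rightarrow> real\<close>.\<close>

definition states :: "('a::real_vector, 'z) ou_space_scheme \<Rightarrow> ('a \<Rightarrow> real) set" where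
  "states A = {\<phi> \<in> extensional (vcarrier A).
     linear_on (vcarrier A) \<phi> \<and> (\<forall>a\<in>pos A. 0 \<le> \<phi> a) \<and> \<phi> (ounit A) = 1}"

definition order_ideal :: "('a::real_vector, 'z) ou_space_scheme \<Rightarrow> 'a set \<Rightarrow> bool" where
  "order_ideal A J \<longleftrightarrow>
     subspace J \<and> J \<subseteq> vcarrier A \<and>
     (\<forall>a\<in>vcarrier A. \<forall>j\<in>J. ou_le A 0 a \<and> ou_le A a j \<longrightarrow> a \<in> J)"

definition closed_order_ideal_hull ::
  "('a::real_vector, 'z) ou_space_scheme \<Rightarrow> 'a set \<Rightarrow> 'a set" where
  "closed_order_ideal_hull A I =
     \<Inter>{J. order_ideal A J \<and> closedin (ou_topology A) J \<and> I \<subseteq> J}"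

text \<open>The quotient by a subspace \<open>J\<close> is realised, up to the canonical isomorphism, as the image
  of a linear map with kernel exactly \<open>J\<close>; \<open>vquot J a\<close> plays the role of the class \<open>a + J\<close>.\<close>

definition vquot :: "'a::real_vector set \<Rightarrow> 'a \<Rightarrow> 'a" where
  "vquot J = (SOME q. linear q \<and> {x. q x = 0} = J)"

lemma vquot:
  assumes "subspace J"
  shows "linear (vquot J)" and "vquot J x = vquot J y \<longleftrightarrow> x - y \<in> J"
proof -
  obtain p where p: "range p \<subseteq> J" "linear p" "\<forall>v\<in>J. p v = v"
    using linear_exists_left_inverse_on[OF linear_id assms inj_on_id] by (auto simp only: id_apply)
  have "linear (\<lambda>x. x - p x)"
    by (intro linear_compose_sub linear_ident p)
  moreover have "{x. x - p x = 0} = J"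
  proof safe
    fix x assume "x - p x = 0"
    then have "x = p x" by simp
    moreover have "p x \<in> J" using p(1) by blast
    ultimately show "x \<in> J" by simp
  next
    fix x assume "x \<in> J"
    then show "x - p x = 0" using p(3) by simp
  qed
  ultimately have *: "linear (vquot J) \<and> {x. vquot J x = 0} = J"
    unfolding vquot_def
    using someI[of "\<lambda>q. linear q \<and> {x. q x = 0} = J" "\<lambda>x. x - p x"] by blast
  then show "linear (vquot J)" by simp
  then have "vquot J (x - y) = vquot J x - vquot J y" by (rule linear_diff)
  then have "vquot J x = vquot J y \<longleftrightarrow> vquot J (x - y) = 0" by simp
  with * show "vquot J x = vquot J y \<longleftrightarrow> x - y \<in> J" by blast
qed

definition quotient_ou ::
  "('a::real_vector, 'z) ou_space_scheme \<Rightarrow> 'a set \<Rightarrow> 'a ou_space" where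
  "quotient_ou A J =
     \<lparr>vcarrier = vquot J ` vcarrier A, pos = vquot J ` pos A, ounit = vquot J (ounit A)\<rparr>"

section \<open>Order unit spaces with a multiplicative domain\<close>

text \<open>The field \<open>reps\<close> is a compact set \<open>X\<close> of states of \<open>A\<close>, on which the Kadison
  representation \<open>a \<mapsto> (\<phi> \<mapsto> \<phi> a)\<close> is still an order embedding \<open>A \<rightarrow> C(X)\<close>. Products of elements
  of \<open>A\<close> are pointwise products in \<open>C(X)\<close>.

  \<open>X\<close> cannot be the whole state space: if \<open>z \<cdot> z \<in> A\<close> for the pointwise product on all states, then
  \<open>\<phi> \<mapsto> (\<phi> z)\<^sup>2\<close> is affine on a convex set, so that \<open>z\<close> is a multiple of the unit. Nor can \<open>X\<close> be
  a function of the order unit space: \<open>K = [0,1] \<times> {0,1}\<close> gives \<open>R^4\<close> with its coordinatewise order,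
  and the permutations of the coordinates leave no two-dimensional subspace invariant, while the
  functions of the second variable form such a subspace. For continuous partially affine functions
  on \<open>K\<close>, \<open>X\<close> consists of the evaluations at the points of \<open>K\<close>.\<close>

record 'a ou_module = "'a ou_space" +
  reps :: "('a \<Rightarrow> real) set"

definition kadison_embedded :: "('a::real_vector) ou_module \<Rightarrow> bool" where
  "kadison_embedded A \<longleftrightarrow>
     reps A \<subseteq> states A \<and> compact (reps A) \<and>
     (\<forall>a\<in>vcarrier A. a \<in> pos A \<longleftrightarrow> (\<forall>\<phi>\<in>reps A. 0 \<le> \<phi> a))"

definition omult :: "('a::real_vector) ou_module \<Rightarrow> 'a \<Rightarrow> 'a \<Rightarrow> 'a" where
  "omult A z a = (THE b. b \<in> vcarrier A \<and> (\<forall>\<phi>\<in>reps A. \<phi> b = \<phi> z * \<phi> a))"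

definition mdom :: "('a::real_vector) ou_module \<Rightarrow> 'a set" where
  "mdom A = {z \<in> vcarrier A.
     \<forall>a\<in>vcarrier A. \<exists>b\<in>vcarrier A. \<forall>\<phi>\<in>reps A. \<phi> b = \<phi> z * \<phi> a}"

text \<open>Commutative real C*-algebras with trivial involution (as is the case for real-valued
  functions). The invertibility of \<open>1 + a\<^sup>*a\<close> is part of the definition of a real C*-algebra.\<close>

definition real_comm_cstar_algebra ::
  "'a::real_vector set \<Rightarrow> ('a \<Rightarrow> 'a \<Rightarrow> 'a) \<Rightarrow> 'a \<Rightarrow> ('a \<Rightarrow> real) \<Rightarrow> bool" where
  "real_comm_cstar_algebra M mul one nrm \<longleftrightarrow>
     subspace M \<and> one \<in> M \<and>
     (\<forall>a\<in>M. \<forall>b\<in>M. mul a b \<in> M \<and> mul a b = mul b a) \<and>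
     (\<forall>a\<in>M. mul one a = a) \<and>
     (\<forall>a\<in>M. \<forall>b\<in>M. \<forall>c\<in>M. mul (mul a b) c = mul a (mul b c)) \<and>
     (\<forall>a\<in>M. linear_on M (mul a)) \<and>
     (\<forall>a\<in>M. 0 \<le> nrm a \<and> (nrm a = 0 \<longleftrightarrow> a = 0)) \<and>
     (\<forall>r. \<forall>a\<in>M. nrm (r *\<^sub>R a) = \<bar>r\<bar> * nrm a) \<and>
     (\<forall>a\<in>M. \<forall>b\<in>M. nrm (a + b) \<le> nrm a + nrm b \<and> nrm (mul a b) \<le> nrm a * nrm b) \<and>
     Metric_space.mcomplete M (\<lambda>a b. nrm (a - b)) \<and>
     (\<forall>a\<in>M. nrm (mul a a) = (nrm a)\<^sup>2) \<and>
     (\<forall>a\<in>M. \<exists>b\<in>M. mul (one + mul a a) b = one)"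

definition cstar_generators :: "('a::real_vector) ou_module \<Rightarrow> ('m \<Rightarrow> 'a) \<Rightarrow> bool" where
  "cstar_generators A g \<longleftrightarrow>
     range g \<subseteq> mdom A \<and>
     (\<forall>S. subspace S \<and> S \<subseteq> mdom A \<and> ounit A \<in> S \<and> (\<forall>a\<in>S. \<forall>b\<in>S. omult A a b \<in> S) \<and>
          closedin (subtopology (ou_topology A) (mdom A)) S \<and> range g \<subseteq> S \<longrightarrow> S = mdom A)"

definition characters :: "('a::real_vector) ou_module \<Rightarrow> ('a \<Rightarrow> real) set" where
  "characters A = {\<xi> \<in> extensional (mdom A).
     linear_on (mdom A) \<xi> \<and> \<xi> (ounit A) = 1 \<and>
     (\<forall>z\<in>mdom A. \<forall>w\<in>mdom A. \<xi> (omult A z w) = \<xi> z * \<xi> w)}"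

definition joint_values :: "('m \<Rightarrow> 'a) \<Rightarrow> ('a \<Rightarrow> real) \<Rightarrow> real^'m" where
  "joint_values g \<xi> = (\<chi> i. \<xi> (g i))"

definition spectrum_set :: "('a::real_vector) ou_module \<Rightarrow> ('m \<Rightarrow> 'a) \<Rightarrow> (real^'m) set" where
  "spectrum_set A g = joint_values g ` characters A"

text \<open>\<open>mval A g z y\<close> is the value \<open>z(y)\<close> under the identification of the multiplicative domain
  with \<open>C(Y)\<close>, where \<open>Y = spectrum_set A g\<close>.\<close>

definition mval :: "('a::real_vector) ou_module \<Rightarrow> ('m \<Rightarrow> 'a) \<Rightarrow> 'a \<Rightarrow> real^'m \<Rightarrow> real" where
  "mval A g z y = (THE \<xi>. \<xi> \<in> characters A \<and> joint_values g \<xi> = y) z"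

text \<open>The map \<open>z \<mapsto> mval A g z\<close> is automatically an algebra homomorphism, since
  \<open>\<lambda>z. mval A g z y\<close> is a character. The \<open>0\<close> inserted in the supremum only matters if the
  spectrum is empty.\<close>

definition gelfand_identification :: "('a::real_vector) ou_module \<Rightarrow> ('m::finite \<Rightarrow> 'a) \<Rightarrow> bool"
  where
  "gelfand_identification A g \<longleftrightarrow>
     (let Y = spectrum_set A g in
       compact Y \<and>
       (\<exists>h. homeomorphism (characters A) Y (joint_values g) h) \<and>
       (\<forall>z\<in>mdom A. continuous_on Y (mval A g z) \<and>
          ou_norm A z = Sup (insert 0 ((\<lambda>y. \<bar>mval A g z y\<bar>) ` Y))) \<and>
       (\<forall>f. continuous_on Y f \<longrightarrow> (\<exists>z\<in>mdom A. \<forall>y\<in>Y. mval A g z y = f y)))"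

section \<open>Free order unit modules\<close>

text \<open>A basis \<open>e\<^sub>0, \<dots>, e\<^sub>n\<close> is indexed by \<open>'n option\<close>, with \<^const>\<open>None\<close> for the index \<open>0\<close>.\<close>

definition module_basis :: "('a::real_vector) ou_module \<Rightarrow> ('n::finite option \<Rightarrow> 'a) \<Rightarrow> bool" where
  "module_basis A e \<longleftrightarrow>
     range e \<subseteq> vcarrier A \<and>
     (\<forall>a\<in>vcarrier A. \<exists>!c. range c \<subseteq> mdom A \<and> a = (\<Sum>i\<in>UNIV. omult A (c i) (e i)))"

definition basis_coords ::
  "('a::real_vector) ou_module \<Rightarrow> ('n::finite option \<Rightarrow> 'a) \<Rightarrow> 'a \<Rightarrow> 'n option \<Rightarrow> 'a" where
  "basis_coords A e a =
     (THE c. range c \<subseteq> mdom A \<and> a = (\<Sum>i\<in>UNIV. omult A (c i) (e i)))"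

definition fibre_ideal :: "('a::real_vector) ou_module \<Rightarrow> ('m \<Rightarrow> 'a) \<Rightarrow> real^'m \<Rightarrow> 'a set" where
  "fibre_ideal A g y = closed_order_ideal_hull A {f \<in> mdom A. mval A g f y = 0}"

definition fibre_ou :: "('a::real_vector) ou_module \<Rightarrow> ('m \<Rightarrow> 'a) \<Rightarrow> real^'m \<Rightarrow> 'a ou_space" where
  "fibre_ou A g y = quotient_ou A (fibre_ideal A g y)"

definition fibre_class :: "('a::real_vector) ou_module \<Rightarrow> ('m \<Rightarrow> 'a) \<Rightarrow> real^'m \<Rightarrow> 'a \<Rightarrow> 'a" where
  "fibre_class A g y = vquot (fibre_ideal A g y)"

text \<open>\<open>n\<close> and \<open>m\<close> are the cardinalities of the two type arguments. In the last conjunct the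
  space \<open>C(Y)\<^bsup>n+1\<^esup>\<close> is the product of copies of the (isometrically isomorphic) multiplicative
  domain.\<close>

definition free_ou_module ::
  "'n::finite itself \<Rightarrow> 'm::finite itself \<Rightarrow> ('a::real_vector) ou_module \<Rightarrow> bool" where
  "free_ou_module _ _ A \<longleftrightarrow>
     aou_space A \<and> kadison_embedded A \<and>
     real_comm_cstar_algebra (mdom A) (omult A) (ounit A) (ou_norm A) \<and>
     (\<exists>g :: 'm \<Rightarrow> 'a.
        cstar_generators A g \<and> gelfand_identification A g \<and>
        (\<forall>y\<in>spectrum_set A g.
           aou_space (fibre_ou A g y) \<and> dim (vcarrier (fibre_ou A g y)) = CARD('n) + 1) \<and>
        (\<forall>a\<in>vcarrier A. a \<in> pos A \<longleftrightarrow>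
           (\<forall>y\<in>spectrum_set A g. fibre_class A g y a \<in> pos (fibre_ou A g y))) \<and>
        (\<forall>y y0 v.
           (\<forall>k::nat. y k \<in> spectrum_set A g) \<and> y0 \<in> spectrum_set A g \<and> y \<longlonglongrightarrow> y0 \<and>
           (\<forall>k. v k \<in> pos (fibre_ou A g (y k))) \<and>
           bdd_above (range (\<lambda>k. ou_norm (fibre_ou A g (y k)) (v k))) \<longrightarrow>
           (\<exists>r v0 a. strict_mono r \<and> v0 \<in> pos (fibre_ou A g y0) \<and> a \<in> vcarrier A \<and>
              fibre_class A g y0 a = v0 \<and>
              (\<lambda>j. ou_norm (fibre_ou A g (y (r j)))
                     (v (r j) - fibre_class A g (y (r j)) a)) \<longlonglongrightarrow> 0))) \<and>
     (\<exists>e :: 'n option \<Rightarrow> 'a.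
        module_basis A e \<and> e None = ounit A \<and>
        homeomorphic_map (ou_topology A)
          (product_topology (\<lambda>_. subtopology (ou_topology A) (mdom A)) UNIV)
          (basis_coords A e))"

definition free_ou_module_iso ::
  "'n::finite itself \<Rightarrow> 'm::finite itself \<Rightarrow>
   ('a::real_vector) ou_module \<Rightarrow> ('b::real_vector) ou_module \<Rightarrow> bool" where
  "free_ou_module_iso N M A B \<longleftrightarrow>
     free_ou_module N M A \<and> free_ou_module N M B \<and>
     (\<exists>\<phi>. linear_on (vcarrier A) \<phi> \<and> bij_betw \<phi> (vcarrier A) (vcarrier B) \<and>
        \<phi> (ounit A) = ounit B \<and> \<phi> ` pos A = pos B \<and>
        \<phi> ` mdom A = mdom B \<and>
        (\<forall>z\<in>mdom A. ou_norm B (\<phi> z) = ou_norm A z) \<and>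
        (\<forall>z\<in>mdom A. \<forall>w\<in>mdom A. \<phi> (omult A z w) = omult B (\<phi> z) (\<phi> w)) \<and>
        (\<forall>z\<in>mdom A. \<forall>a\<in>vcarrier A. \<phi> (omult A z a) = omult B (\<phi> z) (\<phi> a)))"

definition y_states ::
  "('a::real_vector) ou_module \<Rightarrow> ('m \<Rightarrow> 'a) \<Rightarrow> real^'m \<Rightarrow> ('a \<Rightarrow> real) set" where
  "y_states A g y = {\<Phi> \<in> states A.
     \<forall>f\<in>mdom A. \<forall>a\<in>vcarrier A. \<Phi> (omult A f a) = mval A g f y * \<Phi> a}"

definition coord_state_space ::
  "('a::real_vector) ou_module \<Rightarrow> ('n::finite option \<Rightarrow> 'a) \<Rightarrow> ('m::finite \<Rightarrow> 'a) \<Rightarrow>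
   ((real^'n) \<times> (real^'m)) set" where
  "coord_state_space A e g =
     (\<Union>y\<in>spectrum_set A g. (\<lambda>\<Phi>. \<chi> i. \<Phi> (e (Some i))) ` y_states A g y \<times> {y})"

section \<open>Continuous partially affine functions\<close>

instantiation "fun" :: (type, real_vector) real_vector
begin

definition "r *\<^sub>R f = (\<lambda>x. r *\<^sub>R f x)"

instance
  by standard (auto simp: scaleR_fun_def fun_eq_iff algebra_simps)

end

text \<open>A function on \<open>K\<close> is represented by its extension by \<open>0\<close>, so that the operations are the
  pointwise ones of the function type. The order unit norm is the supremum norm.\<close>

definition caff_set :: "((real^'n) \<times> (real^'m)) set \<Rightarrow> ((real^'n) \<times> (real^'m) \<Rightarrow> real) set" where
  "caff_set K = {f. (\<forall>p. p \<notin> K \<longrightarrow> f p = 0) \<and> continuous_on K f \<and>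
     (\<forall>y\<in>pi2 K. affine_on (fib K y) (\<lambda>x. f (x, y)))}"

definition C_aff ::
  "((real^'n) \<times> (real^'m)) set \<Rightarrow> ((real^'n) \<times> (real^'m) \<Rightarrow> real) ou_module" where
  "C_aff K =
     \<lparr>vcarrier = caff_set K,
      pos = {f \<in> caff_set K. \<forall>p\<in>K. 0 \<le> f p},
      ounit = (\<lambda>p. if p \<in> K then 1 else 0),
      reps = (\<lambda>p. \<lambda>f\<in>caff_set K. f p) ` K\<rparr>"

end

theory Submission
  imports Defs
begin

text \<open>
Gelfand duality turns the multiplicative domain of a free order unit module into the continuous
functions on its spectrum \<open>Y\<close>. Relative to a basis \<open>e\<^sub>0 = u, e\<^sub>1, \<dots>, e\<^sub>n\<close> an element \<open>a\<close> then
has continuous coordinates, which are combined into \<open>\<beta> : Y \<rightarrow> \<real>\<close> (the coordinate at \<open>u\<close>) and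
\<open>\<alpha> : Y \<rightarrow> \<real>\<^sup>n\<close>. A \<open>y\<close>-state \<open>\<Phi>\<close> respects the module structure, so it is determined by the point
\<open>x = (\<Phi>(e\<^sub>1), \<dots>, \<Phi>(e\<^sub>n))\<close> and satisfies \<open>\<Phi>(a) = \<beta>(y) + \<alpha>(y) \<bullet> x\<close>. On the coordinate state space
an element is therefore a function \<open>(x, y) \<mapsto> \<beta>(y) + \<alpha>(y) \<bullet> x\<close> with continuous coefficients, and
everything reduces to a comparison of such functions with the continuous partially affine ones.

The two notions agree on a compact regular set \<open>K\<close> (\<open>caff_coefficients\<close>). By lower
hemicontinuity a small ball around an interior point of a fibre is contained in all nearby
fibres (\<open>interior_fib_persists\<close>); the coefficients of \<open>f\<close> are difference quotients of \<open>f\<close> at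
fixed points of this ball and so depend continuously on \<open>y\<close>. The coordinates \<open>1, x\<^sub>1, \<dots>, x\<^sub>n\<close>
thus form a module basis. The square of a nonconstant affine function is not affine, so the
multiplicative domain consists of the functions of \<open>y\<close> (\<open>mdom_lift_base\<close>); its characters are
evaluations (\<open>character_is_eval\<close>) and the coordinates \<open>y\<^sub>1, \<dots>, y\<^sub>m\<close> generate it by the
Stone-Weierstrass theorem. The order ideal at \<open>y\<close> consists of the functions that vanish on the
fibre. A function that is nonnegative on one fibre becomes nonnegative on \<open>K\<close> after a correction
that vanishes on that fibre, because the minimum over the fibres is continuous
(\<open>extend_positive\<close>); so the quotient at \<open>y\<close> is ordered as the affine functions on the fibre. The
compactness condition on sequences is the Bolzano-Weierstrass theorem for coefficients
(\<open>fibre_liminf_C_aff\<close>). Every \<open>y\<close>-state is an evaluation (\<open>y_state_is_evaluation\<close>), which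
identifies \<open>K\<close> with its coordinate state space.

Conversely, let \<open>A\<close> be a free order unit module. Since the fibres have dimension \<open>n + 1\<close>, the
ideal at \<open>y\<close> consists of the elements whose coordinates vanish at \<open>y\<close> (\<open>fibre_ideal_iff\<close>). The
coordinates of the positive elements at \<open>y\<close> form a closed pointed cone in \<open>\<real> \<times> \<real>\<^sup>n\<close>, and the
slice of the coordinate state space is a base of the dual cone (\<open>cone_at_iff_dual\<close>). Pointedness
of the cone gives the slice interior points. If an interior point \<open>x\<close> of the slice at \<open>y\<^sub>0\<close> left
the interiors of the slices at points \<open>y\<^sub>k \<longlonglongrightarrow> y\<^sub>0\<close>, then the compactness condition would yield a
limit of separating functionals, a nonconstant affine function that is nonnegative on the slice
at \<open>y\<^sub>0\<close> and vanishes at \<open>x\<close> (\<open>interior_dual_slice_persists\<close>). To pass from convergence in the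
fibre norms to convergence of coordinates one needs a bound for coordinates by fibre norms that
is uniform in \<open>y\<close> (\<open>coord_bounded_by_values\<close>), which comes from the topological isomorphism of
\<open>A\<close> with \<open>C(Y)\<^bsup>n+1\<^esup>\<close>. The coordinate state space is thus compact and regular, and the first part
of the argument shows that \<open>a \<mapsto> \<beta>(y) + \<alpha>(y) \<bullet> x\<close> maps \<open>A\<close> onto the continuous partially affine
functions.

The definition provides one system of generators and one basis. The fibres depend only on the
points of the character space, and any two bases are related by a matrix with entries in the
multiplicative domain, so that the conditions hold for all generators and bases
(\<open>fibre_conditions_change_generators\<close>, \<open>coords_bounded_change_basis\<close>).
\<close>

section \<open>Order unit spaces embedded by a compact set of states\<close>

text \<open>The order is determined by the states in \<^const>\<open>reps\<close>, and on them products are computed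
  pointwise. Identities and inequalities are therefore tested on these states, where they reduce
  to those of real numbers.\<close>

locale kadison_space =
  fixes A :: "('a::real_vector) ou_module"
  assumes aou: "aou_space A" and emb: "kadison_embedded A"
begin

lemma subspace_carrier: "subspace (vcarrier A)"
  using aou by (simp add: aou_space_def)

lemma unit_carrier [simp]: "ounit A \<in> vcarrier A"
  using aou by (simp add: aou_space_def)

lemma zero_carrier [simp]: "0 \<in> vcarrier A"
  using subspace_carrier by (simp add: subspace_def)

lemma add_carrier [simp]: "a \<in> vcarrier A \<Longrightarrow> b \<in> vcarrier A \<Longrightarrow> a + b \<in> vcarrier A"
  using subspace_carrier by (simp add: subspace_add)

lemma diff_carrier [simp]: "a \<in> vcarrier A \<Longrightarrow> b \<in> vcarrier A \<Longrightarrow> a - b \<in> vcarrier A"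
  using subspace_carrier by (simp add: subspace_diff)

lemma scale_carrier [simp]: "a \<in> vcarrier A \<Longrightarrow> r *\<^sub>R a \<in> vcarrier A"
  using subspace_carrier by (simp add: subspace_scale)

lemma neg_carrier [simp]: "a \<in> vcarrier A \<Longrightarrow> - a \<in> vcarrier A"
  using subspace_carrier by (simp add: subspace_neg)

lemma sum_carrier [simp]: "(\<And>i. i \<in> I \<Longrightarrow> f i \<in> vcarrier A) \<Longrightarrow> sum f I \<in> vcarrier A"
  using subspace_carrier by (simp add: subspace_sum)

lemma pos_carrier: "a \<in> pos A \<Longrightarrow> a \<in> vcarrier A"
  using aou by (auto simp: aou_space_def)

lemma rep_states: "\<phi> \<in> reps A \<Longrightarrow> \<phi> \<in> states A"
  using emb by (auto simp: kadison_embedded_def)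

lemma rep_unit [simp]: "\<phi> \<in> reps A \<Longrightarrow> \<phi> (ounit A) = 1"
  using rep_states by (auto simp: states_def)

lemma rep_add [simp]:
  "\<phi> \<in> reps A \<Longrightarrow> a \<in> vcarrier A \<Longrightarrow> b \<in> vcarrier A \<Longrightarrow> \<phi> (a + b) = \<phi> a + \<phi> b"
  using rep_states by (auto simp: states_def linear_on_def)

lemma rep_scale [simp]: "\<phi> \<in> reps A \<Longrightarrow> a \<in> vcarrier A \<Longrightarrow> \<phi> (r *\<^sub>R a) = r * \<phi> a"
  using rep_states by (auto simp: states_def linear_on_def)

lemma rep_zero [simp]: "\<phi> \<in> reps A \<Longrightarrow> \<phi> 0 = 0"
  using rep_scale[of \<phi> 0 0] by simp

lemma rep_neg [simp]: "\<phi> \<in> reps A \<Longrightarrow> a \<in> vcarrier A \<Longrightarrow> \<phi> (- a) = - \<phi> a"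
  using rep_scale[of \<phi> a "-1"] by simp

lemma rep_diff [simp]:
  "\<phi> \<in> reps A \<Longrightarrow> a \<in> vcarrier A \<Longrightarrow> b \<in> vcarrier A \<Longrightarrow> \<phi> (a - b) = \<phi> a - \<phi> b"
  using rep_add[of \<phi> a "- b"] by simp

lemma rep_sum:
  assumes "\<phi> \<in> reps A" "\<And>i. i \<in> I \<Longrightarrow> f i \<in> vcarrier A"
  shows "\<phi> (sum f I) = (\<Sum>i\<in>I. \<phi> (f i))"
  using assms(2)
proof (induction I rule: infinite_finite_induct)
  case (insert i I)
  then have "sum f I \<in> vcarrier A" "f i \<in> vcarrier A" by auto
  with insert assms(1) show ?case by simp
qed (use assms(1) in auto)

lemma pos_iff: "a \<in> vcarrier A \<Longrightarrow> a \<in> pos A \<longleftrightarrow> (\<forall>\<phi>\<in>reps A. 0 \<le> \<phi> a)"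
  using emb by (simp add: kadison_embedded_def)

lemma ou_le_iff:
  "a \<in> vcarrier A \<Longrightarrow> b \<in> vcarrier A \<Longrightarrow> ou_le A a b \<longleftrightarrow> (\<forall>\<phi>\<in>reps A. \<phi> a \<le> \<phi> b)"
  by (simp add: ou_le_def pos_iff)

text \<open>The states in \<^const>\<open>reps\<close> separate points because the positive cone is proper.\<close>

lemma rep_eqI:
  assumes "a \<in> vcarrier A" "b \<in> vcarrier A" "\<And>\<phi>. \<phi> \<in> reps A \<Longrightarrow> \<phi> a = \<phi> b"
  shows "a = b"
proof -
  have "a - b \<in> pos A" "b - a \<in> pos A"
    by (simp_all add: pos_iff assms)
  then have "a - b \<in> pos A \<inter> uminus ` pos A"
    by (auto intro!: image_eqI[of _ _ "b - a"])
  then have "a - b = 0"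
    using aou unfolding aou_space_def by blast
  then show ?thesis by simp
qed

subsection \<open>The order unit norm\<close>

lemma unit_ball_iff:
  assumes "a \<in> vcarrier A"
  shows "ou_le A (- (r *\<^sub>R ounit A)) a \<and> ou_le A a (r *\<^sub>R ounit A) \<longleftrightarrow>
    (\<forall>\<phi>\<in>reps A. \<bar>\<phi> a\<bar> \<le> r)"
  using assms by (auto simp: ou_le_iff abs_le_iff)

lemma ou_norm_eq:
  "a \<in> vcarrier A \<Longrightarrow> ou_norm A a = Inf {r. r > 0 \<and> (\<forall>\<phi>\<in>reps A. \<bar>\<phi> a\<bar> \<le> r)}"
  by (simp add: ou_norm_def unit_ball_iff)

lemma unit_ball_ex:
  assumes "a \<in> vcarrier A"
  shows "\<exists>r>0. \<forall>\<phi>\<in>reps A. \<bar>\<phi> a\<bar> \<le> r"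
proof -
  obtain r where "r > 0" "ou_le A (- (r *\<^sub>R ounit A)) a \<and> ou_le A a (r *\<^sub>R ounit A)"
    using aou assms by (auto simp: aou_space_def)
  then show ?thesis
    using unit_ball_iff[OF assms] by auto
qed

lemma ou_norm_nonneg [simp]: "0 \<le> ou_norm A a"
proof (cases "a \<in> vcarrier A")
  case True
  then show ?thesis
    using unit_ball_ex[OF True] by (auto simp: ou_norm_eq intro!: cInf_greatest)
qed (simp add: ou_norm_def)

text \<open>The norm is the supremum of \<open>\<bar>\<phi> a\<bar>\<close>. As a comparison with \<open>r \<ge> 0\<close> this remains true if
  there is no state, that is, if the space is zero.\<close>

lemma ou_norm_le_iff:
  assumes "a \<in> vcarrier A" "0 \<le> r"
  shows "ou_norm A a \<le> r \<longleftrightarrow> (\<forall>\<phi>\<in>reps A. \<bar>\<phi> a\<bar> \<le> r)"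
proof
  let ?R = "{r. r > 0 \<and> (\<forall>\<phi>\<in>reps A. \<bar>\<phi> a\<bar> \<le> r)}"
  assume L: "ou_norm A a \<le> r"
  show "\<forall>\<phi>\<in>reps A. \<bar>\<phi> a\<bar> \<le> r"
  proof
    fix \<phi> assume "\<phi> \<in> reps A"
    then have "\<bar>\<phi> a\<bar> \<le> Inf ?R"
      using unit_ball_ex[OF assms(1)] by (intro cInf_greatest) auto
    with L show "\<bar>\<phi> a\<bar> \<le> r"
      using assms(1) by (simp add: ou_norm_eq)
  qed
next
  assume R: "\<forall>\<phi>\<in>reps A. \<bar>\<phi> a\<bar> \<le> r"
  show "ou_norm A a \<le> r"
  proof (rule field_le_epsilon)
    fix e :: real assume "e > 0"
    show "ou_norm A a \<le> r + e"
      unfolding ou_norm_eq[OF assms(1)]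
    proof (rule cInf_lower)
      show "bdd_below {r. 0 < r \<and> (\<forall>\<phi>\<in>reps A. \<bar>\<phi> a\<bar> \<le> r)}"
        by (auto intro!: bdd_belowI[of _ 0])
      show "r + e \<in> {r. 0 < r \<and> (\<forall>\<phi>\<in>reps A. \<bar>\<phi> a\<bar> \<le> r)}"
        using R \<open>e > 0\<close> assms(2) by (auto intro: order_trans)
    qed
  qed
qed

lemma rep_le_norm: "a \<in> vcarrier A \<Longrightarrow> \<phi> \<in> reps A \<Longrightarrow> \<bar>\<phi> a\<bar> \<le> ou_norm A a"
  using ou_norm_le_iff[of a "ou_norm A a"] by simp

lemma ou_norm_zero_iff: "a \<in> vcarrier A \<Longrightarrow> ou_norm A a = 0 \<longleftrightarrow> a = 0"
proof -
  assume a: "a \<in> vcarrier A"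
  have "ou_norm A a = 0 \<longleftrightarrow> (\<forall>\<phi>\<in>reps A. \<bar>\<phi> a\<bar> \<le> 0)"
    using ou_norm_le_iff[OF a, of 0] ou_norm_nonneg[of a] by auto
  also have "\<dots> \<longleftrightarrow> a = 0"
    using a rep_eqI[of a 0] by auto
  finally show ?thesis .
qed

lemma ou_norm_scale: "a \<in> vcarrier A \<Longrightarrow> ou_norm A (r *\<^sub>R a) = \<bar>r\<bar> * ou_norm A a"
proof (rule antisym)
  have le: "ou_norm A (r *\<^sub>R a) \<le> \<bar>r\<bar> * ou_norm A a" if "a \<in> vcarrier A" for r a
    using that by (subst ou_norm_le_iff) (auto simp: abs_mult rep_le_norm intro!: mult_left_mono)
  assume a: "a \<in> vcarrier A"
  show "ou_norm A (r *\<^sub>R a) \<le> \<bar>r\<bar> * ou_norm A a" by (rule le[OF a])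
  show "\<bar>r\<bar> * ou_norm A a \<le> ou_norm A (r *\<^sub>R a)"
  proof (cases "r = 0")
    case False
    then have "ou_norm A a \<le> \<bar>inverse r\<bar> * ou_norm A (r *\<^sub>R a)"
      using le[of "r *\<^sub>R a" "inverse r"] a by simp
    then show ?thesis
      using False by (simp add: field_simps)
  qed simp
qed

lemma ou_norm_neg: "ou_norm A (- a) = ou_norm A a"
proof (cases "a \<in> vcarrier A")
  case True
  then show ?thesis using ou_norm_scale[of a "-1"] by simp
next
  case False
  then have "- a \<notin> vcarrier A" using neg_carrier[of "- a"] by auto
  with False show ?thesis by (simp add: ou_norm_def)
qed

lemma ou_norm_triangle:
  "a \<in> vcarrier A \<Longrightarrow> b \<in> vcarrier A \<Longrightarrow> ou_norm A (a + b) \<le> ou_norm A a + ou_norm A b"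
  by (subst ou_norm_le_iff) (auto intro!: order_trans[OF abs_triangle_ineq] add_mono rep_le_norm)

lemma ou_norm_sum:
  assumes "\<And>i. i \<in> I \<Longrightarrow> f i \<in> vcarrier A"
  shows "ou_norm A (sum f I) \<le> (\<Sum>i\<in>I. ou_norm A (f i))"
  using assms
proof (induction I rule: infinite_finite_induct)
  case (insert i I)
  then have "sum f I \<in> vcarrier A" "f i \<in> vcarrier A" by auto
  with insert ou_norm_triangle[of "f i" "sum f I"] show ?case by auto
qed (use ou_norm_zero_iff[of 0] in auto)

lemma pos_add: "a \<in> pos A \<Longrightarrow> b \<in> pos A \<Longrightarrow> a + b \<in> pos A"
  using pos_iff[of a] pos_iff[of b] pos_iff[of "a + b"] by (simp add: pos_carrier)

lemma pos_scale: "a \<in> pos A \<Longrightarrow> 0 \<le> r \<Longrightarrow> r *\<^sub>R a \<in> pos A"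
  using pos_iff[of a] pos_iff[of "r *\<^sub>R a"] by (simp add: pos_carrier)

lemma norm_unit_plus_pos: "a \<in> vcarrier A \<Longrightarrow> ou_norm A a \<le> r \<Longrightarrow> r *\<^sub>R ounit A + a \<in> pos A"
  using rep_le_norm[of a] by (auto simp: pos_iff) (smt (verit))

lemma ou_norm_le_iff_pos:
  assumes "a \<in> vcarrier A" "0 \<le> r"
  shows "ou_norm A a \<le> r \<longleftrightarrow> r *\<^sub>R ounit A + a \<in> pos A \<and> r *\<^sub>R ounit A - a \<in> pos A"
  using assms by (auto simp: ou_norm_le_iff pos_iff abs_le_iff)

lemma metric_ou: "Metric_space (vcarrier A) (\<lambda>a b. ou_norm A (a - b))"
proof
  show "ou_norm A (a - b) = ou_norm A (b - a)" for a b
    using ou_norm_neg[of "a - b"] by simp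
  show "ou_norm A (a - c) \<le> ou_norm A (a - b) + ou_norm A (b - c)"
    if "a \<in> vcarrier A" "b \<in> vcarrier A" "c \<in> vcarrier A" for a b c
    using ou_norm_triangle[of "a - b" "b - c"] that by simp
qed (auto simp: ou_norm_zero_iff)

lemma topspace_ou [simp]: "topspace (ou_topology A) = vcarrier A"
  by (simp add: ou_topology_def Metric_space.topspace_mtopology[OF metric_ou])

lemma closedin_ou_iff:
  assumes "J \<subseteq> vcarrier A"
  shows "closedin (ou_topology A) J \<longleftrightarrow>
    (\<forall>a\<in>vcarrier A. (\<forall>\<epsilon>>0. \<exists>b\<in>J. ou_norm A (a - b) < \<epsilon>) \<longrightarrow> a \<in> J)"
  unfolding ou_topology_def Metric_space.closedin_metric[OF metric_ou] disjnt_iff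
    Metric_space.in_mball[OF metric_ou]
  using assms by (auto simp: subset_iff) (metis DiffI not_le)+

subsection \<open>The multiplicative domain\<close>

lemma mdom_carrier [simp]: "z \<in> mdom A \<Longrightarrow> z \<in> vcarrier A"
  by (simp add: mdom_def)

lemma mdomI:
  "z \<in> vcarrier A \<Longrightarrow>
   (\<And>a. a \<in> vcarrier A \<Longrightarrow> \<exists>b\<in>vcarrier A. \<forall>\<phi>\<in>reps A. \<phi> b = \<phi> z * \<phi> a) \<Longrightarrow> z \<in> mdom A"
  unfolding mdom_def by blast

lemma omult_eqI:
  assumes "a \<in> vcarrier A" "b \<in> vcarrier A" "\<And>\<phi>. \<phi> \<in> reps A \<Longrightarrow> \<phi> b = \<phi> z * \<phi> a"
  shows "omult A z a = b"
  unfolding omult_def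
proof (rule the_equality)
  show "b \<in> vcarrier A \<and> (\<forall>\<phi>\<in>reps A. \<phi> b = \<phi> z * \<phi> a)"
    using assms by blast
next
  fix c assume "c \<in> vcarrier A \<and> (\<forall>\<phi>\<in>reps A. \<phi> c = \<phi> z * \<phi> a)"
  then show "c = b" by (intro rep_eqI) (use assms in metis)+
qed

lemma omult:
  assumes "z \<in> mdom A" "a \<in> vcarrier A"
  shows "omult A z a \<in> vcarrier A" "\<phi> \<in> reps A \<Longrightarrow> \<phi> (omult A z a) = \<phi> z * \<phi> a"
proof -
  obtain b where b: "b \<in> vcarrier A" "\<forall>\<phi>\<in>reps A. \<phi> b = \<phi> z * \<phi> a"
    using assms unfolding mdom_def by blast
  then have "omult A z a = b" using assms by (intro omult_eqI) blast+
  with b show "omult A z a \<in> vcarrier A" "\<phi> \<in> reps A \<Longrightarrow> \<phi> (omult A z a) = \<phi> z * \<phi> a"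
    by blast+
qed

declare omult [simp]

lemma subspace_mdom: "subspace (mdom A)"
proof -
  have "0 \<in> mdom A" by (rule mdomI) (auto intro!: bexI[of _ 0])
  moreover have "z + w \<in> mdom A" if "z \<in> mdom A" "w \<in> mdom A" for z w
  proof (rule mdomI)
    fix a assume "a \<in> vcarrier A"
    then show "\<exists>b\<in>vcarrier A. \<forall>\<phi>\<in>reps A. \<phi> b = \<phi> (z + w) * \<phi> a"
      using that by (intro bexI[of _ "omult A z a + omult A w a"]) (auto simp: distrib_right)
  qed (use that in auto)
  moreover have "r *\<^sub>R z \<in> mdom A" if "z \<in> mdom A" for z r
  proof (rule mdomI)
    fix a assume "a \<in> vcarrier A"
    then show "\<exists>b\<in>vcarrier A. \<forall>\<phi>\<in>reps A. \<phi> b = \<phi> (r *\<^sub>R z) * \<phi> a"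
      using that by (intro bexI[of _ "r *\<^sub>R omult A z a"]) auto
  qed (use that in auto)
  ultimately show ?thesis by (simp add: subspace_def)
qed

lemma mdom_zero [simp]: "0 \<in> mdom A"
  and mdom_add [simp]: "z \<in> mdom A \<Longrightarrow> w \<in> mdom A \<Longrightarrow> z + w \<in> mdom A"
  and mdom_diff [simp]: "z \<in> mdom A \<Longrightarrow> w \<in> mdom A \<Longrightarrow> z - w \<in> mdom A"
  and mdom_scale [simp]: "z \<in> mdom A \<Longrightarrow> r *\<^sub>R z \<in> mdom A"
  and mdom_sum [simp]: "(\<And>i. i \<in> I \<Longrightarrow> f i \<in> mdom A) \<Longrightarrow> sum f I \<in> mdom A"
  using subspace_mdom
  by (blast intro: subspace_0 subspace_add subspace_diff subspace_scale subspace_sum)+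

lemma mdom_unit [simp]: "ounit A \<in> mdom A"
  by (rule mdomI) auto

lemma mdom_omult [simp]: "z \<in> mdom A \<Longrightarrow> w \<in> mdom A \<Longrightarrow> omult A z w \<in> mdom A"
proof (rule mdomI)
  fix a assume a: "a \<in> vcarrier A" and zw: "z \<in> mdom A" "w \<in> mdom A"
  then show "\<exists>b\<in>vcarrier A. \<forall>\<phi>\<in>reps A. \<phi> b = \<phi> (omult A z w) * \<phi> a"
    by (intro bexI[of _ "omult A z (omult A w a)"]) auto
qed auto

lemma omult_unit_left [simp]: "a \<in> vcarrier A \<Longrightarrow> omult A (ounit A) a = a"
  by (rule omult_eqI) auto

lemma omult_unit_right [simp]: "z \<in> mdom A \<Longrightarrow> omult A z (ounit A) = z"
  by (rule omult_eqI) auto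

lemma omult_zero_left [simp]: "a \<in> vcarrier A \<Longrightarrow> omult A 0 a = 0"
  by (rule omult_eqI) auto

lemma omult_commute: "z \<in> mdom A \<Longrightarrow> w \<in> mdom A \<Longrightarrow> omult A z w = omult A w z"
  by (rule omult_eqI) auto

lemma omult_assoc:
  "z \<in> mdom A \<Longrightarrow> w \<in> mdom A \<Longrightarrow> a \<in> vcarrier A \<Longrightarrow>
   omult A (omult A z w) a = omult A z (omult A w a)"
  by (rule omult_eqI) auto

lemma omult_add_left:
  "z \<in> mdom A \<Longrightarrow> w \<in> mdom A \<Longrightarrow> a \<in> vcarrier A \<Longrightarrow>
   omult A (z + w) a = omult A z a + omult A w a"
  by (rule omult_eqI) (auto simp: algebra_simps)

lemma omult_diff_left:
  "z \<in> mdom A \<Longrightarrow> w \<in> mdom A \<Longrightarrow> a \<in> vcarrier A \<Longrightarrow>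
   omult A (z - w) a = omult A z a - omult A w a"
  by (rule omult_eqI) (auto simp: algebra_simps)

lemma omult_scale_left:
  "z \<in> mdom A \<Longrightarrow> a \<in> vcarrier A \<Longrightarrow> omult A (r *\<^sub>R z) a = r *\<^sub>R omult A z a"
  by (rule omult_eqI) auto

lemma omult_add_right:
  "z \<in> mdom A \<Longrightarrow> a \<in> vcarrier A \<Longrightarrow> b \<in> vcarrier A \<Longrightarrow>
   omult A z (a + b) = omult A z a + omult A z b"
  by (rule omult_eqI) (auto simp: algebra_simps)

lemma omult_scale_right:
  "z \<in> mdom A \<Longrightarrow> a \<in> vcarrier A \<Longrightarrow> omult A z (r *\<^sub>R a) = r *\<^sub>R omult A z a"
  by (rule omult_eqI) auto

lemma omult_sum_right:
  assumes "z \<in> mdom A" "\<And>i. i \<in> I \<Longrightarrow> a i \<in> vcarrier A"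
  shows "omult A z (sum a I) = (\<Sum>i\<in>I. omult A z (a i))"
  by (rule omult_eqI) (use assms in \<open>auto simp: rep_sum sum_distrib_left intro!: sum.cong\<close>)

lemma ou_norm_omult:
  assumes "z \<in> mdom A" "a \<in> vcarrier A"
  shows "ou_norm A (omult A z a) \<le> ou_norm A z * ou_norm A a"
  using assms by (subst ou_norm_le_iff) (auto simp: abs_mult rep_le_norm intro!: mult_mono)

lemma ou_norm_square:
  assumes "z \<in> mdom A"
  shows "ou_norm A (omult A z z) = (ou_norm A z)\<^sup>2"
proof (rule antisym)
  show "ou_norm A (omult A z z) \<le> (ou_norm A z)\<^sup>2"
    using ou_norm_omult[of z z] assms by (simp add: power2_eq_square)
  have "ou_norm A z \<le> sqrt (ou_norm A (omult A z z))"
  proof (subst ou_norm_le_iff)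
    show "\<forall>\<phi>\<in>reps A. \<bar>\<phi> z\<bar> \<le> sqrt (ou_norm A (omult A z z))"
    proof
      fix \<phi> assume "\<phi> \<in> reps A"
      then have "(\<phi> z)\<^sup>2 \<le> ou_norm A (omult A z z)"
        using rep_le_norm[of "omult A z z" \<phi>] assms by (simp add: power2_eq_square)
      then show "\<bar>\<phi> z\<bar> \<le> sqrt (ou_norm A (omult A z z))"
        by (metis real_sqrt_abs real_sqrt_le_mono)
    qed
  qed (use assms in auto)
  then have "(ou_norm A z)\<^sup>2 \<le> (sqrt (ou_norm A (omult A z z)))\<^sup>2"
    by (intro power_mono) auto
  then show "(ou_norm A z)\<^sup>2 \<le> ou_norm A (omult A z z)" by simp
qed

lemma submetric_mdom: "Submetric (vcarrier A) (\<lambda>a b. ou_norm A (a - b)) (mdom A)"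
  by (intro Submetric.intro metric_ou Submetric_axioms.intro) auto

lemma mtopology_mdom:
  "subtopology (ou_topology A) (mdom A) = Metric_space.mtopology (mdom A) (\<lambda>a b. ou_norm A (a - b))"
  unfolding ou_topology_def by (rule Submetric.mtopology_submetric[OF submetric_mdom, symmetric])

lemma metric_mdom: "Metric_space (mdom A) (\<lambda>a b. ou_norm A (a - b))"
  by (rule Metric_space.subspace[OF metric_ou]) auto

text \<open>Since products are computed pointwise on a set of states that determines the order, only
  completeness and the inverses of \<open>1 + a\<^sup>2\<close> are left to check.\<close>

lemma real_comm_cstar_algebra_mdomI:
  assumes "Metric_space.mcomplete (mdom A) (\<lambda>a b. ou_norm A (a - b))"
    and "\<And>a. a \<in> mdom A \<Longrightarrow> \<exists>b\<in>mdom A. omult A (ounit A + omult A a a) b = ounit A"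
  shows "real_comm_cstar_algebra (mdom A) (omult A) (ounit A) (ou_norm A)"
  unfolding real_comm_cstar_algebra_def
  using assms subspace_mdom
  by (auto simp: omult_assoc linear_on_def omult_add_right omult_scale_right ou_norm_zero_iff
      ou_norm_scale ou_norm_triangle ou_norm_omult ou_norm_square intro: omult_commute)

end

section \<open>The multiplicative domain as a function algebra\<close>

context kadison_space
begin

lemma closedin_mdom_iff:
  assumes "J \<subseteq> mdom A"
  shows "closedin (subtopology (ou_topology A) (mdom A)) J \<longleftrightarrow>
    (\<forall>a\<in>mdom A. (\<forall>\<epsilon>>0. \<exists>b\<in>J. ou_norm A (a - b) < \<epsilon>) \<longrightarrow> a \<in> J)"
  unfolding mtopology_mdom Metric_space.closedin_metric[OF metric_mdom] disjnt_iff
    Metric_space.in_mball[OF metric_mdom]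
  using assms by (auto simp: subset_iff) (metis DiffI not_le)+

lemma charactersD:
  assumes "\<xi> \<in> characters A" "z \<in> mdom A" "w \<in> mdom A"
  shows "\<xi> (z + w) = \<xi> z + \<xi> w" "\<xi> (r *\<^sub>R z) = r * \<xi> z" "\<xi> (omult A z w) = \<xi> z * \<xi> w"
    "\<xi> (z - w) = \<xi> z - \<xi> w" "\<xi> (ounit A) = 1" "\<xi> 0 = 0"
proof -
  have add: "\<xi> (z + w) = \<xi> z + \<xi> w" and sc: "\<xi> (r *\<^sub>R z) = r * \<xi> z"
    if "z \<in> mdom A" "w \<in> mdom A" for z w r
    using assms(1) that by (auto simp: characters_def linear_on_def)
  show "\<xi> (z + w) = \<xi> z + \<xi> w" "\<xi> (r *\<^sub>R z) = r * \<xi> z"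
    using add sc assms by blast+
  show "\<xi> (omult A z w) = \<xi> z * \<xi> w" "\<xi> (ounit A) = 1"
    using assms by (auto simp: characters_def)
  show "\<xi> (z - w) = \<xi> z - \<xi> w"
    using add[of "z - w" w] assms by simp
  show "\<xi> 0 = 0"
    using sc[of z z 0] assms by simp
qed

lemma restrict_rep_character: "\<phi> \<in> reps A \<Longrightarrow> restrict \<phi> (mdom A) \<in> characters A"
  by (auto simp: characters_def linear_on_def)

lemma order_ideal_carrier: "order_ideal A (vcarrier A)"
  by (simp add: order_ideal_def subspace_carrier)

lemma closed_order_ideal_hull:
  assumes "I \<subseteq> vcarrier A"
  shows "order_ideal A (closed_order_ideal_hull A I)" "I \<subseteq> closed_order_ideal_hull A I"
proof -
  let ?F = "{J. order_ideal A J \<and> closedin (ou_topology A) J \<and> I \<subseteq> J}"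
  have "vcarrier A \<in> ?F"
    using assms order_ideal_carrier closedin_topspace[of "ou_topology A"] by simp
  then show "order_ideal A (closed_order_ideal_hull A I)"
    unfolding closed_order_ideal_hull_def order_ideal_def
    by (intro conjI subspace_Inter) (blast+)
  show "I \<subseteq> closed_order_ideal_hull A I"
    unfolding closed_order_ideal_hull_def by blast
qed

lemma closed_order_ideal_hull_least:
  "order_ideal A J \<Longrightarrow> closedin (ou_topology A) J \<Longrightarrow> I \<subseteq> J \<Longrightarrow>
   closed_order_ideal_hull A I \<subseteq> J"
  unfolding closed_order_ideal_hull_def by blast

end

lemma continuous_on_joint_values: "continuous_on S (joint_values g)"
  unfolding joint_values_def
  by (intro continuous_on_vec_lambda continuous_on_subset[OF continuous_on_product_coordinates])
    auto

locale gelfand_space = kadison_space A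
  for A :: "('a::real_vector) ou_module" +
  fixes g :: "'m::finite \<Rightarrow> 'a"
  assumes gens_mdom: "range g \<subseteq> mdom A" and gelfand: "gelfand_identification A g"
begin

abbreviation "Y \<equiv> spectrum_set A g"

lemma compact_spectrum: "compact Y"
  using gelfand by (simp add: gelfand_identification_def Let_def)

lemma inj_joint_values: "inj_on (joint_values g) (characters A)"
  using gelfand unfolding gelfand_identification_def Let_def homeomorphism_def
  by (metis inj_onI)

lemma mval_character:
  assumes "\<xi> \<in> characters A"
  shows "mval A g z (joint_values g \<xi>) = \<xi> z"
proof -
  have "(THE \<xi>'. \<xi>' \<in> characters A \<and> joint_values g \<xi>' = joint_values g \<xi>) = \<xi>"
    using assms inj_joint_values by (intro the_equality) (auto dest: inj_onD)
  then show ?thesis by (simp add: mval_def)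
qed

lemma spectrum_character:
  assumes "y \<in> Y"
  obtains \<xi> where "\<xi> \<in> characters A" "y = joint_values g \<xi>" "\<And>z. mval A g z y = \<xi> z"
  using assms mval_character by (auto simp: spectrum_set_def)

lemma
  assumes "y \<in> Y"
  shows mval_unit [simp]: "mval A g (ounit A) y = 1"
    and mval_zero [simp]: "mval A g 0 y = 0"
    and mval_add [simp]: "z \<in> mdom A \<Longrightarrow> w \<in> mdom A \<Longrightarrow> mval A g (z + w) y
      = mval A g z y + mval A g w y"
    and mval_diff [simp]: "z \<in> mdom A \<Longrightarrow> w \<in> mdom A \<Longrightarrow> mval A g (z - w) y
      = mval A g z y - mval A g w y"
    and mval_scale [simp]: "z \<in> mdom A \<Longrightarrow> mval A g (r *\<^sub>R z) y = r * mval A g z y"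
    and mval_omult [simp]: "z \<in> mdom A \<Longrightarrow> w \<in> mdom A \<Longrightarrow> mval A g (omult A z w) y
      = mval A g z y * mval A g w y"
proof -
  obtain \<xi> where \<xi>: "\<xi> \<in> characters A" "\<And>z. mval A g z y = \<xi> z"
    using spectrum_character[OF assms] by metis
  note D = charactersD[OF \<xi>(1)]
  show "mval A g (ounit A) y = 1" "mval A g 0 y = 0"
    using D[of 0 0] by (auto simp: \<xi>(2))
  show "z \<in> mdom A \<Longrightarrow> w \<in> mdom A \<Longrightarrow> mval A g (z + w) y = mval A g z y + mval A g w y"
    "z \<in> mdom A \<Longrightarrow> w \<in> mdom A \<Longrightarrow> mval A g (z - w) y = mval A g z y - mval A g w y"
    "z \<in> mdom A \<Longrightarrow> mval A g (r *\<^sub>R z) y = r * mval A g z y"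
    "z \<in> mdom A \<Longrightarrow> w \<in> mdom A \<Longrightarrow> mval A g (omult A z w) y = mval A g z y * mval A g w y"
    using D[of z w] D[of z z] by (auto simp: \<xi>(2))
qed

lemma continuous_mval: "z \<in> mdom A \<Longrightarrow> continuous_on Y (mval A g z)"
  using gelfand by (simp add: gelfand_identification_def Let_def)

lemma mval_lift:
  assumes "continuous_on Y f"
  obtains z where "z \<in> mdom A" "\<And>y. y \<in> Y \<Longrightarrow> mval A g z y = f y"
  using gelfand assms unfolding gelfand_identification_def Let_def by metis

lemma mval_le_norm:
  assumes "z \<in> mdom A" "y \<in> Y"
  shows "\<bar>mval A g z y\<bar> \<le> ou_norm A z"
proof -
  have "ou_norm A z = Sup (insert 0 ((\<lambda>y. \<bar>mval A g z y\<bar>) ` Y))"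
    using gelfand assms by (simp add: gelfand_identification_def Let_def)
  moreover have "compact ((\<lambda>y. \<bar>mval A g z y\<bar>) ` Y)"
    by (intro compact_continuous_image continuous_on_rabs continuous_mval assms compact_spectrum)
  then have "bdd_above (insert 0 ((\<lambda>y. \<bar>mval A g z y\<bar>) ` Y))"
    by (simp add: bounded_imp_bdd_above compact_imp_bounded)
  ultimately show ?thesis
    using assms by (auto intro!: cSup_upper)
qed

lemma character_le_norm: "\<xi> \<in> characters A \<Longrightarrow> z \<in> mdom A \<Longrightarrow> \<bar>\<xi> z\<bar> \<le> ou_norm A z"
  using mval_le_norm[of z "joint_values g \<xi>"] by (simp add: mval_character spectrum_set_def)

text \<open>A state in the representing set is multiplicative on the multiplicative domain, so that it
  lies over a point of the spectrum.\<close>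

lemma rep_over_spectrum:
  assumes "\<phi> \<in> reps A"
  shows "joint_values g \<phi> \<in> Y"
    and "z \<in> mdom A \<Longrightarrow> \<phi> z = mval A g z (joint_values g \<phi>)"
proof -
  have eq: "joint_values g (restrict \<phi> (mdom A)) = joint_values g \<phi>"
    using gens_mdom by (auto simp: joint_values_def vec_eq_iff)
  note ch = restrict_rep_character[OF assms]
  show "joint_values g \<phi> \<in> Y"
    using ch unfolding spectrum_set_def eq[symmetric] by blast
  show "z \<in> mdom A \<Longrightarrow> \<phi> z = mval A g z (joint_values g \<phi>)"
    using mval_character[OF ch, of z] by (simp add: eq)
qed

lemma mdom_eqI:
  assumes "z \<in> mdom A" "w \<in> mdom A" "\<And>y. y \<in> Y \<Longrightarrow> mval A g z y = mval A g w y"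
  shows "z = w"
proof (rule rep_eqI)
  fix \<phi> assume "\<phi> \<in> reps A"
  then show "\<phi> z = \<phi> w"
    using rep_over_spectrum(1)[of \<phi>] rep_over_spectrum(2)[of \<phi> z] rep_over_spectrum(2)[of \<phi> w] assms
    by simp
qed (use assms in auto)

lemma fibre_ideal:
  shows "order_ideal A (fibre_ideal A g y)" "{f \<in> mdom A. mval A g f y = 0} \<subseteq> fibre_ideal A g y"
  unfolding fibre_ideal_def by (intro closed_order_ideal_hull; auto)+

lemma subspace_fibre_ideal: "subspace (fibre_ideal A g y)"
  using fibre_ideal(1) by (simp add: order_ideal_def)

text \<open>If \<open>-r u \<le> a \<le> r u\<close>, then \<open>0 \<le> f a + r \<bar>f\<bar> \<le> 2 r \<bar>f\<bar>\<close>, where \<open>\<bar>f\<bar>\<close> vanishes at \<open>y\<close>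
  together with \<open>f\<close>.\<close>

lemma omult_fibre_ideal:
  assumes "y \<in> Y" "f \<in> mdom A" "mval A g f y = 0" "a \<in> vcarrier A"
  shows "omult A f a \<in> fibre_ideal A g y"
proof -
  let ?J = "fibre_ideal A g y"
  obtain h where h: "h \<in> mdom A" "\<And>y. y \<in> Y \<Longrightarrow> mval A g h y = \<bar>mval A g f y\<bar>"
    using mval_lift[of "\<lambda>y. \<bar>mval A g f y\<bar>"] assms continuous_mval continuous_on_rabs by blast
  have rh: "\<phi> h = \<bar>\<phi> f\<bar>" if "\<phi> \<in> reps A" for \<phi>
    using rep_over_spectrum[OF that] h assms by simp
  define r where "r = ou_norm A a"
  have hJ: "h \<in> ?J" using fibre_ideal(2) h(1) h(2)[OF assms(1)] assms(3) by auto
  then have J1: "r *\<^sub>R h \<in> ?J" "(2 * r) *\<^sub>R h \<in> ?J"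
    using subspace_fibre_ideal by (auto simp: subspace_scale)
  have bd: "\<bar>\<phi> f * \<phi> a\<bar> \<le> r * \<phi> h" if "\<phi> \<in> reps A" for \<phi>
    using rep_le_norm[OF assms(4) that] rh[OF that] mult_left_mono[of "\<bar>\<phi> a\<bar>" r "\<bar>\<phi> f\<bar>"]
    by (simp add: abs_mult r_def mult.commute)
  have "omult A f a + r *\<^sub>R h \<in> vcarrier A" using assms h by simp
  moreover have "0 \<le> \<phi> f * \<phi> a + r * \<phi> h" "\<phi> f * \<phi> a + r * \<phi> h \<le> 2 * r * \<phi> h"
    if "\<phi> \<in> reps A" for \<phi>
    using bd[OF that] by linarith+
  then have "ou_le A 0 (omult A f a + r *\<^sub>R h)" "ou_le A (omult A f a + r *\<^sub>R h) ((2 * r) *\<^sub>R h)"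
    using assms h by (simp_all add: ou_le_iff)
  ultimately have "omult A f a + r *\<^sub>R h \<in> ?J"
    using fibre_ideal(1)[of y] J1(2) unfolding order_ideal_def by blast
  then have "omult A f a + r *\<^sub>R h - r *\<^sub>R h \<in> ?J"
    using J1(1) subspace_fibre_ideal by (blast intro: subspace_diff)
  then show ?thesis by simp
qed

end

section \<open>Change of generators\<close>

text \<open>These are the parts of the definition of a free order unit module that refer to a choice
  of generators; they are collected in order to compare two choices.\<close>

definition fibre_conditions :: "('a::real_vector) ou_module \<Rightarrow> ('m::finite \<Rightarrow> 'a) \<Rightarrow> nat \<Rightarrow> bool" where
  "fibre_conditions A g n \<longleftrightarrow>
     (\<forall>y\<in>spectrum_set A g.
        aou_space (fibre_ou A g y) \<and> dim (vcarrier (fibre_ou A g y)) = n + 1) \<and>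
     (\<forall>a\<in>vcarrier A. a \<in> pos A \<longleftrightarrow>
        (\<forall>y\<in>spectrum_set A g. fibre_class A g y a \<in> pos (fibre_ou A g y))) \<and>
     (\<forall>y y0 v.
        (\<forall>k::nat. y k \<in> spectrum_set A g) \<and> y0 \<in> spectrum_set A g \<and> y \<longlonglongrightarrow> y0 \<and>
        (\<forall>k. v k \<in> pos (fibre_ou A g (y k))) \<and>
        bdd_above (range (\<lambda>k. ou_norm (fibre_ou A g (y k)) (v k))) \<longrightarrow>
        (\<exists>r v0 a. strict_mono r \<and> v0 \<in> pos (fibre_ou A g y0) \<and> a \<in> vcarrier A \<and>
           fibre_class A g y0 a = v0 \<and>
           (\<lambda>j. ou_norm (fibre_ou A g (y (r j)))
                  (v (r j) - fibre_class A g (y (r j)) a)) \<longlonglongrightarrow> 0))"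

lemma free_ou_module_iff:
  fixes A :: "('a::real_vector) ou_module"
  shows "free_ou_module TYPE('n::finite) TYPE('m::finite) A \<longleftrightarrow>
     aou_space A \<and> kadison_embedded A \<and>
     real_comm_cstar_algebra (mdom A) (omult A) (ounit A) (ou_norm A) \<and>
     (\<exists>g :: 'm \<Rightarrow> 'a.
        cstar_generators A g \<and> gelfand_identification A g \<and> fibre_conditions A g (CARD('n))) \<and>
     (\<exists>e :: 'n option \<Rightarrow> 'a.
        module_basis A e \<and> e None = ounit A \<and>
        homeomorphic_map (ou_topology A)
          (product_topology (\<lambda>_. subtopology (ou_topology A) (mdom A)) UNIV)
          (basis_coords A e))"
  unfolding free_ou_module_def fibre_conditions_def by blast

context gelfand_space
begin

text \<open>Characters are continuous, so the set on which two of them agree is a closed unital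
  subalgebra.\<close>

lemma generators_separate_characters:
  fixes g' :: "'k::finite \<Rightarrow> 'a"
  assumes "cstar_generators A g'"
  shows "inj_on (joint_values g') (characters A)"
proof (rule inj_onI)
  fix \<xi> \<eta> assume ch: "\<xi> \<in> characters A" "\<eta> \<in> characters A"
    and eq: "joint_values g' \<xi> = joint_values g' \<eta>"
  let ?S = "{z \<in> mdom A. \<xi> z = \<eta> z}"
  note D = charactersD[OF ch(1)] charactersD[OF ch(2)]
  have "closedin (subtopology (ou_topology A) (mdom A)) ?S"
  proof (subst closedin_mdom_iff)
    show "\<forall>a\<in>mdom A. (\<forall>\<epsilon>>0. \<exists>b\<in>?S. ou_norm A (a - b) < \<epsilon>) \<longrightarrow> a \<in> ?S"
    proof (intro ballI impI)
      fix a assume a: "a \<in> mdom A" and ap: "\<forall>\<epsilon>>0. \<exists>b\<in>?S. ou_norm A (a - b) < \<epsilon>"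
      have "\<bar>\<xi> a - \<eta> a\<bar> \<le> 0 + e" if "e > 0" for e
      proof -
        obtain b where b: "b \<in> mdom A" "\<xi> b = \<eta> b" "ou_norm A (a - b) < e / 2"
          using ap \<open>e > 0\<close> by (metis (mono_tags, lifting) half_gt_zero mem_Collect_eq)
        have "\<bar>\<xi> (a - b)\<bar> < e / 2" "\<bar>\<eta> (a - b)\<bar> < e / 2"
          using character_le_norm[OF ch(1), of "a - b"] character_le_norm[OF ch(2), of "a - b"] a b
          by auto
        then show ?thesis
          using D(4)[OF a b(1)] D(10)[OF a b(1)] b(2) by linarith
      qed
      then have "\<bar>\<xi> a - \<eta> a\<bar> \<le> 0" by (rule field_le_epsilon)
      with a show "a \<in> ?S" by simp
    qed
  qed auto
  moreover have "subspace ?S"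
    using D[of 0 0] by (auto simp: subspace_def D)
  moreover have "range g' \<subseteq> mdom A"
    using assms by (simp add: cstar_generators_def)
  then have "range g' \<subseteq> ?S"
    using eq by (auto simp: joint_values_def vec_eq_iff)
  moreover have "\<forall>a\<in>?S. \<forall>b\<in>?S. omult A a b \<in> ?S" "ounit A \<in> ?S"
    using D[of 0 0] by (auto simp: D)
  ultimately have "?S = mdom A"
    using assms unfolding cstar_generators_def by blast
  then have "\<xi> z = \<eta> z" for z
    using ch by (cases "z \<in> mdom A") (auto simp: characters_def extensional_def)
  then show "\<xi> = \<eta>" by blast
qed

lemma compact_characters: "compact (characters A)"
proof -
  obtain h where "homeomorphism (characters A) Y (joint_values g) h"
    using gelfand by (auto simp: gelfand_identification_def Let_def)
  then have "continuous_on Y h" "h ` Y = characters A"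
    by (auto simp: homeomorphism_def)
  then show ?thesis
    using compact_continuous_image compact_spectrum by metis
qed

text \<open>The character space is compact, so that any family of generators embeds it topologically;
  the two embeddings differ by a homeomorphism.\<close>

lemma change_of_generators:
  fixes g' :: "'k::finite \<Rightarrow> 'a"
  assumes "cstar_generators A g'"
  obtains \<tau> \<tau>' where "homeomorphism (spectrum_set A g') Y \<tau> \<tau>'"
    "\<And>\<xi>. \<xi> \<in> characters A \<Longrightarrow> \<tau> (joint_values g' \<xi>) = joint_values g \<xi>"
    "\<And>y z. y \<in> spectrum_set A g' \<Longrightarrow> mval A g' z y = mval A g z (\<tau> y)"
    "\<exists>h. homeomorphism (characters A) (spectrum_set A g') (joint_values g') h"
proof -
  note inj' = generators_separate_characters[OF assms]
  obtain h where h: "homeomorphism (characters A) Y (joint_values g) h"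
    using gelfand by (auto simp: gelfand_identification_def Let_def)
  obtain h' where h': "homeomorphism (characters A) (spectrum_set A g') (joint_values g') h'"
    using homeomorphism_compact[OF compact_characters continuous_on_joint_values _ inj'] 
    unfolding spectrum_set_def by blast
  define \<tau> where "\<tau> = joint_values g \<circ> h'"
  have hom: "homeomorphism (spectrum_set A g') Y \<tau> (joint_values g' \<circ> h)"
    unfolding \<tau>_def by (rule homeomorphism_compose[OF homeomorphism_symD[OF h'] h])
  have \<tau>: "\<tau> (joint_values g' \<xi>) = joint_values g \<xi>" if "\<xi> \<in> characters A" for \<xi>
    using homeomorphism_apply1[OF h' that] by (simp add: \<tau>_def)
  have "mval A g' z y = mval A g z (\<tau> y)" if y: "y \<in> spectrum_set A g'" for y z
  proof -
    obtain \<xi> where \<xi>: "\<xi> \<in> characters A" "y = joint_values g' \<xi>"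
      using y by (auto simp: spectrum_set_def)
    have "(THE \<xi>'. \<xi>' \<in> characters A \<and> joint_values g' \<xi>' = joint_values g' \<xi>) = \<xi>"
      using \<xi> inj' by (intro the_equality) (auto dest: inj_onD)
    then show ?thesis
      using \<xi> \<tau> by (simp add: mval_character) (simp add: mval_def)
  qed
  with that hom \<tau> h' show thesis by blast
qed

lemma gelfand_change_generators:
  fixes g' :: "'k::finite \<Rightarrow> 'a"
  assumes "cstar_generators A g'"
  shows "gelfand_identification A g'"
proof -
  obtain \<tau> \<tau>' where \<tau>: "homeomorphism (spectrum_set A g') Y \<tau> \<tau>'"
    and mval: "\<And>y z. y \<in> spectrum_set A g' \<Longrightarrow> mval A g' z y = mval A g z (\<tau> y)"
    and h: "\<exists>h. homeomorphism (characters A) (spectrum_set A g') (joint_values g') h"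
    using change_of_generators[OF assms] by metis
  note hom = \<tau>[unfolded homeomorphism_def]
  have "compact (spectrum_set A g')"
    unfolding spectrum_set_def by (intro compact_continuous_image continuous_on_joint_values
      compact_characters)
  moreover have "continuous_on (spectrum_set A g') (mval A g' z)" if "z \<in> mdom A" for z
  proof -
    have "continuous_on (spectrum_set A g') (mval A g z \<circ> \<tau>)"
      using hom continuous_mval[OF that] by (intro continuous_on_compose) auto
    then show ?thesis by (rule continuous_on_eq) (simp add: mval)
  qed
  moreover have "ou_norm A z = Sup (insert 0 ((\<lambda>y. \<bar>mval A g' z y\<bar>) ` spectrum_set A g'))"
    if "z \<in> mdom A" for z
  proof -
    have "(\<lambda>y. \<bar>mval A g' z y\<bar>) ` spectrum_set A g' = (\<lambda>y. \<bar>mval A g z y\<bar>) ` \<tau> ` spectrum_set A g'"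
      unfolding image_image by (intro image_cong) (auto simp: mval)
    then show ?thesis
      using gelfand that hom by (simp add: gelfand_identification_def Let_def)
  qed
  moreover have "\<exists>z\<in>mdom A. \<forall>y\<in>spectrum_set A g'. mval A g' z y = f y"
    if "continuous_on (spectrum_set A g') f" for f
  proof -
    have "continuous_on Y (f \<circ> \<tau>')"
      using hom that by (intro continuous_on_compose) auto
    then obtain z where z: "z \<in> mdom A" "\<And>y. y \<in> Y \<Longrightarrow> mval A g z y = f (\<tau>' y)"
      using mval_lift by (metis comp_apply)
    have "mval A g' z y = f y" if "y \<in> spectrum_set A g'" for y
      using that z(2)[of "\<tau> y"] hom by (auto simp: mval)
    with z(1) show ?thesis by blast
  qed
  ultimately show ?thesis
    using h by (simp add: gelfand_identification_def Let_def)
qed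

text \<open>The ideal over a point of the spectrum depends only on the character that the point stands
  for.\<close>

lemma fibre_conditions_change_generators:
  fixes g' :: "'k::finite \<Rightarrow> 'a"
  assumes "cstar_generators A g'" "fibre_conditions A g n"
  shows "fibre_conditions A g' n"
proof -
  obtain \<tau> \<tau>' where \<tau>: "homeomorphism (spectrum_set A g') Y \<tau> \<tau>'"
    and mval: "\<And>y z. y \<in> spectrum_set A g' \<Longrightarrow> mval A g' z y = mval A g z (\<tau> y)"
    using change_of_generators[OF assms(1)] by metis
  note hom = \<tau>[unfolded homeomorphism_def]
  have ideal: "fibre_ideal A g' y = fibre_ideal A g (\<tau> y)" if "y \<in> spectrum_set A g'" for y
    using that by (simp add: fibre_ideal_def mval)
  then have ou: "fibre_ou A g' y = fibre_ou A g (\<tau> y)"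
    and cl: "fibre_class A g' y = fibre_class A g (\<tau> y)" if "y \<in> spectrum_set A g'" for y
    using that by (simp_all add: fibre_ou_def fibre_class_def)
  have \<tau>_in: "\<tau> y \<in> Y" if "y \<in> spectrum_set A g'" for y
    using hom that by blast
  have all: "(\<forall>y\<in>spectrum_set A g'. P (\<tau> y)) \<longleftrightarrow> (\<forall>y\<in>Y. P y)" for P
  proof -
    have "Y = \<tau> ` spectrum_set A g'" using hom by simp
    then show ?thesis by simp
  qed
  note F = assms(2)[unfolded fibre_conditions_def]
  have C3: "\<exists>r v0 a. strict_mono r \<and> v0 \<in> pos (fibre_ou A g' y0) \<and> a \<in> vcarrier A \<and>
           fibre_class A g' y0 a = v0 \<and>
           (\<lambda>j. ou_norm (fibre_ou A g' (y (r j)))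
                  (v (r j) - fibre_class A g' (y (r j)) a)) \<longlonglongrightarrow> 0"
    if y: "\<forall>k::nat. y k \<in> spectrum_set A g'" "y0 \<in> spectrum_set A g'" "y \<longlonglongrightarrow> y0"
      and v: "\<forall>k. v k \<in> pos (fibre_ou A g' (y k))"
        "bdd_above (range (\<lambda>k. ou_norm (fibre_ou A g' (y k)) (v k)))" for y y0 v
  proof -
    have "(\<lambda>k. \<tau> (y k)) \<longlonglongrightarrow> \<tau> y0"
      using hom y by (auto simp: continuous_on_sequentially comp_def)
    with F[THEN conjunct2, THEN conjunct2, rule_format, of "\<lambda>k. \<tau> (y k)" "\<tau> y0" v] y v \<tau>_in
    show ?thesis by (simp add: ou cl)
  qed
  have C1: "\<forall>y\<in>spectrum_set A g'.
        aou_space (fibre_ou A g' y) \<and> dim (vcarrier (fibre_ou A g' y)) = n + 1"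
    using F \<tau>_in by (simp add: ou)
  have C2: "\<forall>a\<in>vcarrier A. a \<in> pos A \<longleftrightarrow>
        (\<forall>y\<in>spectrum_set A g'. fibre_class A g' y a \<in> pos (fibre_ou A g' y))"
    using F all[of "\<lambda>y. fibre_class A g y a \<in> pos (fibre_ou A g y)" for a] by (simp add: ou cl)
  show ?thesis
    unfolding fibre_conditions_def
    by (intro conjI C1 C2; intro allI impI; elim conjE; rule C3)
qed

end

section \<open>Coordinates of a free module over the spectrum\<close>

lemma sum_option: "(\<Sum>i\<in>(UNIV::'n::finite option set). f i) = f None + (\<Sum>i\<in>UNIV. f (Some i))"
  by (simp add: UNIV_option_conv sum.reindex)

lemma aou_pointed: "aou_space B \<Longrightarrow> pos B \<inter> uminus ` pos B = {0}"
  by (simp add: aou_space_def)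

lemma aou_order_unit:
  "aou_space B \<Longrightarrow> b \<in> vcarrier B \<Longrightarrow>
   \<exists>r>0. ou_le B (- (r *\<^sub>R ounit B)) b \<and> ou_le B b (r *\<^sub>R ounit B)"
  by (simp add: aou_space_def)

lemma aou_archimedean:
  "aou_space B \<Longrightarrow> b \<in> vcarrier B \<Longrightarrow> (\<And>r. r > 0 \<Longrightarrow> b + r *\<^sub>R ounit B \<in> pos B) \<Longrightarrow> b \<in> pos B"
  by (simp add: aou_space_def)

locale free_basis = gelfand_space A g
  for A :: "('a::real_vector) ou_module" and g :: "'m::finite \<Rightarrow> 'a" +
  fixes e :: "'n::finite option \<Rightarrow> 'a"
  assumes basis: "module_basis A e" and basis_unit: "e None = ounit A"
begin

lemma basis_carrier [simp]: "e i \<in> vcarrier A"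
  using basis by (auto simp: module_basis_def)

lemma
  assumes "a \<in> vcarrier A"
  shows coords_mdom [simp]: "basis_coords A e a i \<in> mdom A"
    and coords_expand: "a = (\<Sum>i\<in>UNIV. omult A (basis_coords A e a i) (e i))"
proof -
  have "\<exists>!c. range c \<subseteq> mdom A \<and> a = (\<Sum>i\<in>UNIV. omult A (c i) (e i))"
    using basis assms by (simp add: module_basis_def)
  from theI'[OF this] show "basis_coords A e a i \<in> mdom A"
    "a = (\<Sum>i\<in>UNIV. omult A (basis_coords A e a i) (e i))"
    unfolding basis_coords_def by auto
qed

lemma coords_eqI:
  assumes "\<And>i. c i \<in> mdom A" "a = (\<Sum>i\<in>UNIV. omult A (c i) (e i))"
  shows "basis_coords A e a = c"
proof -
  have "a \<in> vcarrier A" using assms by simp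
  then have "\<exists>!c. range c \<subseteq> mdom A \<and> a = (\<Sum>i\<in>UNIV. omult A (c i) (e i))"
    using basis by (simp add: module_basis_def)
  moreover have "range c \<subseteq> mdom A" using assms by auto
  ultimately show ?thesis
    unfolding basis_coords_def using assms(2) by (intro the1_equality) auto
qed

lemma coords_add:
  assumes "a \<in> vcarrier A" "b \<in> vcarrier A"
  shows "basis_coords A e (a + b) = (\<lambda>i. basis_coords A e a i + basis_coords A e b i)"
proof (rule coords_eqI)
  show "a + b = (\<Sum>i\<in>UNIV. omult A (basis_coords A e a i + basis_coords A e b i) (e i))"
    using assms coords_expand[OF assms(1)] coords_expand[OF assms(2)]
    by (simp add: omult_add_left sum.distrib)
qed (use assms in auto)

lemma coords_omult:
  assumes "a \<in> vcarrier A" "z \<in> mdom A"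
  shows "basis_coords A e (omult A z a) = (\<lambda>i. omult A z (basis_coords A e a i))"
proof (rule coords_eqI)
  have "omult A z a = omult A z (\<Sum>i\<in>UNIV. omult A (basis_coords A e a i) (e i))"
    using coords_expand[OF assms(1)] by simp
  then show "omult A z a = (\<Sum>i\<in>UNIV. omult A (omult A z (basis_coords A e a i)) (e i))"
    using assms by (simp add: omult_sum_right omult_assoc)
qed (use assms in auto)

lemma coords_scale:
  assumes "a \<in> vcarrier A"
  shows "basis_coords A e (r *\<^sub>R a) = (\<lambda>i. r *\<^sub>R basis_coords A e a i)"
proof (rule coords_eqI)
  show "r *\<^sub>R a = (\<Sum>i\<in>UNIV. omult A (r *\<^sub>R basis_coords A e a i) (e i))"
    using assms coords_expand[OF assms]
    by (simp add: omult_scale_left flip: scaleR_sum_right)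
qed (use assms in auto)

lemma coords_basis: "basis_coords A e (e j) = (\<lambda>i. if i = j then ounit A else 0)"
proof (rule coords_eqI)
  have "(\<Sum>i\<in>UNIV. omult A (if i = j then ounit A else 0) (e i)) = (\<Sum>i\<in>UNIV. if i
    = j then e i else 0)"
    by (intro sum.cong) auto
  then show "e j = (\<Sum>i\<in>UNIV. omult A (if i = j then ounit A else 0) (e i))" by simp
qed auto

text \<open>The coordinates of the class of \<open>a\<close> in the fibre at \<open>y\<close>, as the coefficients of an affine
  function \<open>x \<mapsto> \<beta> + \<alpha> \<bullet> x\<close>.\<close>

definition coord :: "real^'m \<Rightarrow> 'a \<Rightarrow> real \<times> (real^'n)" where
  "coord y a = (mval A g (basis_coords A e a None) y,
                \<chi> i. mval A g (basis_coords A e a (Some i)) y)"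

context
  fixes y assumes y: "y \<in> Y"
begin

lemma coord_add [simp]: "a \<in> vcarrier A \<Longrightarrow> b \<in> vcarrier A \<Longrightarrow> coord y (a + b) = coord y a + coord y b"
  using y by (simp add: coord_def coords_add vec_eq_iff)

lemma coord_scale [simp]: "a \<in> vcarrier A \<Longrightarrow> coord y (r *\<^sub>R a) = r *\<^sub>R coord y a"
  using y by (simp add: coord_def coords_scale vec_eq_iff)

lemma coord_omult [simp]:
  "a \<in> vcarrier A \<Longrightarrow> z \<in> mdom A \<Longrightarrow> coord y (omult A z a) = mval A g z y *\<^sub>R coord y a"
  using y by (simp add: coord_def coords_omult vec_eq_iff)

lemma coord_neg [simp]: "a \<in> vcarrier A \<Longrightarrow> coord y (- a) = - coord y a"
  using coord_scale[of a "-1"] by simp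

lemma coord_diff [simp]: "a \<in> vcarrier A \<Longrightarrow> b \<in> vcarrier A \<Longrightarrow> coord y (a - b) = coord y a - coord y b"
  using coord_add[of a "- b"] by simp

lemma coord_zero [simp]: "coord y 0 = 0"
  using coord_scale[of 0 0] by simp

lemma coord_unit [simp]: "coord y (ounit A) = (1, 0)"
  using y by (simp add: coord_def coords_basis flip: basis_unit) (simp add: basis_unit vec_eq_iff)

lemma coord_basis [simp]: "coord y (e (Some j)) = (0, axis j 1)"
  using y by (simp add: coord_def coords_basis vec_eq_iff axis_def)

lemma coord_sum:
  assumes "\<And>i. i \<in> I \<Longrightarrow> f i \<in> vcarrier A"
  shows "coord y (sum f I) = (\<Sum>i\<in>I. coord y (f i))"
  using assms
proof (induction I rule: infinite_finite_induct)
  case (insert i I)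
  then have "f i \<in> vcarrier A" "sum f I \<in> vcarrier A" by auto
  with insert show ?case by simp
qed auto

end

lemma continuous_coord: "a \<in> vcarrier A \<Longrightarrow> continuous_on Y (\<lambda>y. coord y a)"
  unfolding coord_def by (intro continuous_on_Pair continuous_on_vec_lambda continuous_mval) auto

lemma coord_inj:
  assumes "a \<in> vcarrier A" "b \<in> vcarrier A"
    and eq: "\<And>y. y \<in> Y \<Longrightarrow> coord y a = coord y b"
  shows "a = b"
proof -
  have "basis_coords A e a i = basis_coords A e b i" for i
  proof (rule mdom_eqI)
    show "mval A g (basis_coords A e a i) y = mval A g (basis_coords A e b i) y"
      if "y \<in> Y" for y
      using eq[OF that] by (cases i) (auto simp: coord_def vec_eq_iff)
  qed (use assms in auto)
  then show ?thesis
    using coords_expand[OF assms(1)] coords_expand[OF assms(2)] by simp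
qed

lemma coord_lift:
  assumes "continuous_on Y b" "continuous_on Y c"
  obtains a where "a \<in> vcarrier A" "\<And>y. y \<in> Y \<Longrightarrow> coord y a = (b y, c y)"
proof -
  obtain z0 where z0: "z0 \<in> mdom A" "\<And>y. y \<in> Y \<Longrightarrow> mval A g z0 y = b y"
    using mval_lift[OF assms(1)] by metis
  have "\<exists>z\<in>mdom A. \<forall>y\<in>Y. mval A g z y = c y $ i" for i
    using mval_lift[of "\<lambda>y. c y $ i"] assms(2) by (metis continuous_on_component)
  then obtain z where z: "\<And>i. z i \<in> mdom A" "\<And>i y. y \<in> Y \<Longrightarrow> mval A g (z i) y = c y $ i"
    by metis
  define d where "d i = (case i of None \<Rightarrow> z0 | Some i \<Rightarrow> z i)" for i
  define a where "a = (\<Sum>i\<in>UNIV. omult A (d i) (e i))"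
  have d: "d i \<in> mdom A" for i using z0 z by (auto simp: d_def split: option.split)
  have "basis_coords A e a = d" by (rule coords_eqI[OF d a_def])
  then have "coord y a = (b y, c y)" if "y \<in> Y" for y
    using that z0 z by (simp add: coord_def d_def vec_eq_iff)
  moreover have "a \<in> vcarrier A" using d by (simp add: a_def)
  ultimately show thesis using that by blast
qed

definition affine_elt :: "real \<times> (real^'n) \<Rightarrow> 'a" where
  "affine_elt w = fst w *\<^sub>R ounit A + (\<Sum>i\<in>UNIV. (snd w $ i) *\<^sub>R e (Some i))"

lemma affine_elt_carrier [simp]: "affine_elt w \<in> vcarrier A"
  by (simp add: affine_elt_def)

lemma coord_affine_elt [simp]:
  assumes "y \<in> Y"
  shows "coord y (affine_elt w) = w"
proof -
  have "(\<Sum>i\<in>UNIV. (snd w $ i) *\<^sub>R (0::real, axis i (1::real))) = (0, snd w)"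
    by (simp add: prod_eq_iff fst_sum snd_sum vec_eq_iff axis_def if_distrib cong: if_cong)
  then show ?thesis
    using assms by (simp add: affine_elt_def coord_sum prod_eq_iff)
qed

lemma affine_elt_bounded: "\<exists>R\<ge>0. \<forall>w. ou_norm A (affine_elt w) \<le> R * norm w"
proof -
  define R where "R = ou_norm A (ounit A) + (\<Sum>i\<in>UNIV. ou_norm A (e (Some i)))"
  have "ou_norm A (affine_elt w) \<le> R * norm w" for w
  proof -
    have "ou_norm A (affine_elt w)
      \<le> \<bar>fst w\<bar> * ou_norm A (ounit A) + (\<Sum>i\<in>UNIV. \<bar>snd w $ i\<bar> * ou_norm A (e (Some i)))"
      unfolding affine_elt_def
      by (rule order_trans[OF ou_norm_triangle]) (auto simp: ou_norm_scale intro!: add_mono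
        order_trans[OF ou_norm_sum])
    also have "\<dots> \<le> norm w * ou_norm A (ounit A) + (\<Sum>i\<in>UNIV. norm w * ou_norm A (e (Some i)))"
      using norm_fst_le[of "fst w" "snd w"] norm_snd_le[of "snd w" "fst w"]
      by (intro add_mono mult_right_mono sum_mono) (auto intro: order_trans[OF
        component_le_norm_cart])
    also have "\<dots> = R * norm w"
      by (simp add: R_def algebra_simps sum_distrib_left)
    finally show ?thesis .
  qed
  moreover have "R \<ge> 0" by (auto simp: R_def intro!: add_nonneg_nonneg sum_nonneg)
  ultimately show ?thesis by blast
qed

lemma fibre_class_linear: "linear (fibre_class A g y)"
  unfolding fibre_class_def by (rule vquot(1)[OF subspace_fibre_ideal])

lemma fibre_class_eq_iff: "fibre_class A g y a = fibre_class A g y b \<longleftrightarrow> a - b \<in> fibre_ideal A g y"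
  unfolding fibre_class_def by (rule vquot(2)[OF subspace_fibre_ideal])

text \<open>In the fibre at \<open>y\<close>, multiplication by \<open>f\<close> is multiplication by the number \<open>f(y)\<close>.\<close>

lemma fibre_class_expand:
  assumes "y \<in> Y" "a \<in> vcarrier A"
  shows "fibre_class A g y a
    = (\<Sum>i\<in>UNIV. mval A g (basis_coords A e a i) y *\<^sub>R fibre_class A g y (e i))"
proof -
  let ?q = "fibre_class A g y"
  have "?q (omult A c (e i)) = mval A g c y *\<^sub>R ?q (e i)" if c: "c \<in> mdom A" for c i
  proof -
    have "omult A (c - mval A g c y *\<^sub>R ounit A) (e i) \<in> fibre_ideal A g y"
      using assms(1) c by (intro omult_fibre_ideal) auto
    then have "?q (omult A c (e i)) = ?q (mval A g c y *\<^sub>R e i)"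
      using c by (simp add: fibre_class_eq_iff omult_diff_left omult_scale_left)
    then show ?thesis by (simp add: linear_scale[OF fibre_class_linear])
  qed
  then have "(\<Sum>i\<in>UNIV. ?q (omult A (basis_coords A e a i) (e i))) =
      (\<Sum>i\<in>UNIV. mval A g (basis_coords A e a i) y *\<^sub>R ?q (e i))"
    using assms by (intro sum.cong) auto
  then show ?thesis
    using coords_expand[OF assms(2)] by (simp add: linear_sum[OF fibre_class_linear, symmetric])
qed

lemma fibre_ideal_if_coord_zero:
  assumes "y \<in> Y" "a \<in> vcarrier A" "coord y a = 0"
  shows "a \<in> fibre_ideal A g y"
proof -
  have "mval A g (basis_coords A e a i) y = 0" for i
    using assms(3) by (cases i) (auto simp: coord_def vec_eq_iff zero_prod_def)
  then have "fibre_class A g y a = fibre_class A g y 0"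
    using fibre_class_expand[OF assms(1,2)] linear_0[OF fibre_class_linear] by simp
  then show ?thesis by (simp add: fibre_class_eq_iff)
qed

text \<open>A \<open>y\<close>-state takes the coefficients of an expansion in the basis to their values at \<open>y\<close>.\<close>

lemma y_state_formula:
  assumes "y \<in> Y" "\<Phi> \<in> y_states A g y" "a \<in> vcarrier A"
  shows "\<Phi> a = (1, \<chi> i. \<Phi> (e (Some i))) \<bullet> coord y a"
proof -
  have lin: "linear_on (vcarrier A) \<Phi>" and unit: "\<Phi> (ounit A) = 1"
    and mod: "\<And>f a. f \<in> mdom A \<Longrightarrow> a \<in> vcarrier A \<Longrightarrow> \<Phi> (omult A f a) = mval A g f y * \<Phi> a"
    using assms(2) by (auto simp: y_states_def states_def)
  have zero: "\<Phi> 0 = 0"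
    using lin unfolding linear_on_def by (metis mult_zero_left real_scaleR_def scaleR_zero_left
      zero_carrier)
  have sum: "\<Phi> (sum f I) = (\<Sum>i\<in>I. \<Phi> (f i))" if "\<And>i. i \<in> I \<Longrightarrow> f i \<in> vcarrier A"
    for I and f :: "'n option \<Rightarrow> 'a"
    using that
  proof (induction I rule: infinite_finite_induct)
    case (insert i I)
    then have "f i \<in> vcarrier A" "sum f I \<in> vcarrier A" by auto
    with insert lin show ?case by (simp add: linear_on_def)
  qed (auto simp: zero)
  have "\<Phi> a = (\<Sum>i\<in>UNIV. \<Phi> (omult A (basis_coords A e a i) (e i)))"
    using coords_expand[OF assms(3)] sum[of UNIV "\<lambda>i. omult A (basis_coords A e a i) (e i)"]
      assms(3)
    by simp
  also have "\<dots> = (\<Sum>i\<in>UNIV. mval A g (basis_coords A e a i) y * \<Phi> (e i))"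
    using assms(3) by (intro sum.cong mod) auto
  finally show ?thesis
    by (simp add: sum_option basis_unit unit coord_def inner_vec_def mult.commute)
qed

subsection \<open>The coordinate topology\<close>

lemma coords_diff:
  assumes "a \<in> vcarrier A" "b \<in> vcarrier A"
  shows "basis_coords A e (a - b) = (\<lambda>i. basis_coords A e a i - basis_coords A e b i)"
  using coords_add[of a "(-1) *\<^sub>R b"] coords_scale[of b "-1"] assms by simp

lemma coords_zero: "basis_coords A e 0 i = 0"
  using coords_scale[of 0 0] by simp

text \<open>The coordinates are linear, and linear maps that are continuous at \<open>0\<close> are bounded.\<close>

lemma homeomorphic_imp_coords_bounded:
  assumes "homeomorphic_map (ou_topology A)
    (product_topology (\<lambda>_. subtopology (ou_topology A) (mdom A)) UNIV) (basis_coords A e)"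
  shows "\<exists>C. \<forall>a\<in>vcarrier A. \<forall>i. ou_norm A (basis_coords A e a i) \<le> C * ou_norm A a"
proof -
  have "continuous_map (ou_topology A) (subtopology (ou_topology A) (mdom A)) (\<lambda>a. basis_coords A e a i)" for i
    using homeomorphic_imp_continuous_map[OF assms] by (simp add: continuous_map_componentwise_UNIV)
  then have cont: "\<exists>\<delta>>0. \<forall>a. a \<in> vcarrier A \<and> ou_norm A (0 - a) < \<delta> \<longrightarrow>
      ou_norm A (basis_coords A e 0 i - basis_coords A e a i) < 1" for i
    unfolding mtopology_mdom unfolding ou_topology_def
      Metric_space.metric_continuous_map[OF metric_ou metric_mdom]
    by (meson zero_carrier zero_less_one)
  have "\<exists>C\<ge>0. \<forall>a\<in>vcarrier A. ou_norm A (basis_coords A e a i) \<le> C * ou_norm A a" for i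
  proof -
    obtain \<delta> where \<delta>: "\<delta> > 0" "\<And>a. a \<in> vcarrier A \<Longrightarrow> ou_norm A a < \<delta>
      \<Longrightarrow> ou_norm A (basis_coords A e a i) < 1"
      using cont[of i] by (auto simp: coords_zero ou_norm_neg)
    have "ou_norm A (basis_coords A e a i) \<le> (2 / \<delta>) * ou_norm A a" if a: "a \<in> vcarrier A" for a
    proof (cases "a = 0")
      case True
      then show ?thesis using ou_norm_zero_iff[of 0] by (simp add: coords_zero)
    next
      case False
      then have n: "ou_norm A a > 0"
        using ou_norm_zero_iff[OF a] ou_norm_nonneg[of a] by (simp add: less_le)
      define s where "s = \<delta> / (2 * ou_norm A a)"
      have s: "s > 0" using n \<delta>(1) by (simp add: s_def)
      have "ou_norm A (s *\<^sub>R a) < \<delta>"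
        using a n \<delta>(1) by (simp add: ou_norm_scale s_def)
      then have "ou_norm A (basis_coords A e (s *\<^sub>R a) i) < 1"
        using \<delta>(2) a by simp
      then have "s * ou_norm A (basis_coords A e a i) < 1"
        using a s by (simp add: coords_scale ou_norm_scale)
      then have "ou_norm A (basis_coords A e a i) < 1 / s" using s by (simp add: field_simps)
      then show ?thesis by (simp add: s_def)
    qed
    then show ?thesis using \<delta>(1) by (intro exI[of _ "2 / \<delta>"]) auto
  qed
  then obtain C where C: "\<And>i. C i \<ge> 0" "\<And>i a. a \<in> vcarrier A \<Longrightarrow> ou_norm A (basis_coords A e a i)
    \<le> C i * ou_norm A a"
    by metis
  have "ou_norm A (basis_coords A e a i) \<le> (\<Sum>i\<in>UNIV. C i) * ou_norm A a" if a: "a \<in> vcarrier A"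
    for a i
  proof -
    have "C i \<le> (\<Sum>i\<in>UNIV. C i)" using C(1) by (intro member_le_sum) auto
    then show ?thesis using C(2)[OF a, of i] by (meson mult_right_mono order_trans ou_norm_nonneg)
  qed
  then show ?thesis by blast
qed

text \<open>The inverse map is a finite sum of products with fixed elements, and hence continuous for
  every basis.\<close>

lemma coords_bounded_imp_homeomorphic:
  assumes "\<And>a i. a \<in> vcarrier A \<Longrightarrow> ou_norm A (basis_coords A e a i) \<le> C * ou_norm A a"
  shows "homeomorphic_map (ou_topology A)
    (product_topology (\<lambda>_. subtopology (ou_topology A) (mdom A)) UNIV) (basis_coords A e)"
proof -
  let ?T = "subtopology (ou_topology A) (mdom A)"
  define G where "G c = (\<Sum>i\<in>UNIV. omult A (c i) (e i))" for c
  have topT: "topspace ?T = mdom A" by (auto simp: topspace_subtopology)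
  have Gin: "G c \<in> vcarrier A" if "\<And>i. c i \<in> mdom A" for c
    using that by (simp add: G_def)
  have "continuous_map (ou_topology A) (product_topology (\<lambda>_. ?T) UNIV) (basis_coords A e)"
    unfolding continuous_map_componentwise_UNIV
  proof
    fix i
    have "\<exists>\<delta>>0. \<forall>b. b \<in> vcarrier A \<and> ou_norm A (a - b) < \<delta> \<longrightarrow>
        ou_norm A (basis_coords A e a i - basis_coords A e b i) < \<epsilon>"
      if a: "a \<in> vcarrier A" and "\<epsilon> > 0" for a \<epsilon>
    proof -
      define \<delta> where "\<delta> = \<epsilon> / (\<bar>C\<bar> + 1)"
      have \<delta>: "\<delta> > 0" "(\<bar>C\<bar> + 1) * \<delta> = \<epsilon>"
        using \<open>\<epsilon> > 0\<close> by (auto simp: \<delta>_def intro!: divide_pos_pos)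
      have "ou_norm A (basis_coords A e a i - basis_coords A e b i) < \<epsilon>"
        if b: "b \<in> vcarrier A" "ou_norm A (a - b) < \<delta>" for b
      proof -
        have "ou_norm A (basis_coords A e (a - b) i) \<le> C * ou_norm A (a - b)"
          using assms[of "a - b"] a b(1) by simp
        also have "\<dots> \<le> (\<bar>C\<bar> + 1) * ou_norm A (a - b)" by (intro mult_right_mono) auto
        also have "\<dots> < (\<bar>C\<bar> + 1) * \<delta>" using b(2) by (intro mult_strict_left_mono) auto
        finally show ?thesis using \<delta>(2) a b(1) by (simp add: coords_diff)
      qed
      with \<delta>(1) show ?thesis by blast
    qed
    then show "continuous_map (ou_topology A) ?T (\<lambda>a. basis_coords A e a i)"
      unfolding mtopology_mdom unfolding ou_topology_def
        Metric_space.metric_continuous_map[OF metric_ou metric_mdom] by auto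
  qed
  moreover have "continuous_map (product_topology (\<lambda>_. ?T) UNIV) (ou_topology A) G"
    unfolding ou_topology_def[of A] Metric_space.continuous_map_to_metric[OF metric_ou]
      Metric_space.in_mball[OF metric_ou]
  proof (intro ballI allI impI, fold ou_topology_def[of A])
    fix c :: "'n option \<Rightarrow> 'a" and \<epsilon> :: real
    assume c: "c \<in> topspace (product_topology (\<lambda>_. ?T) UNIV)" and "\<epsilon> > 0"
    then have cM: "c i \<in> mdom A" for i by (auto simp: topspace_product_topology topT)
    define R where "R = (\<Sum>i\<in>UNIV. ou_norm A (e i))"
    define \<delta> where "\<delta> = \<epsilon> / (R + 1)"
    have "R \<ge> 0" by (auto simp: R_def intro!: sum_nonneg)
    then have \<delta>: "\<delta> > 0" "(R + 1) * \<delta> = \<epsilon>"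
      using \<open>\<epsilon> > 0\<close> by (auto simp: \<delta>_def intro!: divide_pos_pos)
    let ?U = "PiE UNIV (\<lambda>i. Metric_space.mball (mdom A) (\<lambda>a b. ou_norm A (a - b)) (c i) \<delta>)"
    have "openin (product_topology (\<lambda>_. ?T) UNIV) ?U"
      unfolding mtopology_mdom
      by (subst openin_PiE) (auto intro: Metric_space.openin_mball[OF metric_mdom])
    moreover have "c \<in> ?U"
      using cM \<delta>(1) ou_norm_zero_iff[of 0] by (auto simp: Metric_space.in_mball[OF metric_mdom])
    moreover have "G c \<in> vcarrier A \<and> G d \<in> vcarrier A \<and> ou_norm A (G c - G d) < \<epsilon>" if "d \<in> ?U"
      for d
    proof -
      have dM: "d i \<in> mdom A" and dn: "ou_norm A (c i - d i) < \<delta>" for i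
        using that by (auto simp: Metric_space.in_mball[OF metric_mdom] PiE_def Pi_def)
      have "G c - G d = (\<Sum>i\<in>UNIV. omult A (c i - d i) (e i))"
        using cM dM by (simp add: G_def omult_diff_left sum_subtractf)
      then have "ou_norm A (G c - G d) \<le> (\<Sum>i\<in>UNIV. ou_norm A (omult A (c i - d i) (e i)))"
        using cM dM by (auto intro!: ou_norm_sum)
      also have "\<dots> \<le> (\<Sum>i\<in>UNIV. \<delta> * ou_norm A (e i))"
        using cM dM dn by (intro sum_mono order_trans[OF ou_norm_omult] mult_right_mono) (auto
          intro: less_imp_le)
      also have "\<dots> = R * \<delta>" by (simp add: R_def sum_distrib_left mult.commute)
      also have "\<dots> < (R + 1) * \<delta>" using \<delta>(1) by (simp add: distrib_right)
      finally show ?thesis using \<delta>(2) Gin cM dM by simp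
    qed
    ultimately show "\<exists>U. openin (product_topology (\<lambda>_. ?T) UNIV) U \<and> c \<in> U \<and>
        (\<forall>d\<in>U. G c \<in> vcarrier A \<and> G d \<in> vcarrier A \<and> ou_norm A (G c - G d) < \<epsilon>)" by blast
  qed
  moreover have "G (basis_coords A e a) = a" if "a \<in> vcarrier A" for a
    using coords_expand[OF that] by (simp add: G_def)
  moreover have "basis_coords A e (G c) = c" if "\<And>i. c i \<in> mdom A" for c
    by (rule coords_eqI[OF that]) (auto simp: G_def)
  ultimately have
    "homeomorphic_maps (ou_topology A) (product_topology (\<lambda>_. ?T) UNIV) (basis_coords A e) G"
    unfolding homeomorphic_maps_def by (auto simp: topspace_product_topology topT PiE_def Pi_def)
  then show ?thesis by (auto simp: homeomorphic_map_maps)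
qed

lemma coords_sum:
  assumes "\<And>j. j \<in> I \<Longrightarrow> a j \<in> vcarrier A"
  shows "basis_coords A e (sum a I) i = (\<Sum>j\<in>I. basis_coords A e (a j) i)"
  using assms
proof (induction I rule: infinite_finite_induct)
  case (insert j I)
  then have "a j \<in> vcarrier A" "sum a I \<in> vcarrier A" by auto
  with insert show ?case by (simp add: coords_add)
qed (auto simp: coords_zero)

text \<open>The coordinates change by a matrix with entries in the multiplicative domain.\<close>

lemma coords_bounded_change_basis:
  fixes e' :: "'n option \<Rightarrow> 'a"
  assumes e': "module_basis A e'" "e' None = ounit A"
    and bdd: "\<exists>C. \<forall>a\<in>vcarrier A. \<forall>i. ou_norm A (basis_coords A e' a i) \<le> C * ou_norm A a"
  shows "\<exists>C. \<forall>a\<in>vcarrier A. \<forall>i. ou_norm A (basis_coords A e a i) \<le> C * ou_norm A a"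
proof -
  interpret E: free_basis A g e' using e' by unfold_locales
  obtain C where C: "\<And>a i. a \<in> vcarrier A \<Longrightarrow> ou_norm A (basis_coords A e' a i) \<le> C * ou_norm A a"
    using bdd by blast
  define D where "D = (\<Sum>i\<in>UNIV. \<Sum>j\<in>UNIV. ou_norm A (basis_coords A e (e' j) i))"
  have "ou_norm A (basis_coords A e a i) \<le> (C * D) * ou_norm A a" if a: "a \<in> vcarrier A" for a i
  proof -
    let ?d = "basis_coords A e' a"
    have CN: "0 \<le> C * ou_norm A a" using C[OF a] ou_norm_nonneg order_trans by blast
    have "basis_coords A e a i = basis_coords A e (\<Sum>j\<in>UNIV. omult A (?d j) (e' j)) i"
      using E.coords_expand[OF a] by simp
    also have "\<dots> = (\<Sum>j\<in>UNIV. omult A (?d j) (basis_coords A e (e' j) i))"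
      using a by (simp add: coords_sum coords_omult)
    finally have "ou_norm A (basis_coords A e a i)
      \<le> (\<Sum>j\<in>UNIV. ou_norm A (omult A (?d j) (basis_coords A e (e' j) i)))"
      using a by (auto intro!: ou_norm_sum)
    also have "\<dots> \<le> (\<Sum>j\<in>UNIV. (C * ou_norm A a) * ou_norm A (basis_coords A e (e' j) i))"
      using a by (intro sum_mono order_trans[OF ou_norm_omult] mult_right_mono C) auto
    also have "\<dots> = (C * ou_norm A a) * (\<Sum>j\<in>UNIV. ou_norm A (basis_coords A e (e' j) i))"
      by (simp add: sum_distrib_left)
    also have "\<dots> \<le> (C * ou_norm A a) * D"
      unfolding D_def using CN
      by (intro mult_left_mono member_le_sum[where f =
        "\<lambda>i. \<Sum>j\<in>UNIV. ou_norm A (basis_coords A e (e' j) i)"] sum_nonneg) auto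
    finally show ?thesis by (simp add: mult_ac)
  qed
  then show ?thesis by blast
qed

end

section \<open>The coordinate state space of a free order unit module\<close>

locale free_ou_coords = free_basis A g e
  for A :: "('a::real_vector) ou_module" and g :: "'m::finite \<Rightarrow> 'a"
    and e :: "'n::finite option \<Rightarrow> 'a" +
  assumes fibres: "fibre_conditions A g (CARD('n))"
    and coords_bounded: "\<exists>C. \<forall>a\<in>vcarrier A. \<forall>i. ou_norm A (basis_coords A e a i) \<le> C * ou_norm A a"
begin

text \<open>The classes of the \<open>n + 1\<close> basis elements span the fibre, which has dimension \<open>n + 1\<close>; a
  nontrivial relation between them would make one of them redundant.\<close>

lemma fibre_ideal_iff:
  assumes y: "y \<in> Y" and a: "a \<in> vcarrier A"
  shows "a \<in> fibre_ideal A g y \<longleftrightarrow> coord y a = 0"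
proof
  let ?q = "fibre_class A g y"
  define m where "m i = mval A g (basis_coords A e a i) y" for i
  assume "a \<in> fibre_ideal A g y"
  then have "?q a = ?q 0" by (simp add: fibre_class_eq_iff)
  then have rel: "(\<Sum>i\<in>UNIV. m i *\<^sub>R ?q (e i)) = 0"
    using fibre_class_expand[OF y a] linear_0[OF fibre_class_linear] by (simp add: m_def)
  have "m j = 0" for j
  proof (rule ccontr)
    assume j: "m j \<noteq> 0"
    let ?W = "(\<lambda>i. ?q (e i)) ` (UNIV - {j})"
    have "m j *\<^sub>R ?q (e j) = - (\<Sum>i\<in>UNIV - {j}. m i *\<^sub>R ?q (e i))"
      using rel by (simp add: sum.remove[of UNIV j] add_eq_0_iff2)
    moreover have "- (\<Sum>i\<in>UNIV - {j}. m i *\<^sub>R ?q (e i)) \<in> span ?W"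
      by (intro span_neg span_sum span_scale span_base) auto
    ultimately have "inverse (m j) *\<^sub>R (m j *\<^sub>R ?q (e j)) \<in> span ?W"
      by (metis span_scale)
    then have "?q (e j) \<in> span ?W" using j by simp
    then have W: "?q (e i) \<in> span ?W" for i
      by (cases "i = j") (auto intro: span_base)
    have "vcarrier (fibre_ou A g y) \<subseteq> span ?W"
    proof
      fix v assume "v \<in> vcarrier (fibre_ou A g y)"
      then obtain b where "b \<in> vcarrier A" "v = ?q b"
        by (auto simp: fibre_ou_def quotient_ou_def fibre_class_def)
      then have "v = (\<Sum>i\<in>UNIV. mval A g (basis_coords A e b i) y *\<^sub>R ?q (e i))"
        using fibre_class_expand[OF y] by blast
      then show "v \<in> span ?W"
        by (simp add: span_sum span_scale W)
    qed
    then have "dim (vcarrier (fibre_ou A g y)) \<le> card ?W"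
      by (intro dim_le_card) auto
    also have "\<dots> \<le> card (UNIV - {j} :: 'n option set)"
      by (intro card_image_le) auto
    also have "\<dots> = CARD('n)" by (simp add: card_Diff_singleton)
    finally show False
      using fibres y unfolding fibre_conditions_def by force
  qed
  then show "coord y a = 0"
    by (simp add: coord_def m_def vec_eq_iff zero_prod_def)
qed (rule fibre_ideal_if_coord_zero[OF assms])

text \<open>The positive cone of the fibre at \<open>y\<close>, transported to \<open>\<real> \<times> \<real>\<^sup>n\<close> by the coordinates.\<close>

definition cone_at :: "real^'m \<Rightarrow> (real \<times> (real^'n)) set" where
  "cone_at y = coord y ` pos A"

lemma fibre_pos_iff:
  assumes y: "y \<in> Y" and a: "a \<in> vcarrier A"
  shows "fibre_class A g y a \<in> pos (fibre_ou A g y) \<longleftrightarrow> coord y a \<in> cone_at y"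
proof -
  have "fibre_class A g y a = fibre_class A g y p \<longleftrightarrow> coord y a = coord y p" if "p \<in> pos A" for p
    using fibre_ideal_iff[OF y, of "a - p"] a pos_carrier[OF that] y
      by (simp add: fibre_class_eq_iff)
  then show ?thesis
    by (auto simp: cone_at_def fibre_ou_def quotient_ou_def image_iff simp flip: fibre_class_def)
qed

lemma fibre_aou: "y \<in> Y \<Longrightarrow> aou_space (fibre_ou A g y)"
  using fibres by (simp add: fibre_conditions_def)

lemma fibre_simps:
  "vcarrier (fibre_ou A g y) = fibre_class A g y ` vcarrier A"
  "pos (fibre_ou A g y) = fibre_class A g y ` pos A"
  "ounit (fibre_ou A g y) = fibre_class A g y (ounit A)"
  by (simp_all add: fibre_ou_def quotient_ou_def fibre_class_def)

lemma pos_iff_cone: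
  "a \<in> vcarrier A \<Longrightarrow> a \<in> pos A \<longleftrightarrow> (\<forall>y\<in>Y. coord y a \<in> cone_at y)"
  using fibres fibre_pos_iff by (simp add: fibre_conditions_def)

context
  fixes y assumes y: "y \<in> Y"
begin

lemma cone_at_add: "v \<in> cone_at y \<Longrightarrow> w \<in> cone_at y \<Longrightarrow> v + w \<in> cone_at y"
proof -
  assume "v \<in> cone_at y" "w \<in> cone_at y"
  then obtain a b where "a \<in> pos A" "b \<in> pos A" "v = coord y a" "w = coord y b"
    by (auto simp: cone_at_def)
  then show ?thesis
    using y by (auto simp: cone_at_def pos_add pos_carrier intro!: image_eqI[of _ _ "a + b"])
qed

lemma cone_at_scale: "v \<in> cone_at y \<Longrightarrow> 0 \<le> r \<Longrightarrow> r *\<^sub>R v \<in> cone_at y"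
proof -
  assume "v \<in> cone_at y" "0 \<le> r"
  then obtain a where "a \<in> pos A" "v = coord y a"
    by (auto simp: cone_at_def)
  with \<open>0 \<le> r\<close> show ?thesis
    using y by (auto simp: cone_at_def pos_scale pos_carrier intro!: image_eqI[of _ _ "r *\<^sub>R a"])
qed

lemma cone_at_unit: "(1, 0) \<in> cone_at y"
  using y by (auto simp: cone_at_def pos_iff intro!: image_eqI[of _ _ "ounit A"])

lemma cone_at_unit_scale: "0 \<le> r \<Longrightarrow> (r, 0) \<in> cone_at y"
  using cone_at_scale[OF cone_at_unit] by simp

lemma cone_at_zero: "0 \<in> cone_at y"
  using cone_at_scale[OF cone_at_unit, of 0] by (simp add: zero_prod_def)

lemma cone_at_pointed:
  assumes "w \<in> cone_at y" "- w \<in> cone_at y"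
  shows "w = 0"
proof -
  let ?q = "fibre_class A g y" and ?a = "affine_elt w"
  have "?q ?a \<in> pos (fibre_ou A g y)" "?q (- ?a) \<in> pos (fibre_ou A g y)"
    using assms y by (simp_all add: fibre_pos_iff)
  moreover have "?q ?a = - ?q (- ?a)"
    using linear_neg[OF fibre_class_linear, of y ?a] by simp
  ultimately have "?q ?a \<in> pos (fibre_ou A g y) \<inter> uminus ` pos (fibre_ou A g y)"
    by (metis IntI imageI)
  then have "?q ?a = ?q 0"
    using aou_pointed[OF fibre_aou[OF y]] linear_0[OF fibre_class_linear] by (metis singletonD)
  then show ?thesis
    using fibre_ideal_iff[OF y, of ?a] y by (simp add: fibre_class_eq_iff)
qed

lemma cone_at_archimedean:
  assumes "\<And>r. r > 0 \<Longrightarrow> w + (r, 0) \<in> cone_at y"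
  shows "w \<in> cone_at y"
proof -
  let ?q = "fibre_class A g y" and ?a = "affine_elt w"
  have "?q ?a + r *\<^sub>R ?q (ounit A) \<in> pos (fibre_ou A g y)" if "r > 0" for r
  proof -
    have "?q (?a + r *\<^sub>R ounit A) \<in> pos (fibre_ou A g y)"
      using assms[OF that] y by (subst fibre_pos_iff) auto
    then show ?thesis
      by (simp add: linear_add[OF fibre_class_linear] linear_scale[OF fibre_class_linear])
  qed
  moreover have "?q ?a \<in> vcarrier (fibre_ou A g y)" by (simp add: fibre_simps)
  ultimately have "?q ?a \<in> pos (fibre_ou A g y)"
    using aou_archimedean[OF fibre_aou[OF y]] unfolding fibre_simps(3) by blast
  then show ?thesis using fibre_pos_iff[OF y, of ?a] y by simp
qed

lemma cone_at_order_unit: "\<exists>R\<ge>0. \<forall>w. (R * norm w, 0) + w \<in> cone_at y"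
proof -
  obtain R where R: "R \<ge> 0" "\<And>w. ou_norm A (affine_elt w) \<le> R * norm w"
    using affine_elt_bounded by auto
  have "(R * norm w, 0) + w \<in> cone_at y" for w
  proof -
    have "(R * norm w) *\<^sub>R ounit A + affine_elt w \<in> pos A"
      using R(2) by (intro norm_unit_plus_pos) auto
    then have "coord y ((R * norm w) *\<^sub>R ounit A + affine_elt w) \<in> cone_at y"
      by (simp add: cone_at_def)
    then show ?thesis using y by simp
  qed
  with R(1) show ?thesis by blast
qed

text \<open>Points near \<open>w\<close> dominate \<open>w\<close> up to a small multiple of the order unit, so that for this
  cone the Archimedean property amounts to closedness.\<close>

lemma closed_cone_at: "closed (cone_at y)"
proof -
  obtain R where R: "R \<ge> 0" "\<And>w. (R * norm w, 0) + w \<in> cone_at y"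
    using cone_at_order_unit by auto
  have "w \<in> cone_at y" if w: "w \<in> closure (cone_at y)" for w
  proof (rule cone_at_archimedean)
    fix r :: real assume "r > 0"
    then have "r / (R + 1) > 0" using R(1) by simp
    then obtain v where v: "v \<in> cone_at y" "dist v w < r / (R + 1)"
      using w unfolding closure_approachable by blast
    \<comment> \<open>The part of \<open>r\<close> that is left after making \<open>w - v\<close> positive.\<close>
    define s where "s = r - R * norm (w - v)"
    have "(R + 1) * norm (w - v) < r"
      using v(2) R(1) by (simp add: dist_norm norm_minus_commute field_simps)
    then have "s \<ge> 0" using norm_ge_zero[of "w - v"]
      by (simp add: s_def algebra_simps del: norm_ge_zero)
    then have "v + ((R * norm (w - v), 0) + (w - v)) + (s, 0) \<in> cone_at y"
      by (intro cone_at_add[OF cone_at_add[OF v(1) R(2)] cone_at_unit_scale])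
    moreover have "v + ((R * norm (w - v), 0) + (w - v)) + (s, 0) = w + (r, 0)"
      by (simp add: s_def prod_eq_iff)
    ultimately show "w + (r, 0) \<in> cone_at y" by (rule back_subst)
  qed
  then show ?thesis by (metis closure_subset closure_eq subsetI subset_antisym)
qed

lemma convex_cone_at: "convex (cone_at y)"
  by (auto simp: convex_def intro!: cone_at_add cone_at_scale)

end

text \<open>\<open>(1, x) \<bullet> w\<close> is the value at \<open>x\<close> of the affine function with coefficients \<open>w\<close>.\<close>

definition dual_slice :: "real^'m \<Rightarrow> (real^'n) set" where
  "dual_slice y = {x. \<forall>w\<in>cone_at y. 0 \<le> (1, x) \<bullet> w}"

text \<open>The states of the fibre at \<open>y\<close> are the functionals in the dual cone with value \<open>1\<close> at the
  order unit.\<close>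

lemma coord_y_states:
  assumes y: "y \<in> Y"
  shows "(\<lambda>\<Phi>. \<chi> i. \<Phi> (e (Some i))) ` y_states A g y = dual_slice y"
proof (intro equalityI subsetI)
  fix x assume "x \<in> (\<lambda>\<Phi>. \<chi> i. \<Phi> (e (Some i))) ` y_states A g y"
  then obtain \<Phi> where \<Phi>: "\<Phi> \<in> y_states A g y" "x = (\<chi> i. \<Phi> (e (Some i)))" by auto
  have "0 \<le> (1, x) \<bullet> coord y p" if "p \<in> pos A" for p
    using y_state_formula[OF y \<Phi>(1) pos_carrier[OF that]] \<Phi> that
    by (auto simp: y_states_def states_def)
  then show "x \<in> dual_slice y" by (simp add: dual_slice_def cone_at_def)
next
  fix x assume x: "x \<in> dual_slice y"
  let ?\<Phi> = "\<lambda>a\<in>vcarrier A. (1, x) \<bullet> coord y a"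
  have "?\<Phi> \<in> states A"
    using x y pos_carrier
    by (auto simp: states_def linear_on_def inner_right_distrib dual_slice_def cone_at_def simp
      del: inner_Pair)
      (simp add: inner_Pair)
  then have "?\<Phi> \<in> y_states A g y"
    using y by (auto simp: y_states_def)
  moreover have "x = (\<chi> i. ?\<Phi> (e (Some i)))"
    using y by (simp add: vec_eq_iff inner_axis)
  ultimately show "x \<in> (\<lambda>\<Phi>. \<chi> i. \<Phi> (e (Some i))) ` y_states A g y" by blast
qed

abbreviation "state_space \<equiv> coord_state_space A e g"

lemma state_space_iff: "(x, y) \<in> state_space \<longleftrightarrow> y \<in> Y \<and> x \<in> dual_slice y"
proof -
  have "(x, y) \<in> state_space \<longleftrightarrow>
    y \<in> Y \<and> x \<in> (\<lambda>\<Phi>. \<chi> i. \<Phi> (e (Some i))) ` y_states A g y"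
    by (auto simp: coord_state_space_def)
  then show ?thesis using coord_y_states by blast
qed

lemma fib_state_space: "y \<in> Y \<Longrightarrow> fib state_space y = dual_slice y"
  by (simp add: fib_def state_space_iff)

text \<open>The bipolar theorem for the closed cone of the fibre; a separating functional is positive
  at the order unit and can be normalised.\<close>

lemma cone_at_iff_dual:
  assumes y: "y \<in> Y"
  shows "w \<in> cone_at y \<longleftrightarrow> (\<forall>x\<in>dual_slice y. 0 \<le> (1, x) \<bullet> w)"
proof
  show "w \<in> cone_at y \<Longrightarrow> \<forall>x\<in>dual_slice y. 0 \<le> (1, x) \<bullet> w" by (simp add: dual_slice_def)
  assume R: "\<forall>x\<in>dual_slice y. 0 \<le> (1, x) \<bullet> w"
  show "w \<in> cone_at y"
  proof (rule ccontr)
    assume "w \<notin> cone_at y"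
    then obtain a b where ab: "a \<bullet> w < b" "\<And>v. v \<in> cone_at y \<Longrightarrow> a \<bullet> v > b"
      using separating_hyperplane_closed_point[OF convex_cone_at[OF y] closed_cone_at[OF y]]
        by blast
    have "b < 0" using ab(2)[OF cone_at_zero[OF y]] by simp
    have nn: "0 \<le> a \<bullet> v" if "v \<in> cone_at y" for v
    proof (rule ccontr)
      assume "\<not> 0 \<le> a \<bullet> v"
      then have "(b / (a \<bullet> v)) *\<^sub>R v \<in> cone_at y" "a \<bullet> v \<noteq> 0"
        using \<open>b < 0\<close> that by (auto intro!: cone_at_scale[OF y] divide_nonpos_nonpos)
      then show False using ab(2)[of "(b / (a \<bullet> v)) *\<^sub>R v"] by simp
    qed
    obtain a0 a1 where a: "a = (a0, a1)" by (cases a)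
    have "a0 \<ge> 0" using nn[OF cone_at_unit[OF y]] by (simp add: a)
    moreover have "a0 \<noteq> 0"
    proof
      assume "a0 = 0"
      obtain S where "\<And>w. (S * norm w, 0) + w \<in> cone_at y"
        using cone_at_order_unit[OF y] by blast
      from nn[OF this[of "- a"]] have "0 \<le> - (a \<bullet> a)"
        using \<open>a0 = 0\<close> by (simp add: a)
      then have "a = 0" by (metis inner_eq_zero_iff inner_ge_zero neg_0_le_iff_le order_antisym)
      with ab(1) \<open>b < 0\<close> show False by simp
    qed
    ultimately have "a0 > 0" by simp
    have scale: "(1, a1 /\<^sub>R a0) \<bullet> v = (a \<bullet> v) / a0" for v
      using \<open>a0 > 0\<close> by (cases v) (simp add: a field_simps)
    have "a1 /\<^sub>R a0 \<in> dual_slice y"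
      using nn \<open>a0 > 0\<close> unfolding dual_slice_def mem_Collect_eq scale by simp
    then have "0 \<le> (a \<bullet> w) / a0" using R scale by metis
    then show False using ab(1) \<open>b < 0\<close> \<open>a0 > 0\<close> by (simp add: zero_le_divide_iff)
  qed
qed

lemma convex_dual_slice: "convex (dual_slice y)"
proof -
  have "dual_slice y = (\<Inter>w\<in>cone_at y. {x. snd w \<bullet> x \<ge> - fst w})"
    by (fastforce simp: dual_slice_def inner_prod_def inner_commute)
  then show ?thesis by (simp add: convex_INT convex_halfspace_ge)
qed

text \<open>A convex set without interior points lies in a hyperplane \<open>a \<bullet> x = b\<close>, and then
  \<open>a \<bullet> x - b\<close> and its negative both belong to the pointed cone.\<close>

lemma interior_dual_slice:
  assumes y: "y \<in> Y"
  shows "interior (dual_slice y) \<noteq> {}"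
proof
  assume "interior (dual_slice y) = {}"
  then obtain a b where ab: "a \<noteq> 0" "dual_slice y \<subseteq> {x. a \<bullet> x = b}"
    using empty_interior_subset_hyperplane[OF convex_dual_slice] by metis
  then have "(- b, a) \<in> cone_at y" "- (- b, a) \<in> cone_at y"
    unfolding cone_at_iff_dual[OF y] by (auto simp: inner_commute)
  then show False using cone_at_pointed[OF y] ab(1) by (metis prod.inject zero_prod_def)
qed

lemma pi2_state_space: "pi2 state_space = Y"
proof -
  have "\<exists>x. x \<in> dual_slice y" if "y \<in> Y" for y
    using interior_dual_slice[OF that] interior_subset by blast
  then show ?thesis by (auto simp: pi2_def state_space_iff)
qed

lemma pos_iff_state_space:
  assumes "a \<in> vcarrier A"
  shows "a \<in> pos A \<longleftrightarrow> (\<forall>(x, y)\<in>state_space. 0 \<le> (1, x) \<bullet> coord y a)"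
  using assms by (auto simp: pos_iff_cone cone_at_iff_dual state_space_iff)

lemma continuous_on_inner_coord:
  assumes "a \<in> vcarrier A"
  shows "continuous_on state_space (\<lambda>p. (1, fst p) \<bullet> coord (snd p) a)"
proof -
  have "continuous_on state_space (\<lambda>p. coord (snd p) a)"
    by (rule continuous_on_compose2[OF continuous_coord[OF assms]])
      (auto intro!: continuous_intros simp: state_space_iff)
  then show ?thesis by (intro continuous_intros)
qed

text \<open>The positivity of \<open>\<beta>(y) + \<alpha>(y) \<bullet> x\<close> for a fixed positive element passes to limits of
  \<open>(x, y)\<close>, because \<open>\<beta>\<close> and \<open>\<alpha>\<close> are continuous.\<close>

lemma compact_state_space: "compact state_space"
  unfolding compact_eq_bounded_closed
proof
  define B where "B = (\<Sum>i\<in>UNIV. ou_norm A (e (Some i)))"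
  have "norm x \<le> B" if "(x, y) \<in> state_space" for x y
  proof -
    have y: "y \<in> Y" and x: "x \<in> dual_slice y"
      using that by (auto simp: state_space_iff)
    have "\<bar>x $ i\<bar> \<le> ou_norm A (e (Some i))" for i
    proof -
      have "coord y (ou_norm A (e (Some i)) *\<^sub>R ounit A + e (Some i)) \<in> cone_at y"
        "coord y (ou_norm A (e (Some i)) *\<^sub>R ounit A + - e (Some i)) \<in> cone_at y"
        unfolding cone_at_def by (intro imageI norm_unit_plus_pos; simp add: ou_norm_neg)+
      then have "0 \<le> (1, x) \<bullet> coord y (ou_norm A (e (Some i)) *\<^sub>R ounit A + e (Some i))"
        "0 \<le> (1, x) \<bullet> coord y (ou_norm A (e (Some i)) *\<^sub>R ounit A + - e (Some i))"
        using x unfolding dual_slice_def by blast+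
      then show ?thesis using y by (simp add: inner_axis del: add_uminus_conv_diff)
    qed
    then have "(\<Sum>i\<in>UNIV. \<bar>x $ i\<bar>) \<le> B" unfolding B_def by (intro sum_mono)
    then show ?thesis using norm_le_l1_cart[of x] by linarith
  qed
  then have "state_space \<subseteq> cball 0 B \<times> Y"
    by (auto simp: state_space_iff)
  then show "bounded state_space"
    using bounded_subset bounded_Times bounded_cball compact_imp_bounded[OF compact_spectrum]
      by metis
  show "closed state_space"
    unfolding closed_sequential_limits
  proof (intro allI impI, elim conjE)
    fix s :: "nat \<Rightarrow> (real^'n) \<times> (real^'m)" and l
    assume s: "\<forall>k. s k \<in> state_space" and lim: "s \<longlonglongrightarrow> l"
    have sY: "snd (s k) \<in> Y" for k
      using s by (metis prod.collapse state_space_iff)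
    have ly: "snd l \<in> Y"
      using closed_sequentially[OF compact_imp_closed[OF compact_spectrum] sY tendsto_snd[OF lim]] .
    have "0 \<le> (1, fst l) \<bullet> coord (snd l) p" if p: "p \<in> pos A" for p
    proof (rule tendsto_lowerbound)
      have "(\<lambda>k. coord (snd (s k)) p) \<longlonglongrightarrow> coord (snd l) p"
        by (rule continuous_on_tendsto_compose[OF continuous_coord[OF pos_carrier[OF p]]
          tendsto_snd[OF lim] ly])
          (simp add: sY)
      then show "(\<lambda>k. (1, fst (s k)) \<bullet> coord (snd (s k)) p) \<longlonglongrightarrow> (1, fst l) \<bullet> coord (snd l) p"
        by (intro tendsto_intros tendsto_fst[OF lim])
      show "\<forall>\<^sub>F k in sequentially. 0 \<le> (1, fst (s k)) \<bullet> coord (snd (s k)) p"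
        using s p pos_iff_state_space[OF pos_carrier[OF p]] by (auto simp: case_prod_unfold)
    qed simp
    then have "fst l \<in> dual_slice (snd l)" by (simp add: dual_slice_def cone_at_def)
    with ly show "l \<in> state_space" by (metis prod.collapse state_space_iff)
  qed
qed

text \<open>If \<open>\<bar>a\<bar> \<le> r\<close> on the slice over \<open>y\<close>, then \<open>\<bar>a\<bar> < 2 r\<close> over a neighbourhood of \<open>y\<close>.
  Multiplication by a bump function that is \<open>1\<close> at \<open>y\<close> makes the bound global without changing
  the coordinates at \<open>y\<close>.\<close>

lemma coord_bounded_by_values:
  obtains C where "C \<ge> 0" "\<And>y a r. y \<in> Y \<Longrightarrow> a \<in> vcarrier A \<Longrightarrow> r > 0 \<Longrightarrow>
    (\<And>x. x \<in> dual_slice y \<Longrightarrow> \<bar>(1, x) \<bullet> coord y a\<bar> \<le> r) \<Longrightarrow> norm (coord y a) \<le> C * r"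
proof -
  obtain C0 where C0: "\<And>a i. a \<in> vcarrier A \<Longrightarrow> ou_norm A (basis_coords A e a i) \<le> C0 * ou_norm A a"
    using coords_bounded by blast
  define C where "C = (1 + real CARD('n)) * (2 * \<bar>C0\<bar>)"
  have "norm (coord y a) \<le> C * r"
    if y: "y \<in> Y" and a: "a \<in> vcarrier A" and r: "r > 0"
      and bd: "\<And>x. x \<in> dual_slice y \<Longrightarrow> \<bar>(1, x) \<bullet> coord y a\<bar> \<le> r" for y a r
  proof -
    define F where "F p = (1, fst p) \<bullet> coord (snd p) a" for p
    define T where "T = {p \<in> state_space. 2 * r \<le> \<bar>F p\<bar>}"
    have contF: "continuous_on state_space F"
      unfolding F_def by (rule continuous_on_inner_coord[OF a])
    have "compact T"
    proof -
      have "closed T" unfolding T_def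
        by (intro continuous_closed_preimage_constant continuous_on_closed_Collect_le
            continuous_intros contF compact_imp_closed compact_state_space)
      then show ?thesis using compact_state_space
        by (metis (no_types, lifting) T_def closed_Int_compact inf.absorb1 mem_Collect_eq subsetI)
    qed
    then have "closed (snd ` T)"
      by (intro compact_imp_closed compact_continuous_image continuous_intros)
    moreover have "y \<notin> snd ` T"
    proof
      assume "y \<in> snd ` T"
      then obtain x where x: "(x, y) \<in> state_space" "2 * r \<le> \<bar>(1, x) \<bullet> coord y a\<bar>"
        by (auto simp: T_def F_def)
      then show False using bd[of x] r by (simp add: state_space_iff)
    qed
    ultimately obtain d where d: "d > 0" "\<And>y'. dist y y' < d \<Longrightarrow> y' \<notin> snd ` T"
      by (metis (no_types, opaque_lifting) ComplI open_Compl open_dist dist_commute ComplD)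
    \<comment> \<open>The bump function vanishes where \<open>\<bar>a\<bar> \<ge> 2 r\<close> may occur.\<close>
    define f where "f y' = max 0 (1 - dist y y' / d)" for y'
    have "continuous_on Y f"
      unfolding f_def using d(1) by (intro continuous_intros) auto
    then obtain z where z: "z \<in> mdom A" "\<And>y'. y' \<in> Y \<Longrightarrow> mval A g z y' = f y'"
      using mval_lift by blast
    have za: "omult A z a \<in> vcarrier A" using z(1) a by simp
    have le: "\<bar>(1, x) \<bullet> coord y' (omult A z a)\<bar> \<le> 2 * r" if p: "(x, y') \<in> state_space" for x y'
    proof -
      have y': "y' \<in> Y" using p by (simp add: state_space_iff)
      have eq: "(1, x) \<bullet> coord y' (omult A z a) = f y' * F (x, y')"
        using y' a z by (simp add: F_def)
      show ?thesis
      proof (cases "dist y y' < d")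
        case True
        then have "(x, y') \<notin> T" using d(2) by force
        then have "\<bar>F (x, y')\<bar> \<le> 2 * r" using p by (simp add: T_def)
        moreover have "0 \<le> f y'" "f y' \<le> 1" using d(1) by (auto simp: f_def)
        ultimately show ?thesis unfolding eq abs_mult
          using mult_mono[of "\<bar>f y'\<bar>" 1 "\<bar>F (x, y')\<bar>" "2 * r"] by simp
      next
        case False
        then have "f y' = 0" using d(1) by (simp add: f_def)
        then show ?thesis using eq r by simp
      qed
    qed
    let ?b = "omult A z a"
    have val: "(1, x) \<bullet> coord y' ((2 * r) *\<^sub>R ounit A + s *\<^sub>R ?b)
      = 2 * r + s * ((1, x) \<bullet> coord y' ?b)"
      if "(x, y') \<in> state_space" for x y' s
    proof -
      have "y' \<in> Y" using that by (simp add: state_space_iff)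
      then have "coord y' ((2 * r) *\<^sub>R ounit A + s *\<^sub>R ?b) = (2 * r) *\<^sub>R (1, 0) + s *\<^sub>R coord y' ?b"
        using za by (simp only: coord_add coord_scale coord_unit scale_carrier unit_carrier)
      then show ?thesis by (simp only: inner_right_distrib inner_scaleR_right) (simp add:
        inner_Pair)
    qed
    have pos: "(2 * r) *\<^sub>R ounit A + s *\<^sub>R ?b \<in> pos A" if "\<bar>s\<bar> = 1" for s
    proof -
      have "0 \<le> (1, x) \<bullet> coord y' ((2 * r) *\<^sub>R ounit A + s *\<^sub>R ?b)" if p: "(x, y') \<in> state_space"
        for x y'
        using le[OF p] \<open>\<bar>s\<bar> = 1\<close> unfolding val[OF p] by (auto simp: abs_if split: if_splits)
      then show ?thesis
        using za by (subst pos_iff_state_space) auto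
    qed
    have "\<bar>\<phi> ?b\<bar> \<le> 2 * r" if "\<phi> \<in> reps A" for \<phi>
    proof -
      have "0 \<le> \<phi> ((2 * r) *\<^sub>R ounit A + s *\<^sub>R ?b)" if "\<bar>s\<bar> = 1" for s
        using pos[OF that] pos_iff pos_carrier \<open>\<phi> \<in> reps A\<close> by blast
      from this[of 1] this[of "-1"] that za show ?thesis
        by (simp del: omult(2))
    qed
    then have "ou_norm A ?b \<le> 2 * r"
      using za r by (subst ou_norm_le_iff) auto
    then have "ou_norm A (basis_coords A e (omult A z a) i) \<le> \<bar>C0\<bar> * (2 * r)" for i
      by (intro order_trans[OF C0[OF za] mult_mono]) auto
    then have m: "\<bar>mval A g (basis_coords A e (omult A z a) i) y\<bar> \<le> \<bar>C0\<bar> * (2 * r)" for i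
      using mval_le_norm[OF coords_mdom[OF za] y, of i] by (meson order_trans)
    have ca: "coord y a = coord y (omult A z a)"
      using y a z d(1) by (simp add: f_def)
    have "norm (coord y (omult A z a)) \<le>
        \<bar>fst (coord y (omult A z a))\<bar> + (\<Sum>i\<in>UNIV. \<bar>snd (coord y (omult A z a)) $ i\<bar>)"
      using norm_Pair_le[of "fst (coord y (omult A z a))" "snd (coord y (omult A z a))"]
        norm_le_l1_cart[of "snd (coord y (omult A z a))"] by simp
    also have "\<dots> \<le> \<bar>C0\<bar> * (2 * r) + (\<Sum>i\<in>(UNIV::'n set). \<bar>C0\<bar> * (2 * r))"
      by (intro add_mono sum_mono) (simp_all add: coord_def m)
    also have "\<dots> = C * r" by (simp add: C_def algebra_simps)
    finally show ?thesis unfolding ca .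
  qed
  moreover have "C \<ge> 0" by (simp add: C_def)
  ultimately show thesis using that by blast
qed

text \<open>The quotient map is positive and unital, hence contractive.\<close>

lemma fibre_norm_le:
  assumes "y \<in> Y" "a \<in> vcarrier A" "r > 0" "ou_norm A a \<le> r"
  shows "ou_norm (fibre_ou A g y) (fibre_class A g y a) \<le> r"
proof -
  let ?q = "fibre_class A g y"
  note lin = linear_add[OF fibre_class_linear] linear_scale[OF fibre_class_linear]
    linear_diff[OF fibre_class_linear]
  have "r *\<^sub>R ounit A + a \<in> pos A" "r *\<^sub>R ounit A - a \<in> pos A"
    using norm_unit_plus_pos[of a r] norm_unit_plus_pos[of "- a" r] assms
      by (auto simp: ou_norm_neg)
  then have "ou_le (fibre_ou A g y) (- (r *\<^sub>R ?q (ounit A))) (?q a)"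
    "ou_le (fibre_ou A g y) (?q a) (r *\<^sub>R ?q (ounit A))"
    unfolding ou_le_def fibre_simps
    by (force simp: lin)+
  then have "Inf {r. r > 0 \<and> ou_le (fibre_ou A g y) (- (r *\<^sub>R ?q (ounit A))) (?q a) \<and>
      ou_le (fibre_ou A g y) (?q a) (r *\<^sub>R ?q (ounit A))} \<le> r"
    using assms(3) by (intro cInf_lower) (auto intro!: bdd_belowI[of _ 0])
  then show ?thesis
    using assms(2) by (simp add: ou_norm_def fibre_simps)
qed

lemma values_le_fibre_norm:
  assumes y: "y \<in> Y" and a: "a \<in> vcarrier A"
    and r: "ou_norm (fibre_ou A g y) (fibre_class A g y a) < r" and x: "x \<in> dual_slice y"
  shows "\<bar>(1, x) \<bullet> coord y a\<bar> \<le> r"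
proof -
  let ?q = "fibre_class A g y" and ?B = "fibre_ou A g y"
  note lin = linear_add[OF fibre_class_linear] linear_scale[OF fibre_class_linear]
    linear_diff[OF fibre_class_linear]
  let ?R = "{r. r > 0 \<and> ou_le ?B (- (r *\<^sub>R ?q (ounit A))) (?q a)
    \<and> ou_le ?B (?q a) (r *\<^sub>R ?q (ounit A))}"
  have qa: "?q a \<in> vcarrier ?B" using a by (simp add: fibre_simps)
  then have "?R \<noteq> {}"
    using aou_order_unit[OF fibre_aou[OF y] qa] unfolding fibre_simps(3) by blast
  moreover have "Inf ?R < r"
    using r qa by (simp add: ou_norm_def fibre_simps(3))
  ultimately obtain s where s: "s \<in> ?R" "s < r"
    using cInf_lessD[of ?R r] by meson
  moreover have "?q (a + s *\<^sub>R ounit A) = ?q a - - (s *\<^sub>R ?q (ounit A))"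
    "?q (s *\<^sub>R ounit A - a) = s *\<^sub>R ?q (ounit A) - ?q a"
    by (simp_all add: lin)
  ultimately have "?q (a + s *\<^sub>R ounit A) \<in> pos ?B" "?q (s *\<^sub>R ounit A - a) \<in> pos ?B"
    by (simp_all add: ou_le_def)
  then have "coord y (a + s *\<^sub>R ounit A) \<in> cone_at y" "coord y (s *\<^sub>R ounit A - a) \<in> cone_at y"
    using y a by (simp_all add: fibre_pos_iff del: coord_add coord_diff)
  then have "0 \<le> (1, x) \<bullet> coord y (a + s *\<^sub>R ounit A)" "0 \<le> (1, x) \<bullet> coord y (s *\<^sub>R ounit A - a)"
    using x unfolding dual_slice_def by blast+
  then have "0 \<le> (1, x) \<bullet> coord y a + s" "0 \<le> s - (1, x) \<bullet> coord y a"
    using y a by (simp_all add: inner_right_distrib inner_diff_right del: inner_Pair) (simp_all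
      add: inner_Pair)
  then show ?thesis using s(2) by linarith
qed

lemma free_ou_liminf:
  assumes "\<And>k::nat. y k \<in> Y" "y0 \<in> Y" "y \<longlonglongrightarrow> y0"
    "\<And>k. v k \<in> pos (fibre_ou A g (y k))"
    "bdd_above (range (\<lambda>k. ou_norm (fibre_ou A g (y k)) (v k)))"
  obtains r a where "strict_mono r" "a \<in> vcarrier A" "fibre_class A g y0 a \<in> pos (fibre_ou A g y0)"
    "(\<lambda>j. ou_norm (fibre_ou A g (y (r j))) (v (r j) - fibre_class A g (y (r j)) a)) \<longlonglongrightarrow> 0"
proof -
  have "\<exists>r v0 a. strict_mono r \<and> v0 \<in> pos (fibre_ou A g y0) \<and> a \<in> vcarrier A \<and>
           fibre_class A g y0 a = v0 \<and>
           (\<lambda>j. ou_norm (fibre_ou A g (y (r j)))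
                  (v (r j) - fibre_class A g (y (r j)) a)) \<longlonglongrightarrow> 0"
    using fibres[unfolded fibre_conditions_def, THEN conjunct2, THEN conjunct2, rule_format, of y
      y0 v] assms
    by (simp only: simp_thms)
  then show thesis using that by blast
qed

text \<open>If \<open>x\<close> left the interiors of the slices over \<open>y\<^sub>k\<close>, there would be affine functions
  \<open>z \<mapsto> \<alpha>\<^sub>k \<bullet> (z - x)\<close> that are nonnegative on these slices with \<open>\<alpha>\<^sub>k\<close> of norm \<open>1\<close>. They
  accumulate at an affine function of the same form that is nonnegative on the slice over \<open>y\<^sub>0\<close>,
  and such a function cannot vanish at an interior point.\<close>

lemma interior_dual_slice_persists:
  assumes yk: "\<And>k::nat. y k \<in> Y" and y0: "y0 \<in> Y" and lim: "y \<longlonglongrightarrow> y0"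
    and x: "x \<in> interior (dual_slice y0)"
  shows "\<forall>\<^sub>F k in sequentially. x \<in> interior (dual_slice (y k))"
proof (rule ccontr)
  assume "\<not> ?thesis"
  then obtain \<rho> :: "nat \<Rightarrow> nat" where \<rho>: "strict_mono \<rho>" "\<And>k. x \<notin> interior (dual_slice (y (\<rho> k)))"
    by (metis (no_types, lifting) not_eventually_sequentiallyD)
  define t where "t = (\<lambda>k. y (\<rho> k))"
  have tY: "t k \<in> Y" for k using yk by (simp add: t_def)
  have tlim: "t \<longlonglongrightarrow> y0" using LIMSEQ_subseq_LIMSEQ[OF lim \<rho>(1)] by (simp add: t_def comp_def)
  have "\<exists>\<alpha>. norm \<alpha> = 1 \<and> (\<forall>z\<in>dual_slice (t k). \<alpha> \<bullet> x \<le> \<alpha> \<bullet> z)" for k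
  proof -
    let ?I = "interior (dual_slice (t k))"
    have ne: "?I \<noteq> {}" by (rule interior_dual_slice[OF tY])
    have "{x} \<inter> ?I = {}" using \<rho>(2) by (simp add: t_def)
    then obtain a b where ab: "a \<noteq> 0" "a \<bullet> x \<le> b" "\<And>z. z \<in> ?I \<Longrightarrow> b \<le> a \<bullet> z"
      using separating_hyperplane_sets[of "{x}" ?I] ne convex_interior[OF convex_dual_slice] by auto
    have "?I \<subseteq> {z. a \<bullet> z \<ge> b}" using ab(3) by auto
    then have "closure ?I \<subseteq> {z. a \<bullet> z \<ge> b}" by (rule closure_minimal[OF _ closed_halfspace_ge])
    moreover have "dual_slice (t k) \<subseteq> closure ?I"
      using convex_closure_interior[OF convex_dual_slice ne] closure_subset by blast
    ultimately have "\<forall>z\<in>dual_slice (t k). a \<bullet> x \<le> a \<bullet> z" using ab(2) by force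
    then show ?thesis
      using ab(1) by (intro exI[of _ "a /\<^sub>R norm a"]) (auto simp: mult_left_mono)
  qed
  then obtain \<alpha> where \<alpha>: "\<And>k. norm (\<alpha> k) = 1" "\<And>k z. z \<in> dual_slice (t k) \<Longrightarrow> \<alpha> k \<bullet> x \<le> \<alpha> k \<bullet> z"
    by metis
  \<comment> \<open>The coefficients of \<open>z \<mapsto> \<alpha> k \<bullet> (z - x)\<close>.\<close>
  define w where "w k = (- (\<alpha> k \<bullet> x), \<alpha> k)" for k
  have wcone: "w k \<in> cone_at (t k)" for k
    unfolding cone_at_iff_dual[OF tY] using \<alpha>(2) by (auto simp: w_def inner_commute)
  define v where "v k = fibre_class A g (t k) (affine_elt (w k))" for k
  have vpos: "v k \<in> pos (fibre_ou A g (t k))" for k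
    using wcone tY unfolding v_def by (subst fibre_pos_iff) auto
  obtain R where R: "R \<ge> 0" "\<And>w. ou_norm A (affine_elt w) \<le> R * norm w"
    using affine_elt_bounded by auto
  have "ou_norm (fibre_ou A g (t k)) (v k) \<le> R * (norm x + 1) + 1" for k
    unfolding v_def
  proof (rule fibre_norm_le[OF tY])
    have "norm (w k) \<le> norm x + 1"
      using norm_Pair_le[of "- (\<alpha> k \<bullet> x)" "\<alpha> k"] Cauchy_Schwarz_ineq2[of "\<alpha> k" x] \<alpha>(1)[of k]
        by (simp add: w_def)
    then show "ou_norm A (affine_elt (w k)) \<le> R * (norm x + 1) + 1"
      using R(2)[of "w k"] mult_left_mono[OF _ R(1), of "norm (w k)" "norm x + 1"] by linarith
    show "0 < R * (norm x + 1) + 1" using R(1) by (simp add: add_nonneg_pos)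
  qed simp
  then have "bdd_above (range (\<lambda>k. ou_norm (fibre_ou A g (t k)) (v k)))"
    by (auto intro!: bdd_aboveI)
  from free_ou_liminf[OF tY y0 tlim vpos this]
  obtain r a where r: "strict_mono r" and a: "a \<in> vcarrier A"
    and apos: "fibre_class A g y0 a \<in> pos (fibre_ou A g y0)"
    and conv: "(\<lambda>j. ou_norm (fibre_ou A g (t (r j))) (v (r j) - fibre_class A g (t (r j)) a)) \<longlonglongrightarrow> 0"
    by blast
  obtain C where C: "C \<ge> 0" "\<And>y a r. y \<in> Y \<Longrightarrow> a \<in> vcarrier A \<Longrightarrow> r > 0 \<Longrightarrow>
    (\<And>x. x \<in> dual_slice y \<Longrightarrow> \<bar>(1, x) \<bullet> coord y a\<bar> \<le> r) \<Longrightarrow> norm (coord y a) \<le> C * r"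
    using coord_bounded_by_values by blast
  have "(\<lambda>j. w (r j) - coord (t (r j)) a) \<longlonglongrightarrow> 0"
  proof (rule LIMSEQ_I)
    fix \<epsilon> :: real assume "\<epsilon> > 0"
    define \<delta> where "\<delta> = \<epsilon> / (2 * (C + 1))"
    have "\<delta> > 0" using \<open>\<epsilon> > 0\<close> C(1) by (simp add: \<delta>_def)
    have "\<delta> * (2 * (C + 1)) = \<epsilon>" using C(1) by (simp add: \<delta>_def)
    moreover have "C * \<delta> < (2 * (C + 1)) * \<delta>"
      using \<open>\<delta> > 0\<close> C(1) by (intro mult_strict_right_mono) auto
    ultimately have "C * \<delta> < \<epsilon>" by (simp only: mult.commute)
    obtain N where N: "\<And>j. j \<ge> N \<Longrightarrow>
        ou_norm (fibre_ou A g (t (r j))) (v (r j) - fibre_class A g (t (r j)) a) < \<delta>"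
      using order_tendstoD(2)[OF conv \<open>\<delta> > 0\<close>] unfolding eventually_sequentially by blast
    have "norm (w (r j) - coord (t (r j)) a) < \<epsilon>" if "j \<ge> N" for j
    proof -
      let ?b = "affine_elt (w (r j)) - a"
      have b: "?b \<in> vcarrier A" using a by simp
      have "ou_norm (fibre_ou A g (t (r j))) (fibre_class A g (t (r j)) ?b) < \<delta>"
        using N[OF that] by (simp add: v_def linear_diff[OF fibre_class_linear])
      from values_le_fibre_norm[OF tY b this]
      have "norm (coord (t (r j)) ?b) \<le> C * \<delta>"
        by (intro C(2)[OF tY b \<open>\<delta> > 0\<close>])
      then show ?thesis using \<open>C * \<delta> < \<epsilon>\<close> tY a by simp
    qed
    then show "\<exists>N. \<forall>j\<ge>N. norm (w (r j) - coord (t (r j)) a - 0) < \<epsilon>"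
      unfolding diff_zero by blast
  qed
  moreover have "(\<lambda>j. coord (t (r j)) a) \<longlonglongrightarrow> coord y0 a"
    using LIMSEQ_subseq_LIMSEQ[OF tlim r] tY
    by (intro continuous_on_tendsto_compose[OF continuous_coord[OF a] _ y0]) (auto simp: comp_def)
  ultimately have "(\<lambda>j. (w (r j) - coord (t (r j)) a) + coord (t (r j)) a) \<longlonglongrightarrow> 0 + coord y0 a"
    by (rule tendsto_add)
  then have wlim: "(\<lambda>j. w (r j)) \<longlonglongrightarrow> coord y0 a"
    by (simp only: diff_add_cancel add_0_left)
  obtain b0 a0 where ba: "coord y0 a = (b0, a0)" by (cases "coord y0 a")
  have alim: "(\<lambda>j. \<alpha> (r j)) \<longlonglongrightarrow> a0"
    using tendsto_snd[OF wlim] by (simp add: w_def ba)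
  then have "norm a0 = 1"
    using tendsto_norm[OF alim] \<alpha>(1) by (simp add: LIMSEQ_const_iff)
  have "(\<lambda>j. - (\<alpha> (r j) \<bullet> x)) \<longlonglongrightarrow> b0" using tendsto_fst[OF wlim] by (simp add: w_def ba)
  moreover have "(\<lambda>j. - (\<alpha> (r j) \<bullet> x)) \<longlonglongrightarrow> - (a0 \<bullet> x)" by (intro tendsto_intros alim)
  ultimately have b0: "b0 = - (a0 \<bullet> x)" by (rule LIMSEQ_unique)
  have pos: "a0 \<bullet> x \<le> a0 \<bullet> z" if "z \<in> dual_slice y0" for z
    using apos that fibre_pos_iff[OF y0 a]
      by (auto simp: cone_at_iff_dual[OF y0] ba b0 inner_commute)
  obtain \<epsilon> where \<epsilon>: "\<epsilon> > 0" "cball x \<epsilon> \<subseteq> dual_slice y0"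
    using x by (meson mem_interior_cball)
  have "x - \<epsilon> *\<^sub>R a0 \<in> dual_slice y0"
    using \<epsilon> \<open>norm a0 = 1\<close> by (intro subsetD[OF \<epsilon>(2)]) (simp add: dist_norm)
  from pos[OF this] have "\<epsilon> * (a0 \<bullet> a0) \<le> 0" by (simp add: inner_diff_right)
  then show False using \<epsilon>(1) \<open>norm a0 = 1\<close> by (simp add: dot_square_norm)
qed

text \<open>Lower hemicontinuity holds with an eventually constant sequence.\<close>

lemma regular_state_space: "regular_partially_convex state_space"
  unfolding regular_partially_convex_def partially_convex_def pi2_state_space
proof (intro conjI ballI allI impI)
  show "closed state_space" by (rule compact_imp_closed[OF compact_state_space])
  show "convex (fib state_space y)" if "y \<in> Y" for y
    using that by (simp add: fib_state_space convex_dual_slice)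
  show "interior (fib state_space y) \<noteq> {}" if "y \<in> Y" for y
    using that by (simp add: fib_state_space interior_dual_slice)
  fix y0 and y :: "nat \<Rightarrow> _" and x
  assume y0: "y0 \<in> Y" and y: "(\<forall>k. y k \<in> Y) \<and> y \<longlonglongrightarrow> y0"
    and x: "x \<in> interior (fib state_space y0)"
  have ev: "\<forall>\<^sub>F k in sequentially. x \<in> interior (fib state_space (y k))"
    using interior_dual_slice_persists[of y y0 x] y y0 x by (simp add: fib_state_space)
  define t where "t k = (if x \<in> interior (fib state_space (y k)) then x
    else SOME x. x \<in> interior (fib state_space (y k)))" for k
  have "t k \<in> interior (fib state_space (y k))" for k
    using interior_dual_slice[of "y k"] y unfolding t_def
    by (auto simp: fib_state_space intro!: someI_ex[of "\<lambda>x. x \<in> interior (dual_slice (y k))"])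
  moreover have "t \<longlonglongrightarrow> x"
    by (rule tendsto_eventually) (use ev in \<open>auto simp: t_def elim: eventually_mono\<close>)
  ultimately show "\<exists>t. (\<forall>k. t k \<in> interior (fib state_space (y k))) \<and> t \<longlonglongrightarrow> x" by blast
qed

end

section \<open>Affine functions and perturbed polytopes\<close>

lemma affine_onD:
  "affine_on S f \<Longrightarrow> x \<in> S \<Longrightarrow> y \<in> S \<Longrightarrow> 0 \<le> t \<Longrightarrow> t \<le> 1 \<Longrightarrow>
   f ((1 - t) *\<^sub>R x + t *\<^sub>R y) = (1 - t) *\<^sub>R f x + t *\<^sub>R f y"
  by (simp add: affine_on_def)

text \<open>The difference quotients of \<open>f\<close> at an interior point along a direction \<open>v\<close> are constant,
  and their value is linear in \<open>v\<close>.\<close>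

lemma affine_on_imp_formula:
  fixes f :: "'a::euclidean_space \<Rightarrow> real"
  assumes f: "affine_on S f" and S: "convex S" and x0: "x0 \<in> interior S"
  obtains a b where "\<And>x. x \<in> S \<Longrightarrow> f x = b + a \<bullet> x"
proof -
  obtain r where r: "r > 0" "ball x0 r \<subseteq> S"
    using x0 by (meson mem_interior)
  have x0S: "x0 \<in> S" using x0 interior_subset by blast
  define D where "D v t = (f (x0 + t *\<^sub>R v) - f x0) / t" for v t
  have shrink: "f (x0 + (l * t) *\<^sub>R v) - f x0 = l * (f (x0 + t *\<^sub>R v) - f x0)"
    if "0 \<le> l" "l \<le> 1" "x0 + t *\<^sub>R v \<in> S" for l t v
  proof -
    have "x0 + (l * t) *\<^sub>R v = (1 - l) *\<^sub>R x0 + l *\<^sub>R (x0 + t *\<^sub>R v)"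
      by (simp add: algebra_simps)
    then show ?thesis
      using affine_onD[OF f x0S that(3,1,2)] by (simp add: algebra_simps)
  qed
  have D_le: "D v s = D v t" if "0 < s" "s \<le> t" "x0 + t *\<^sub>R v \<in> S" for v s t
  proof -
    have t: "t > 0" using that by simp
    have "f (x0 + s *\<^sub>R v) - f x0 = (s / t) * (f (x0 + t *\<^sub>R v) - f x0)"
      using shrink[of "s / t" t v] that t by simp
    then show ?thesis using that(1) by (simp add: D_def)
  qed
  have D_const: "D v s = D v t" if "0 < s" "0 < t" "x0 + s *\<^sub>R v \<in> S" "x0 + t *\<^sub>R v \<in> S" for v s t
    using D_le[OF that(1) _ that(4)] D_le[OF that(2) _ that(3)] linear[of s t] by metis
  \<comment> \<open>A step along \<open>v\<close> that does not leave the ball of radius \<open>r\<close>.\<close>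
  define \<tau> where "\<tau> v = r / (2 * (norm v + 1))" for v :: 'a
  have \<tau>: "\<tau> v > 0" for v
    using r(1) norm_ge_zero[of v] unfolding \<tau>_def
      by (intro divide_pos_pos mult_pos_pos add_nonneg_pos) auto
  have small: "x0 + t *\<^sub>R v \<in> S" if "\<bar>t\<bar> * norm v < r" for t v
    using that r(2) by (auto simp: dist_norm)
  have \<tau>_small: "x0 + \<tau> v *\<^sub>R v \<in> S" for v
  proof (rule small)
    have "\<tau> v * (2 * (norm v + 1)) = r"
      using add_nonneg_pos[OF norm_ge_zero zero_less_one, of v] unfolding \<tau>_def by simp
    then have "\<tau> v * norm v + (\<tau> v * norm v + 2 * \<tau> v) = r" by (simp add: algebra_simps)
    moreover have "0 \<le> \<tau> v * norm v" using \<tau>[of v] by simp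
    ultimately have "\<tau> v * norm v < r" using \<tau>[of v] by linarith
    then show "\<bar>\<tau> v\<bar> * norm v < r" using \<tau>[of v] by simp
  qed
  define G where "G v = D v (\<tau> v)" for v
  have G_eq: "f (x0 + t *\<^sub>R v) - f x0 = t * G v" if "0 < t" "x0 + t *\<^sub>R v \<in> S" for t v
    using D_const[OF that(1) \<tau> that(2) \<tau>_small] that(1) by (simp add: G_def D_def field_simps)
  have G_scale: "G (c *\<^sub>R v) = c * G v" if "c > 0" for c v
  proof -
    have "x0 + (\<tau> (c *\<^sub>R v) * c) *\<^sub>R v \<in> S" using \<tau>_small[of "c *\<^sub>R v"] by simp
    then have "(\<tau> (c *\<^sub>R v) * c) * G v = \<tau> (c *\<^sub>R v) * G (c *\<^sub>R v)"
      using G_eq[of "\<tau> (c *\<^sub>R v) * c" v] G_eq[OF \<tau> \<tau>_small, of "c *\<^sub>R v"] \<tau>[of "c *\<^sub>R v"] that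
        by simp
    then show ?thesis using \<tau>[of "c *\<^sub>R v"] by simp
  qed
  have G_add: "G (v + w) = G v + G w" for v w
  proof -
    define t where "t = r / (4 * (norm v + norm w + 1))"
    have pos: "4 * (norm v + norm w + 1) > 0"
      by (intro mult_pos_pos add_nonneg_pos add_nonneg_nonneg) auto
    have t: "t > 0" using r(1) pos by (simp add: t_def)
    have "t * (4 * (norm v + norm w + 1)) = r" using pos by (simp add: t_def)
    then have "4 * (t * norm v) + 4 * (t * norm w) + 4 * t = r" by (simp add: algebra_simps)
    moreover have "0 \<le> t * norm v" "0 \<le> t * norm w" using t by auto
    ultimately have "2 * (t * norm v) < r" "2 * (t * norm w) < r" using t by linarith+
    then have le: "\<bar>2 * t\<bar> * norm v < r" "\<bar>2 * t\<bar> * norm w < r" using t by simp_all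
    have S1: "x0 + (2 * t) *\<^sub>R v \<in> S" and S2: "x0 + (2 * t) *\<^sub>R w \<in> S"
      using le by (auto intro!: small)
    have mid: "x0 + t *\<^sub>R (v + w)
      = (1 - 1/2) *\<^sub>R (x0 + (2 * t) *\<^sub>R v) + (1/2) *\<^sub>R (x0 + (2 * t) *\<^sub>R w)"
    proof -
      have "(1/2) *\<^sub>R x0 + (1/2) *\<^sub>R x0 = x0" by (simp flip: scaleR_left_distrib)
      then show ?thesis by (simp add: algebra_simps)
    qed
    have S3: "x0 + t *\<^sub>R (v + w) \<in> S"
      unfolding mid by (rule convexD_alt[OF S S1 S2]) auto
    have "f (x0 + t *\<^sub>R (v + w)) = (f (x0 + (2 * t) *\<^sub>R v) + f (x0 + (2 * t) *\<^sub>R w)) / 2"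
      unfolding mid using affine_onD[OF f S1 S2, of "1/2"] by simp
    then have "t * G (v + w) = t * (G v + G w)"
      using G_eq[OF t S3] G_eq[OF _ S1] G_eq[OF _ S2] t by (simp add: field_simps)
    then show ?thesis using t by simp
  qed
  have "linear G"
  proof
    show "G (v + w) = G v + G w" for v w by (rule G_add)
    have G0: "G 0 = 0" using G_add[of 0 0] by simp
    show "G (c *\<^sub>R v) = c *\<^sub>R G v" for c v
    proof (cases c "0::real" rule: linorder_cases)
      case less
      have "G (c *\<^sub>R v) + G ((- c) *\<^sub>R v) = 0" using G_add[of "c *\<^sub>R v" "(- c) *\<^sub>R v"] G0 by simp
      then show ?thesis using G_scale[of "- c" v] less by simp
    qed (use G0 G_scale in auto)
  qed
  then have Ga: "G v = adjoint G 1 \<bullet> v" for v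
    using adjoint_works[of G v 1] by (simp add: inner_commute)
  show thesis
  proof (rule that)
    fix x assume "x \<in> S"
    then have "f x - f x0 = G (x - x0)" using G_eq[of 1 "x - x0"] by simp
    then show "f x = (f x0 - adjoint G 1 \<bullet> x0) + adjoint G 1 \<bullet> x"
      by (simp add: Ga inner_diff_right)
  qed
qed

lemma affine_formula_on_ball:
  fixes a a' :: "'a::euclidean_space"
  assumes "r > 0" "\<And>x. x \<in> cball x0 r \<Longrightarrow> b + a \<bullet> x = b' + a' \<bullet> x"
  shows "a = a' \<and> b = b'"
proof -
  let ?w = "r *\<^sub>R ((a - a') /\<^sub>R norm (a - a'))"
  have "norm ?w \<le> r"
    using assms(1) by (cases "a = a'") simp_all
  then have "x0 + ?w \<in> cball x0 r"
    by (simp add: dist_norm del: norm_scaleR)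
  from assms(2)[OF this] assms(2)[of x0] assms(1)
  have "(a - a') \<bullet> ?w = 0"
    by (simp add: inner_add_right inner_diff_left del: inner_scaleR_right scaleR_scaleR)
  then have "r * (inverse (norm (a - a')) * ((a - a') \<bullet> (a - a'))) = 0"
    by (simp only: inner_scaleR_right)
  then have "a = a'" using assms(1) by auto
  with assms(2)[of x0] assms(1) show ?thesis by simp
qed

text \<open>A point that a convex set \<open>C\<close> misses is separated from the hull of points of \<open>C\<close> that are
  \<open>\<delta>\<close>-close to the vertices; the half-space moved by \<open>\<delta>\<close> contains the polytope.\<close>

lemma cball_subset_perturbed_hull:
  fixes C :: "'a::euclidean_space set"
  assumes C: "convex C" and V: "finite V" and r: "cball x r \<subseteq> convex hull V" "0 \<le> r"
    and near: "\<And>p. p \<in> V \<Longrightarrow> \<exists>q\<in>C. dist p q \<le> \<delta>"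
  shows "cball x (r - \<delta>) \<subseteq> C"
proof
  fix z assume z: "z \<in> cball x (r - \<delta>)"
  obtain q where q: "\<And>p. p \<in> V \<Longrightarrow> q p \<in> C" "\<And>p. p \<in> V \<Longrightarrow> dist p (q p) \<le> \<delta>"
    using near by metis
  let ?H = "convex hull (q ` V)"
  have "z \<in> ?H"
  proof (rule ccontr)
    assume "z \<notin> ?H"
    then obtain a b where ab: "a \<bullet> z < b" "\<And>t. t \<in> ?H \<Longrightarrow> a \<bullet> t > b"
      using separating_hyperplane_closed_point[of ?H z] V
      by (metis compact_convex_hull compact_imp_closed convex_convex_hull finite_imageI
        finite_imp_compact)
    have "V \<subseteq> {p. a \<bullet> p \<ge> b - norm a * \<delta>}"
    proof
      fix p assume p: "p \<in> V"
      then have "a \<bullet> q p > b" by (intro ab(2) hull_inc) auto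
      moreover have "a \<bullet> (q p - p) \<le> norm a * \<delta>"
        using q(2)[OF p] norm_cauchy_schwarz[of a "q p - p"] mult_left_mono[of "norm (q p - p)" \<delta>
          "norm a"]
        by (simp add: dist_norm norm_minus_commute)
      ultimately show "p \<in> {p. a \<bullet> p \<ge> b - norm a * \<delta>}" by (simp add: inner_diff_right)
    qed
    then have "convex hull V \<subseteq> {p. a \<bullet> p \<ge> b - norm a * \<delta>}"
      by (rule hull_minimal) (rule convex_halfspace_ge)
    moreover have "x - r *\<^sub>R (a /\<^sub>R norm a) \<in> cball x r"
      using r(2) by (cases "a = 0") (simp_all add: dist_norm mult.assoc)
    ultimately have "x - r *\<^sub>R (a /\<^sub>R norm a) \<in> {p. a \<bullet> p \<ge> b - norm a * \<delta>}"
      using r(1) by blast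
    then have "b - norm a * \<delta> \<le> a \<bullet> x - r * (inverse (norm a) * (a \<bullet> a))"
      by (simp add: inner_diff_right)
    moreover have "inverse (norm a) * (a \<bullet> a) = norm a"
      by (cases "a = 0") (simp_all add: dot_square_norm power2_eq_square)
    ultimately have "b \<le> a \<bullet> x - norm a * (r - \<delta>)" by (simp add: algebra_simps)
    moreover have "a \<bullet> (x - z) \<le> norm a * (r - \<delta>)"
      using z norm_cauchy_schwarz[of a "x - z"] mult_left_mono[of "norm (x - z)" "r - \<delta>" "norm a"]
      by (simp add: dist_norm)
    ultimately show False using ab(1) by (simp add: inner_diff_right)
  qed
  moreover have "?H \<subseteq> C" using q(1) C by (intro hull_minimal) auto
  ultimately show "z \<in> C" by blast
qed

text \<open>A small cube serves as the polytope.\<close>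

lemma polytope_neighbourhood:
  fixes x :: "'a::euclidean_space"
  assumes "open U" "x \<in> U"
  obtains d V where "d > 0" "finite V" "cball x d \<subseteq> convex hull V" "V \<subseteq> U"
proof -
  obtain r where r: "r > 0" "ball x r \<subseteq> U" using assms by (meson openE)
  define d where "d = r / (2 * real DIM('a))"
  have d: "d > 0" using r(1) by (simp add: d_def)
  obtain V :: "'a set" where V: "finite V"
    "cbox (x - (\<Sum>i\<in>Basis. d *\<^sub>R i)) (x + (\<Sum>i\<in>Basis. d *\<^sub>R i)) = convex hull V"
    using cube_convex_hull[OF d, of x] by metis
  have cube: "z \<in> convex hull V \<longleftrightarrow> (\<forall>i\<in>Basis. \<bar>(z - x) \<bullet> i\<bar> \<le> d)" for z
    unfolding V(2)[symmetric] mem_box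
    by (auto simp: inner_diff_left inner_add_left abs_le_iff intro!: ball_cong)
  have "cball x d \<subseteq> convex hull V"
  proof
    fix z assume "z \<in> cball x d"
    then have "norm (z - x) \<le> d" by (simp add: dist_norm norm_minus_commute)
    then show "z \<in> convex hull V"
      unfolding cube using Basis_le_norm order_trans by blast
  qed
  moreover have "V \<subseteq> U"
  proof
    fix z assume "z \<in> V"
    then have "\<forall>i\<in>Basis. \<bar>(z - x) \<bullet> i\<bar> \<le> d" using cube hull_inc by metis
    then have "(\<Sum>i\<in>Basis. \<bar>(z - x) \<bullet> i\<bar>) \<le> (\<Sum>i\<in>(Basis::'a set). d)" by (intro sum_mono) auto
    then have "norm (z - x) \<le> real DIM('a) * d" using norm_le_l1[of "z - x"] by simp
    also have "\<dots> < r" using r(1) by (simp add: d_def)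
    finally show "z \<in> U" using r(2) by (auto simp: dist_norm norm_minus_commute)
  qed
  ultimately show thesis using that d V(1) by blast
qed

section \<open>Compact regular partially convex sets\<close>

lemma mem_fib [simp]: "x \<in> fib K y \<longleftrightarrow> (x, y) \<in> K"
  by (simp add: fib_def)

lemma pi2_eq: "pi2 K = snd ` K"
  by (force simp: pi2_def)

lemma pi2I: "(x, y) \<in> K \<Longrightarrow> y \<in> pi2 K"
  by (auto simp: pi2_def)

lemma snd_pi2: "p \<in> K \<Longrightarrow> snd p \<in> pi2 K"
  by (simp add: pi2_eq)

locale compact_regular =
  fixes K :: "((real^'n) \<times> (real^'m)) set"
  assumes cpt: "compact K" and reg: "regular_partially_convex K"
begin

lemma compact_base: "compact (pi2 K)"
  unfolding pi2_eq by (intro compact_continuous_image continuous_intros cpt)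

lemma convex_fib: "y \<in> pi2 K \<Longrightarrow> convex (fib K y)"
  using reg by (simp add: regular_partially_convex_def partially_convex_def)

lemma interior_fib: "y \<in> pi2 K \<Longrightarrow> interior (fib K y) \<noteq> {}"
  using reg by (simp add: regular_partially_convex_def)

lemma lower_hemicontinuous:
  assumes "y0 \<in> pi2 K" "\<And>k::nat. s k \<in> pi2 K" "s \<longlonglongrightarrow> y0" "x \<in> interior (fib K y0)"
  shows "\<exists>t. (\<forall>k. t k \<in> interior (fib K (s k))) \<and> t \<longlonglongrightarrow> x"
proof -
  have "\<forall>y\<in>pi2 K. \<forall>s. (\<forall>k. s k \<in> pi2 K) \<and> s \<longlonglongrightarrow> y \<longrightarrow>
      (\<forall>x\<in>interior (fib K y). \<exists>t. (\<forall>k::nat. t k \<in> interior (fib K (s k))) \<and> t \<longlonglongrightarrow> x)"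
    using reg unfolding regular_partially_convex_def by (elim conjE)
  from bspec[OF this assms(1)] assms(2-4) show ?thesis by simp
qed

lemma compact_fib: "compact (fib K y)"
proof -
  have "fib K y = fst ` (K \<inter> (UNIV \<times> {y}))" by (force simp: fib_def)
  moreover have "closed (UNIV \<times> {y} :: ((real^'n) \<times> (real^'m)) set)" by (intro closed_Times) auto
  ultimately show ?thesis
    using cpt by (auto intro!: compact_continuous_image continuous_intros compact_Int_closed)
qed

text \<open>By lower hemicontinuity the vertices of a polytope around \<open>x\<close> are limits of points of the
  nearby fibres, which therefore contain a fixed ball around \<open>x\<close>.\<close>

lemma interior_fib_persists:
  assumes y0: "y0 \<in> pi2 K" and x: "x \<in> interior (fib K y0)"
  obtains \<epsilon> \<delta> where "\<epsilon> > 0" "\<delta> > 0"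
    "\<And>y. y \<in> pi2 K \<Longrightarrow> dist y y0 < \<delta> \<Longrightarrow> cball x \<epsilon> \<subseteq> fib K y"
proof -
  obtain d V where d: "d > 0" and V: "finite V" "cball x d \<subseteq> convex hull V"
    "V \<subseteq> interior (fib K y0)"
    using polytope_neighbourhood[OF open_interior x] by metis
  have "\<exists>\<delta>>0. \<forall>y\<in>pi2 K. dist y y0 < \<delta> \<longrightarrow> cball x (d / 2) \<subseteq> fib K y"
  proof (rule ccontr)
    assume "\<not> ?thesis"
    then have "\<forall>k::nat. \<exists>y. y \<in> pi2 K \<and> dist y y0 < inverse (Suc k) \<and> \<not> cball x (d / 2) \<subseteq> fib K y"
      by (metis inverse_positive_iff_positive of_nat_0_less_iff zero_less_Suc)
    then obtain s where s: "\<And>k::nat. s k \<in> pi2 K" "\<And>k. dist (s k) y0 < inverse (Suc k)"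
      "\<And>k. \<not> cball x (d / 2) \<subseteq> fib K (s k)" by metis
    have "s \<longlonglongrightarrow> y0"
    proof (rule metric_tendsto_imp_tendsto[of "\<lambda>k. inverse (real (Suc k))" 0])
      show "(\<lambda>k. inverse (real (Suc k))) \<longlonglongrightarrow> 0" by (rule LIMSEQ_inverse_real_of_nat)
      show "\<forall>\<^sub>F k in sequentially. dist (s k) y0 \<le> dist (inverse (real (Suc k))) 0"
        using s(2) by (intro always_eventually allI) (simp add: less_imp_le)
    qed
    have "\<forall>\<^sub>F k in sequentially. \<exists>q\<in>fib K (s k). dist p q \<le> d / 2" if p: "p \<in> V" for p
    proof -
      obtain t where t: "\<And>k. t k \<in> interior (fib K (s k))" "t \<longlonglongrightarrow> p"
        using lower_hemicontinuous[OF y0 s(1) \<open>s \<longlonglongrightarrow> y0\<close>, of p] V(3) p by blast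
      have "\<forall>\<^sub>F k in sequentially. dist (t k) p < d / 2"
        using tendstoD[OF t(2), of "d / 2"] d by simp
      then show ?thesis
      proof (rule eventually_mono)
        fix k assume "dist (t k) p < d / 2"
        then show "\<exists>q\<in>fib K (s k). dist p q \<le> d / 2"
          using t(1)[of k] interior_subset
            by (intro bexI[of _ "t k"]) (auto simp: dist_commute simp del: mem_fib)
      qed
    qed
    then have "\<forall>\<^sub>F k in sequentially. \<forall>p\<in>V. \<exists>q\<in>fib K (s k). dist p q \<le> d / 2"
      using V(1) by (simp add: eventually_ball_finite_distrib)
    then obtain k where k: "\<forall>p\<in>V. \<exists>q\<in>fib K (s k). dist p q \<le> d / 2"
      using eventually_happens[of _ sequentially] sequentially_bot by blast
    have "cball x (d - d / 2) \<subseteq> fib K (s k)"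
      using k d by (intro cball_subset_perturbed_hull[OF convex_fib[OF s(1)] V(1,2)]) auto
    then show False using s(3) by simp
  qed
  then obtain \<delta> where "\<delta> > 0" "\<And>y. y \<in> pi2 K \<Longrightarrow> dist y y0 < \<delta> \<Longrightarrow> cball x (d / 2) \<subseteq> fib K y"
    by blast
  with d show thesis by (intro that[of "d / 2" \<delta>]) auto
qed

text \<open>Compactness of the base makes the local radius uniform.\<close>

lemma uniform_inner_radius:
  obtains \<epsilon> where "\<epsilon> > 0" "\<And>y. y \<in> pi2 K \<Longrightarrow> \<exists>x. cball x \<epsilon> \<subseteq> fib K y"
proof -
  have "\<exists>\<epsilon>>0. \<forall>y\<in>pi2 K. \<exists>x. cball x \<epsilon> \<subseteq> fib K y"
  proof (rule ccontr)
    assume "\<not> ?thesis"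
    then have "\<forall>k::nat. \<exists>y. y \<in> pi2 K \<and> (\<forall>x. \<not> cball x (inverse (Suc k)) \<subseteq> fib K y)"
      by (metis inverse_positive_iff_positive of_nat_0_less_iff zero_less_Suc)
    then obtain s where s: "\<And>k::nat. s k \<in> pi2 K" "\<And>k x. \<not> cball x (inverse (Suc k)) \<subseteq> fib K (s k)"
      by metis
    obtain y0 r where y0: "y0 \<in> pi2 K" and r: "strict_mono (r :: nat \<Rightarrow> nat)" and lim: "(s \<circ> r) \<longlonglongrightarrow> y0"
      using compact_base s(1) unfolding compact_def by metis
    obtain x where "x \<in> interior (fib K y0)" using interior_fib[OF y0] by blast
    then obtain \<epsilon> \<delta> where ed: "\<epsilon> > 0" "\<delta> > 0"
      "\<And>y. y \<in> pi2 K \<Longrightarrow> dist y y0 < \<delta> \<Longrightarrow> cball x \<epsilon> \<subseteq> fib K y"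
      using interior_fib_persists[OF y0] by metis
    have "(\<lambda>k. inverse (real (Suc (r k)))) \<longlonglongrightarrow> 0"
      using LIMSEQ_subseq_LIMSEQ[OF LIMSEQ_inverse_real_of_nat r] by (simp add: comp_def)
    then have "\<forall>\<^sub>F k in sequentially. inverse (real (Suc (r k))) < \<epsilon>"
      using order_tendstoD(2) ed(1) by blast
    moreover have "\<forall>\<^sub>F k in sequentially. dist ((s \<circ> r) k) y0 < \<delta>"
      using tendstoD[OF lim ed(2)] .
    ultimately have "\<forall>\<^sub>F k in sequentially. inverse (real (Suc (r k))) < \<epsilon>
      \<and> dist ((s \<circ> r) k) y0 < \<delta>"
      by (rule eventually_conj)
    then obtain k where k: "inverse (real (Suc (r k))) < \<epsilon>" "dist (s (r k)) y0 < \<delta>"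
      using eventually_happens[of _ sequentially] by auto
    have "cball x (inverse (Suc (r k))) \<subseteq> cball x \<epsilon>" using k(1) by (intro subset_cball) simp
    then show False using ed(3)[OF s(1) k(2)] s(2) by blast
  qed
  then show thesis using that by blast
qed

subsection \<open>Continuous partially affine functions have continuous coefficients\<close>

definition lift_aff :: "(real^'m \<Rightarrow> real) \<Rightarrow> (real^'m \<Rightarrow> real^'n) \<Rightarrow> (real^'n) \<times> (real^'m) \<Rightarrow> real" where
  "lift_aff b c = (\<lambda>p. if p \<in> K then b (snd p) + c (snd p) \<bullet> fst p else 0)"

lemma lift_aff_in [simp]: "p \<in> K \<Longrightarrow> lift_aff b c p = b (snd p) + c (snd p) \<bullet> fst p"
  by (simp add: lift_aff_def)

lemma lift_aff_caff:
  assumes "continuous_on (pi2 K) b" "continuous_on (pi2 K) c"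
  shows "lift_aff b c \<in> caff_set K"
  unfolding caff_set_def
proof (intro CollectI conjI ballI)
  have "continuous_on K (\<lambda>p. b (snd p) + c (snd p) \<bullet> fst p)"
    by (intro continuous_intros continuous_on_compose2[OF assms(1)] continuous_on_compose2[OF
      assms(2)])
      (auto intro: pi2I)
  then show "continuous_on K (lift_aff b c)"
    by (rule continuous_on_eq) simp
  fix y assume y: "y \<in> pi2 K"
  show "affine_on (fib K y) (\<lambda>x. lift_aff b c (x, y))"
    unfolding affine_on_def
  proof (intro ballI)
    fix x x' and t :: real assume h: "x \<in> fib K y" "x' \<in> fib K y" "t \<in> {0..1}"
    then have "(1 - t) *\<^sub>R x + t *\<^sub>R x' \<in> fib K y"
      using convexD_alt[OF convex_fib[OF y]] by auto
    with h show "lift_aff b c ((1 - t) *\<^sub>R x + t *\<^sub>R x', y) =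
        (1 - t) *\<^sub>R lift_aff b c (x, y) + t *\<^sub>R lift_aff b c (x', y)"
      by (simp add: inner_add_right) (simp add: algebra_simps)
  qed
qed (auto simp: lift_aff_def)

lemma caff_tendsto:
  fixes f :: "(real^'n) \<times> (real^'m) \<Rightarrow> real"
  assumes f: "continuous_on K f" and "\<delta> > 0" "y0 \<in> pi2 K"
    and near: "\<And>y. y \<in> pi2 K \<Longrightarrow> dist y y0 < \<delta> \<Longrightarrow> (x, y) \<in> K"
  shows "((\<lambda>y. f (x, y)) \<longlongrightarrow> f (x, y0)) (at y0 within pi2 K)"
  unfolding tendsto_iff eventually_at
proof (intro allI impI)
  fix \<epsilon> :: real assume "\<epsilon> > 0"
  have "(x, y0) \<in> K" using near[OF assms(3)] assms(2) by simp
  then obtain d where d: "d > 0" "\<And>p. p \<in> K \<Longrightarrow> dist p (x, y0) < d \<Longrightarrow> dist (f p) (f (x, y0)) < \<epsilon>"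
    using f \<open>\<epsilon> > 0\<close> unfolding continuous_on_iff by metis
  show "\<exists>d>0. \<forall>y\<in>pi2 K. y \<noteq> y0 \<and> dist y y0 < d \<longrightarrow> dist (f (x, y)) (f (x, y0)) < \<epsilon>"
    using d near assms(2) by (intro exI[of _ "min d \<delta>"]) (auto simp: dist_Pair_Pair)
qed

text \<open>Near \<open>y\<^sub>0\<close> the fibres contain a fixed ball around some \<open>x\<^sub>0\<close>, and the linear coefficients
  are difference quotients of \<open>f\<close> between points \<open>(x, y)\<close> with fixed \<open>x\<close> in that ball.\<close>

lemma caff_coefficients:
  assumes f: "f \<in> caff_set K"
  obtains b c where "continuous_on (pi2 K) b" "continuous_on (pi2 K) c" "f = lift_aff b c"
proof -
  have fc: "continuous_on K f" and f0: "\<And>p. p \<notin> K \<Longrightarrow> f p = 0"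
    and fa: "\<And>y. y \<in> pi2 K \<Longrightarrow> affine_on (fib K y) (\<lambda>x. f (x, y))"
    using f by (auto simp: caff_set_def)
  have "\<exists>c b. \<forall>x. (x, y) \<in> K \<longrightarrow> f (x, y) = b + c \<bullet> x" if y: "y \<in> pi2 K" for y
  proof -
    obtain x0 where "x0 \<in> interior (fib K y)" using interior_fib[OF y] by blast
    then show ?thesis
      using affine_on_imp_formula[OF fa[OF y] convex_fib[OF y]] by (metis mem_fib)
  qed
  then obtain b c where bc: "\<And>y x. y \<in> pi2 K \<Longrightarrow> (x, y) \<in> K \<Longrightarrow> f (x, y) = b y + c y \<bullet> x"
    by metis
  have eq: "f = lift_aff b c"
    using bc f0 by (auto simp: lift_aff_def fun_eq_iff intro: pi2I)
  have cont: "(c \<longlongrightarrow> c y0) (at y0 within pi2 K) \<and> (b \<longlongrightarrow> b y0) (at y0 within pi2 K)"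
    if y0: "y0 \<in> pi2 K" for y0
  proof -
    obtain x0 where "x0 \<in> interior (fib K y0)" using interior_fib[OF y0] by blast
    then obtain \<epsilon> \<delta> where ed: "\<epsilon> > 0" "\<delta> > 0"
      "\<And>y. y \<in> pi2 K \<Longrightarrow> dist y y0 < \<delta> \<Longrightarrow> cball x0 \<epsilon> \<subseteq> fib K y"
      using interior_fib_persists[OF y0] by metis
    have inK: "(x, y) \<in> K" if "y \<in> pi2 K" "dist y y0 < \<delta>" "dist x0 x \<le> \<epsilon>" for x y
      using ed(3)[OF that(1,2)] that(3) by auto
    have lim: "((\<lambda>y. f (x, y)) \<longlongrightarrow> f (x, y0)) (at y0 within pi2 K)" if "dist x0 x \<le> \<epsilon>" for x
      by (rule caff_tendsto[OF fc ed(2) y0]) (rule inK[OF _ _ that])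
    have comp: "c y $ i = (f (x0 + \<epsilon> *\<^sub>R axis i 1, y) - f (x0, y)) / \<epsilon>"
      if "y \<in> pi2 K" "dist y y0 < \<delta>" for y i
    proof -
      have "(x0 + \<epsilon> *\<^sub>R axis i 1, y) \<in> K" "(x0, y) \<in> K"
        using inK[OF that] ed(1) by (auto simp: dist_norm norm_axis_1)
      then show ?thesis using bc[OF that(1)] ed(1) by (simp add: inner_add_right inner_axis)
    qed
    have ev: "\<forall>\<^sub>F y in at y0 within pi2 K. y \<in> pi2 K \<and> dist y y0 < \<delta>"
      using ed(2) by (auto simp: eventually_at)
    have c: "(c \<longlongrightarrow> c y0) (at y0 within pi2 K)"
    proof (rule vec_tendstoI)
      fix i
      have "((\<lambda>y. (f (x0 + \<epsilon> *\<^sub>R axis i 1, y) - f (x0, y)) / \<epsilon>) \<longlongrightarrow>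
          (f (x0 + \<epsilon> *\<^sub>R axis i 1, y0) - f (x0, y0)) / \<epsilon>) (at y0 within pi2 K)"
        using ed(1) by (intro tendsto_intros lim) (auto simp: dist_norm norm_axis_1)
      then show "((\<lambda>y. c y $ i) \<longlongrightarrow> c y0 $ i) (at y0 within pi2 K)"
        unfolding comp[OF y0, simplified, OF ed(2)]
        by (rule Lim_transform_eventually) (use ev comp in \<open>auto elim: eventually_mono\<close>)
    qed
    have b: "b y = f (x0, y) - c y \<bullet> x0" if "y \<in> pi2 K" "dist y y0 < \<delta>" for y
      using bc[OF that(1) inK[OF that, of x0]] ed(1) by simp
    have "((\<lambda>y. f (x0, y) - c y \<bullet> x0) \<longlongrightarrow> f (x0, y0) - c y0 \<bullet> x0) (at y0 within pi2 K)"
      using ed(1) by (intro tendsto_intros lim c) auto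
    then have "(b \<longlongrightarrow> b y0) (at y0 within pi2 K)"
      unfolding b[OF y0, simplified, OF ed(2)]
      by (rule Lim_transform_eventually) (use ev b in \<open>auto elim: eventually_mono\<close>)
    with c show ?thesis by blast
  qed
  have "continuous_on (pi2 K) b" "continuous_on (pi2 K) c"
    using cont by (auto simp: continuous_on_def)
  with eq show thesis using that by blast
qed

lemma lift_aff_inj:
  assumes "lift_aff b c = lift_aff b' c'" "y \<in> pi2 K"
  shows "b y = b' y \<and> c y = c' y"
proof -
  obtain x r where x: "r > 0" "cball x r \<subseteq> fib K y"
    using interior_fib[OF assms(2)] by (meson all_not_in_conv mem_interior_cball)
  have "b y + c y \<bullet> z = b' y + c' y \<bullet> z" if "z \<in> cball x r" for z
    using fun_cong[OF assms(1), of "(z, y)"] x(2) that by auto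
  then show ?thesis using affine_formula_on_ball[OF x(1), of x "b y" "c y" "b' y" "c' y"] by blast
qed

subsection \<open>Extending positive elements from a fibre\<close>

text \<open>The minimum over the fibres is continuous: lower semicontinuity is compactness, upper
  semicontinuity holds because a value close to the minimum is taken at an interior point, which
  stays in the nearby fibres.\<close>

lemma continuous_fibre_min:
  fixes f :: "(real^'n) \<times> (real^'m) \<Rightarrow> real"
  assumes f: "continuous_on K f"
  shows "continuous_on (pi2 K) (\<lambda>y. Inf ((\<lambda>x. f (x, y)) ` fib K y))"
proof -
  define m where "m y = Inf ((\<lambda>x. f (x, y)) ` fib K y)" for y
  have fy: "continuous_on (fib K y) (\<lambda>x. f (x, y))" for y
    by (rule continuous_on_compose2[OF f]) (auto intro!: continuous_intros)
  have cpt_im: "compact ((\<lambda>x. f (x, y)) ` fib K y)" for y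
    by (intro compact_continuous_image fy compact_fib)
  have m_le: "m y \<le> f (x, y)" if "(x, y) \<in> K" for x y
    unfolding m_def using that bounded_imp_bdd_below[OF compact_imp_bounded[OF cpt_im]]
    by (intro cInf_lower) auto
  have m_attained: "\<exists>x. (x, y) \<in> K \<and> m y = f (x, y)" if "y \<in> pi2 K" for y
  proof -
    have "fib K y \<noteq> {}" using that by (auto simp: pi2_def)
    then obtain x where x: "x \<in> fib K y" "\<And>x'. x' \<in> fib K y \<Longrightarrow> f (x, y) \<le> f (x', y)"
      using continuous_attains_inf[OF compact_fib _ fy] by metis
    then have "m y = f (x, y)" unfolding m_def by (intro cInf_eq_minimum) auto
    with x(1) show ?thesis by auto
  qed
  have "\<exists>d>0. \<forall>y\<in>pi2 K. dist y y0 < d \<longrightarrow> dist (m y) (m y0) < \<epsilon>"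
    if y0: "y0 \<in> pi2 K" and "\<epsilon> > 0" for y0 \<epsilon>
  proof -
    \<comment> \<open>Move the minimiser into the interior at the cost of \<open>\<epsilon> / 2\<close>.\<close>
    obtain x1 where x1: "(x1, y0) \<in> K" "m y0 = f (x1, y0)" using m_attained[OF y0] by blast
    have "x1 \<in> closure (interior (fib K y0))"
      using convex_closure_interior[OF convex_fib[OF y0] interior_fib[OF y0]] x1(1) closure_subset
        by fastforce
    moreover obtain d1 where d1: "d1 > 0"
      "\<And>x. x \<in> fib K y0 \<Longrightarrow> dist x x1 < d1 \<Longrightarrow> dist (f (x, y0)) (f (x1, y0)) < \<epsilon> / 2"
      using fy[of y0] x1(1) \<open>\<epsilon> > 0\<close> unfolding continuous_on_iff by (metis half_gt_zero mem_fib)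
    ultimately obtain x where x: "x \<in> interior (fib K y0)" "dist x x1 < d1"
      unfolding closure_approachable by blast
    have fx: "f (x, y0) < m y0 + \<epsilon> / 2"
    proof -
      have "x \<in> fib K y0" using x(1) interior_subset by blast
      then show ?thesis using d1(2)[of x] x(2) x1(2) unfolding dist_real_def by linarith
    qed
    obtain r \<delta> where ed: "r > 0" "\<delta> > 0" "\<And>y. y \<in> pi2 K \<Longrightarrow> dist y y0 < \<delta> \<Longrightarrow> cball x r \<subseteq> fib K y"
      using interior_fib_persists[OF y0 x(1)] by metis
    have inK: "(x, y) \<in> K" if "y \<in> pi2 K" "dist y y0 < \<delta>" for y
      using subsetD[OF ed(3)[OF that], of x] ed(1) by simp
    have "((\<lambda>y. f (x, y)) \<longlongrightarrow> f (x, y0)) (at y0 within pi2 K)"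
      by (rule caff_tendsto[OF f ed(2) y0 inK])
    then obtain d2 where d2: "d2 > 0" "\<And>y. y \<in> pi2 K \<Longrightarrow> dist y y0 < d2
      \<Longrightarrow> dist (f (x, y)) (f (x, y0)) < \<epsilon> / 2"
      using \<open>\<epsilon> > 0\<close> unfolding tendsto_iff eventually_at by (metis dist_self half_gt_zero)
    \<comment> \<open>The points with a much smaller value project to a compact set that omits \<open>y0\<close>.\<close>
    define T where "T = {p \<in> K. f p \<le> m y0 - \<epsilon> / 2}"
    have "closed T" unfolding T_def
      using f compact_imp_closed[OF cpt] by (intro continuous_on_closed_Collect_le
        continuous_intros)
    then have "compact T"
      using cpt by (metis (no_types, lifting) T_def closed_Int_compact inf.absorb1 mem_Collect_eq
        subsetI)
    then have "closed (snd ` T)"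
      by (intro compact_imp_closed compact_continuous_image continuous_intros)
    moreover have "y0 \<notin> snd ` T"
      using m_le \<open>\<epsilon> > 0\<close> by (force simp: T_def)
    ultimately obtain d3 where d3: "d3 > 0" "\<And>y. dist y y0 < d3 \<Longrightarrow> y \<notin> snd ` T"
      by (metis ComplD ComplI open_Compl open_dist)
    have "dist (m y) (m y0) < \<epsilon>" if y: "y \<in> pi2 K" "dist y y0 < min \<delta> (min d2 d3)" for y
    proof -
      have "m y \<le> f (x, y)" using m_le inK y by simp
      also have "\<dots> < m y0 + \<epsilon>" using d2(2)[OF y(1)] y(2) fx
        unfolding dist_real_def min_less_iff_conj by linarith
      finally have "m y < m y0 + \<epsilon>" .
      moreover obtain x' where x': "(x', y) \<in> K" "m y = f (x', y)" using m_attained[OF y(1)]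
        by blast
      have "(x', y) \<notin> T" using d3(2)[of y] y(2) by force
      then have "m y > m y0 - \<epsilon>" using x' \<open>\<epsilon> > 0\<close> by (simp add: T_def)
      ultimately show ?thesis by (simp add: dist_real_def)
    qed
    then show ?thesis
      using ed(2) d2(1) d3(1) by (intro exI[of _ "min \<delta> (min d2 d3)"]) auto
  qed
  then show ?thesis unfolding continuous_on_iff m_def by blast
qed

text \<open>The negative part of the minimum over the fibres is a continuous function of \<open>y\<close> that
  vanishes at \<open>y\<^sub>0\<close>; adding it makes the function nonnegative.\<close>

lemma extend_positive:
  assumes b: "continuous_on (pi2 K) b" and c: "continuous_on (pi2 K) c" and y0: "y0 \<in> pi2 K"
    and pos: "\<And>x. (x, y0) \<in> K \<Longrightarrow> 0 \<le> b y0 + c y0 \<bullet> x"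
  obtains b' where "continuous_on (pi2 K) b'" "b' y0 = b y0"
    "\<And>x y. (x, y) \<in> K \<Longrightarrow> 0 \<le> b' y + c y \<bullet> x"
proof -
  let ?f = "lift_aff b c"
  define m where "m y = Inf ((\<lambda>x. ?f (x, y)) ` fib K y)" for y
  have f: "continuous_on K ?f" using lift_aff_caff[OF b c] by (simp add: caff_set_def)
  have m_le: "m y \<le> ?f (x, y)" if "(x, y) \<in> K" for x y
  proof -
    have "compact ((\<lambda>x. ?f (x, y)) ` fib K y)"
      by (intro compact_continuous_image compact_fib continuous_on_compose2[OF f])
        (auto intro!: continuous_intros)
    then show ?thesis
      unfolding m_def using that by (intro cInf_lower) (auto intro: bounded_imp_bdd_below
        compact_imp_bounded)
  qed
  have "0 \<le> m y0"
    unfolding m_def using y0 pos by (intro cInf_greatest) (auto simp: pi2_def)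
  then have "b y0 + max 0 (- m y0) = b y0" by simp
  moreover have "continuous_on (pi2 K) (\<lambda>y. b y + max 0 (- m y))"
    unfolding m_def by (intro continuous_intros b continuous_fibre_min f)
  moreover have "0 \<le> b y + max 0 (- m y) + c y \<bullet> x" if "(x, y) \<in> K" for x y
    using m_le[OF that] that by simp
  ultimately show thesis using that by blast
qed

end

section \<open>The order unit space of continuous partially affine functions\<close>

lemma scaleR_fun_apply [simp]: "(r *\<^sub>R f) x = r *\<^sub>R f x"
  by (simp add: scaleR_fun_def)

lemma C_aff_simps [simp]:
  "vcarrier (C_aff K) = caff_set K"
  "pos (C_aff K) = {f \<in> caff_set K. \<forall>p\<in>K. 0 \<le> f p}"
  "ounit (C_aff K) = (\<lambda>p. if p \<in> K then 1 else 0)"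
  "reps (C_aff K) = (\<lambda>p. \<lambda>f\<in>caff_set K. f p) ` K"
  by (simp_all add: C_aff_def)

context compact_regular
begin

lemma lift_aff_cong:
  "(\<And>y. y \<in> pi2 K \<Longrightarrow> b y = b' y \<and> c y = c' y) \<Longrightarrow> lift_aff b c = lift_aff b' c'"
  by (auto simp: lift_aff_def fun_eq_iff dest: pi2I)

lemma lift_aff_add: "lift_aff b c + lift_aff b' c' = lift_aff (\<lambda>y. b y + b' y) (\<lambda>y. c y + c' y)"
  by (auto simp: lift_aff_def fun_eq_iff inner_add_left)

lemma lift_aff_scale: "r *\<^sub>R lift_aff b c = lift_aff (\<lambda>y. r * b y) (\<lambda>y. r *\<^sub>R c y)"
  by (auto simp: lift_aff_def fun_eq_iff algebra_simps)

lemma lift_aff_const: "(\<lambda>p. if p \<in> K then r else 0) = lift_aff (\<lambda>_. r) (\<lambda>_. 0)"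
  by (auto simp: lift_aff_def fun_eq_iff)

lemma subspace_caff: "subspace (caff_set K)"
proof -
  have "0 \<in> caff_set K"
    by (auto simp: caff_set_def affine_on_def zero_fun_def)
  moreover have "f + h \<in> caff_set K" if fh: "f \<in> caff_set K" "h \<in> caff_set K" for f h
  proof -
    obtain b c where bc: "continuous_on (pi2 K) b" "continuous_on (pi2 K) c" "f = lift_aff b c"
      by (rule caff_coefficients[OF fh(1)])
    obtain b' c' where bc': "continuous_on (pi2 K) b'" "continuous_on (pi2 K) c'" "h
      = lift_aff b' c'"
      by (rule caff_coefficients[OF fh(2)])
    show ?thesis unfolding bc(3) bc'(3) lift_aff_add
      using bc bc' by (intro lift_aff_caff continuous_intros)
  qed
  moreover have "r *\<^sub>R f \<in> caff_set K" if f: "f \<in> caff_set K" for r f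
  proof -
    obtain b c where bc: "continuous_on (pi2 K) b" "continuous_on (pi2 K) c" "f = lift_aff b c"
      by (rule caff_coefficients[OF f])
    show ?thesis unfolding bc(3) lift_aff_scale
      using bc by (intro lift_aff_caff continuous_intros)
  qed
  ultimately show ?thesis by (simp add: subspace_def)
qed

lemma caff_bounded:
  assumes "f \<in> caff_set K"
  shows "\<exists>r>0. \<forall>p\<in>K. \<bar>f p\<bar> \<le> r"
proof -
  have "bounded (f ` K)"
    using assms cpt by (auto simp: caff_set_def intro!: compact_imp_bounded
      compact_continuous_image)
  then obtain r where "\<forall>p\<in>K. \<bar>f p\<bar> \<le> r" by (auto simp: bounded_iff)
  then show ?thesis by (intro exI[of _ "\<bar>r\<bar> + 1"]) force
qed

lemma unit_caff: "(\<lambda>p. if p \<in> K then 1 else 0) \<in> caff_set K"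
  unfolding lift_aff_const by (intro lift_aff_caff continuous_intros)

lemma aou_C_aff: "aou_space (C_aff K)"
proof -
  note S = subspace_caff
  have le: "ou_le (C_aff K) f h \<longleftrightarrow> (\<forall>p\<in>K. f p \<le> h p)" if "f \<in> caff_set K" "h \<in> caff_set K" for f h
    using subspace_diff[OF S that(2,1)] by (auto simp: ou_le_def)
  have "convex_cone {f \<in> caff_set K. \<forall>p\<in>K. 0 \<le> f p}"
    unfolding convex_cone_iff
    using S by (auto simp: subspace_0 intro!: subspace_add subspace_scale)
  moreover have "{f \<in> caff_set K. \<forall>p\<in>K. 0 \<le> f p} \<inter> uminus ` {f \<in> caff_set K. \<forall>p\<in>K. 0 \<le> f p} = {0}"
  proof (intro equalityI subsetI)
    fix f assume "f \<in> {f \<in> caff_set K. \<forall>p\<in>K. 0 \<le> f p} \<inter> uminus ` {f \<in> caff_set K. \<forall>p\<in>K. 0 \<le> f p}"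
    then obtain h where fh: "f \<in> caff_set K" "\<forall>p\<in>K. 0 \<le> f p" "f = - h" "\<forall>p\<in>K. 0 \<le> h p" by auto
    have "f p = 0" for p
    proof (cases "p \<in> K")
      case True
      then have "0 \<le> f p" "0 \<le> h p" "f p = - h p" using fh by simp_all
      then show ?thesis by linarith
    next
      case False
      then show ?thesis using fh(1) by (cases p) (auto simp: caff_set_def)
    qed
    then show "f \<in> {0}" by auto
  next
    fix f :: "(real^'n) \<times> (real^'m) \<Rightarrow> real" assume "f \<in> {0}"
    then show "f \<in> {f \<in> caff_set K. \<forall>p\<in>K. 0 \<le> f p} \<inter> uminus ` {f \<in> caff_set K. \<forall>p\<in>K. 0 \<le> f p}"
      using subspace_0[OF S] by (auto intro!: image_eqI[of _ _ 0])
  qed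
  moreover have "\<exists>r>0. ou_le (C_aff K) (- (r *\<^sub>R ounit (C_aff K))) f
    \<and> ou_le (C_aff K) f (r *\<^sub>R ounit (C_aff K))"
    if f: "f \<in> caff_set K" for f
  proof -
    obtain r where r: "r > 0" "\<forall>p\<in>K. \<bar>f p\<bar> \<le> r" using caff_bounded[OF f] by blast
    have u: "r *\<^sub>R ounit (C_aff K) \<in> caff_set K" "- (r *\<^sub>R ounit (C_aff K)) \<in> caff_set K"
      using unit_caff S by (auto intro!: subspace_neg subspace_scale)
    show ?thesis
      using r le[OF u(2) f] le[OF f u(1)]
        by (intro exI[of _ r]) (auto simp: abs_le_iff minus_le_iff)
  qed
  moreover have "f \<in> pos (C_aff K)" if "f \<in> caff_set K"
    "\<forall>r>0. f + r *\<^sub>R ounit (C_aff K) \<in> pos (C_aff K)" for f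
  proof -
    have "0 \<le> f p" if p: "p \<in> K" for p
    proof (rule field_le_epsilon)
      fix r :: real assume "r > 0"
      then show "0 \<le> f p + r" using \<open>\<forall>r>0. _\<close> p by auto
    qed
    with that show ?thesis by simp
  qed
  ultimately show ?thesis
    unfolding aou_space_def using S unit_caff by simp
qed

lemma kadison_C_aff: "kadison_embedded (C_aff K)"
proof -
  have "compact (reps (C_aff K))"
    unfolding C_aff_simps
  proof (rule compact_continuous_image[OF _ cpt], rule continuous_on_coordinatewise_then_product)
    fix f show "continuous_on K (\<lambda>p. (\<lambda>f\<in>caff_set K. f p) f)"
    proof (cases "f \<in> caff_set K")
      case True
      then have "continuous_on K f" by (simp add: caff_set_def)
      with True show ?thesis by simp
    qed simp
  qed
  moreover have "reps (C_aff K) \<subseteq> states (C_aff K)"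
    using subspace_caff unit_caff
    by (auto simp: states_def linear_on_def subspace_add subspace_scale)
  ultimately show ?thesis by (auto simp: kadison_embedded_def)
qed

sublocale kadison_space "C_aff K"
  by (intro kadison_space.intro aou_C_aff kadison_C_aff)

lemma C_aff_norm_le_iff:
  "f \<in> caff_set K \<Longrightarrow> 0 \<le> r \<Longrightarrow> ou_norm (C_aff K) f \<le> r \<longleftrightarrow> (\<forall>p\<in>K. \<bar>f p\<bar> \<le> r)"
  using ou_norm_le_iff[of f r] by simp

lemma C_aff_value_le_norm: "f \<in> caff_set K \<Longrightarrow> p \<in> K \<Longrightarrow> \<bar>f p\<bar> \<le> ou_norm (C_aff K) f"
  using C_aff_norm_le_iff[of f "ou_norm (C_aff K) f"] by simp

lemma C_aff_omult_eqI:
  "f \<in> caff_set K \<Longrightarrow> h \<in> caff_set K \<Longrightarrow> z \<in> caff_set K \<Longrightarrow> (\<And>p. p \<in> K \<Longrightarrow> h p = z p * f p) \<Longrightarrow>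
   omult (C_aff K) z f = h"
  by (rule omult_eqI) auto

subsection \<open>The multiplicative domain consists of the functions of the second variable\<close>

definition lift_base :: "(real^'m \<Rightarrow> real) \<Rightarrow> (real^'n) \<times> (real^'m) \<Rightarrow> real" where
  "lift_base c = lift_aff c (\<lambda>_. 0)"

lemma lift_base_in [simp]: "p \<in> K \<Longrightarrow> lift_base c p = c (snd p)"
  by (simp add: lift_base_def)

lemma lift_base_caff: "continuous_on (pi2 K) c \<Longrightarrow> lift_base c \<in> caff_set K"
  unfolding lift_base_def by (intro lift_aff_caff continuous_intros)

lemma lift_base_unit: "ounit (C_aff K) = lift_base (\<lambda>_. 1)"
  by (simp add: lift_base_def lift_aff_const)

lemma lift_base_cong: "(\<And>y. y \<in> pi2 K \<Longrightarrow> b y = c y) \<Longrightarrow> lift_base b = lift_base c"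
  unfolding lift_base_def by (rule lift_aff_cong) simp

lemma lift_base_add: "lift_base b + lift_base c = lift_base (\<lambda>y. b y + c y)"
  by (simp add: lift_base_def lift_aff_add)

lemma lift_base_scale: "r *\<^sub>R lift_base c = lift_base (\<lambda>y. r * c y)"
  by (simp add: lift_base_def lift_aff_scale)

lemma omult_lift:
  assumes "continuous_on (pi2 K) c" "continuous_on (pi2 K) b" "continuous_on (pi2 K) d"
  shows "omult (C_aff K) (lift_base c) (lift_aff b d) = lift_aff (\<lambda>y. c y * b y) (\<lambda>y. c y *\<^sub>R d y)"
proof (rule C_aff_omult_eqI)
  show "lift_aff (\<lambda>y. c y * b y) (\<lambda>y. c y *\<^sub>R d y) \<in> caff_set K"
    using assms by (intro lift_aff_caff continuous_intros)
qed (use assms in \<open>auto simp: algebra_simps intro!: lift_aff_caff lift_base_caff\<close>)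

lemma omult_lift_base:
  assumes "continuous_on (pi2 K) c" "continuous_on (pi2 K) b"
  shows "omult (C_aff K) (lift_base c) (lift_base b) = lift_base (\<lambda>y. c y * b y)"
  using omult_lift[OF assms, of "\<lambda>_. 0"] by (simp add: lift_base_def)

lemma lift_base_mdom:
  assumes "continuous_on (pi2 K) c"
  shows "lift_base c \<in> mdom (C_aff K)"
proof (rule mdomI)
  fix a assume "a \<in> vcarrier (C_aff K)"
  then obtain b d where bd: "continuous_on (pi2 K) b" "continuous_on (pi2 K) d" "a = lift_aff b d"
    using caff_coefficients by (metis C_aff_simps(1))
  let ?h = "lift_aff (\<lambda>y. c y * b y) (\<lambda>y. c y *\<^sub>R d y)"
  have h: "?h \<in> caff_set K" using bd assms by (intro lift_aff_caff continuous_intros)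
  show "\<exists>h\<in>vcarrier (C_aff K). \<forall>\<phi>\<in>reps (C_aff K). \<phi> h = \<phi> (lift_base c) * \<phi> a"
    using h lift_base_caff[OF assms] lift_aff_caff[OF bd(1,2)]
    by (intro bexI[of _ ?h]) (auto simp: bd(3) algebra_simps)
qed (simp add: lift_base_caff assms)

text \<open>Both \<open>z\<close> and \<open>z\<^sup>2\<close> are affine on the fibres, and the square of a nonconstant affine
  function is not affine.\<close>

lemma mdom_lift_base:
  assumes "z \<in> mdom (C_aff K)"
  obtains c where "continuous_on (pi2 K) c" "z = lift_base c"
proof -
  have zc: "z \<in> caff_set K" using mdom_carrier[OF assms] by simp
  obtain b d where bd: "continuous_on (pi2 K) b" "continuous_on (pi2 K) d" "z = lift_aff b d"
    by (rule caff_coefficients[OF zc])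
  define w where "w = omult (C_aff K) z z"
  have wc: "w \<in> caff_set K" using omult(1)[OF assms, of z] zc by (simp add: w_def)
  have w: "w p = z p * z p" if "p \<in> K" for p
    using omult(2)[OF assms, of z "\<lambda>f\<in>caff_set K. f p"] zc wc that by (simp add: w_def)
  have "d y = 0" if y: "y \<in> pi2 K" for y
  proof -
    obtain x0 r where x0: "r > 0" "cball x0 r \<subseteq> fib K y"
      using interior_fib[OF y] by (meson all_not_in_conv mem_interior_cball)
    \<comment> \<open>A multiple of \<open>d y\<close> of norm at most \<open>r\<close>; if \<open>z\<close> takes equal values at \<open>x0 + v\<close> and \<open>x0 -
    v\<close>, then \<open>d y = 0\<close>.\<close>
    define v where "v = (r / (1 + norm (d y))) *\<^sub>R d y"
    have pos: "1 + norm (d y) > 0" by (simp add: add_pos_nonneg)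
    have "norm v \<le> r"
      using x0(1) pos by (simp add: v_def field_simps)
    then have K3: "x0 + v \<in> fib K y" "x0 - v \<in> fib K y"
      using x0(2) by (auto simp: dist_norm subset_iff simp del: mem_fib)
    have mid: "(1 - 1/2) *\<^sub>R (x0 + v) + (1/2) *\<^sub>R (x0 - v) = x0"
    proof -
      have "(1/2) *\<^sub>R x0 + (1/2) *\<^sub>R x0 = x0" by (simp flip: scaleR_left_distrib)
      then show ?thesis by (simp add: algebra_simps)
    qed
    have aff: "affine_on (fib K y) (\<lambda>x. w (x, y))" using wc y by (simp add: caff_set_def)
    have x0K: "(x0, y) \<in> K" using subsetD[OF x0(2), of x0] x0(1) by simp
    have "w (x0, y) = (w (x0 + v, y) + w (x0 - v, y)) / 2"
      using affine_onD[OF aff K3, of "1/2"] unfolding mid by simp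
    then have "2 * (z (x0, y) * z (x0, y))
      = z (x0 + v, y) * z (x0 + v, y) + z (x0 - v, y) * z (x0 - v, y)"
      using K3 x0K by (simp add: w)
    moreover have "z (x0, y) = b y + d y \<bullet> x0" "z (x0 + v, y) = (b y + d y \<bullet> x0) + d y \<bullet> v"
      "z (x0 - v, y) = (b y + d y \<bullet> x0) - d y \<bullet> v"
      using K3 x0K by (simp_all add: bd(3) inner_add_right inner_diff_right)
    ultimately have "(d y \<bullet> v) * (d y \<bullet> v) = 0" by (simp add: algebra_simps)
    then have "(r / (1 + norm (d y))) * (d y \<bullet> d y) = 0" by (simp add: v_def)
    then show ?thesis using x0(1) pos by simp
  qed
  then have "z = lift_base b"
    unfolding bd(3) lift_base_def by (intro lift_aff_cong) auto
  with bd(1) show thesis using that by blast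
qed

subsection \<open>Completeness and the Gelfand representation\<close>

text \<open>Completeness: a uniform limit of continuous functions of \<open>y\<close> is a continuous function of
  \<open>y\<close>.\<close>

lemma cstar_C_aff:
  "real_comm_cstar_algebra (mdom (C_aff K)) (omult (C_aff K)) (ounit (C_aff K)) (ou_norm (C_aff K))"
proof (rule real_comm_cstar_algebra_mdomI)
  let ?d = "\<lambda>a b. ou_norm (C_aff K) (a - b)"
  show "Metric_space.mcomplete (mdom (C_aff K)) ?d"
    unfolding Metric_space.mcomplete_def[OF metric_mdom] Metric_space.MCauchy_def[OF metric_mdom]
  proof (intro allI impI, elim conjE)
    fix \<sigma> :: "nat \<Rightarrow> (real^'n) \<times> (real^'m) \<Rightarrow> real"
    assume \<sigma>: "range \<sigma> \<subseteq> mdom (C_aff K)"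
      and cauchy: "\<forall>\<epsilon>>0. \<exists>N. \<forall>n n'. N \<le> n \<longrightarrow> N \<le> n' \<longrightarrow> ?d (\<sigma> n) (\<sigma> n') < \<epsilon>"
    have "\<forall>k. \<exists>c. continuous_on (pi2 K) c \<and> \<sigma> k = lift_base c"
      using \<sigma> mdom_lift_base by (metis rangeI subsetD)
    then obtain c where c: "\<And>k. continuous_on (pi2 K) (c k)" "\<And>k. \<sigma> k = lift_base (c k)"
      by metis
    have bound: "\<bar>c k y - c l y\<bar> \<le> ?d (\<sigma> k) (\<sigma> l)" if "y \<in> pi2 K" for k l y
    proof -
      obtain x where x: "(x, y) \<in> K" using \<open>y \<in> pi2 K\<close> by (auto simp: pi2_def)
      have "\<sigma> k - \<sigma> l \<in> caff_set K"
        using mdom_diff[of "\<sigma> k" "\<sigma> l"] mdom_carrier \<sigma> by fastforce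
      from C_aff_value_le_norm[OF this x] show ?thesis using x by (simp add: c(2))
    qed
    have "uniformly_Cauchy_on (pi2 K) c"
      unfolding uniformly_Cauchy_on_def
    proof (intro allI impI)
      fix \<epsilon> :: real assume "\<epsilon> > 0"
      then obtain N where "\<And>n n'. N \<le> n \<Longrightarrow> N \<le> n' \<Longrightarrow> ?d (\<sigma> n) (\<sigma> n') < \<epsilon>" using cauchy by meson
      then show "\<exists>M. \<forall>x\<in>pi2 K. \<forall>m\<ge>M. \<forall>n\<ge>M. dist (c m x) (c n x) < \<epsilon>"
        unfolding dist_real_def using le_less_trans[OF bound] by meson
    qed
    then obtain l where l: "uniform_limit (pi2 K) c l sequentially"
      using Cauchy_uniformly_convergent uniformly_convergent_on_def by blast
    have lc: "continuous_on (pi2 K) l"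
      by (rule uniform_limit_theorem[OF _ l]) (auto simp: c(1))
    have "\<exists>N. \<forall>n\<ge>N. \<sigma> n \<in> mdom (C_aff K) \<and> ?d (\<sigma> n) (lift_base l) < \<epsilon>" if "\<epsilon> > 0" for \<epsilon>
    proof -
      obtain N where N: "\<And>n y. n \<ge> N \<Longrightarrow> y \<in> pi2 K \<Longrightarrow> dist (c n y) (l y) < \<epsilon> / 2"
        using l \<open>\<epsilon> > 0\<close> unfolding uniform_limit_sequentially_iff by (meson half_gt_zero)
      have "?d (\<sigma> n) (lift_base l) \<le> \<epsilon> / 2" if "n \<ge> N" for n
      proof (subst C_aff_norm_le_iff)
        show "\<sigma> n - lift_base l \<in> caff_set K"
          unfolding c(2) using c(1) lc by (intro subspace_diff[OF subspace_caff] lift_base_caff)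
        show "\<forall>p\<in>K. \<bar>(\<sigma> n - lift_base l) p\<bar> \<le> \<epsilon> / 2"
          using N[OF that snd_pi2] by (auto simp: c(2) dist_real_def intro: less_imp_le)
      qed (use \<open>\<epsilon> > 0\<close> in auto)
      then show ?thesis using \<open>\<epsilon> > 0\<close> \<sigma> by (intro exI[of _ N]) force
    qed
    then show "\<exists>l. limitin (Metric_space.mtopology (mdom (C_aff K)) ?d) \<sigma> l sequentially"
      unfolding Metric_space.limit_metric_sequentially[OF metric_mdom]
      using lift_base_mdom[OF lc] by blast
  qed
next
  fix a assume "a \<in> mdom (C_aff K)"
  then obtain c where c: "continuous_on (pi2 K) c" "a = lift_base c" by (rule mdom_lift_base)
  have nz: "1 + c y * c y \<noteq> 0" for y
    using zero_le_square[of "c y"] by (metis add.commute add_le_same_cancel1 not_one_le_zero)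
  have "continuous_on (pi2 K) (\<lambda>y. 1 + c y * c y)"
    "continuous_on (pi2 K) (\<lambda>y. inverse (1 + c y * c y))"
    using c(1) nz by (intro continuous_intros; simp)+
  then have "omult (C_aff K) (ounit (C_aff K) + omult (C_aff K) a a) (lift_base (\<lambda>y. inverse (1 + c y * c y))) =
      ounit (C_aff K)" "lift_base (\<lambda>y. inverse (1 + c y * c y)) \<in> mdom (C_aff K)"
    unfolding c(2) omult_lift_base[OF c(1) c(1)] lift_base_unit lift_base_add
    by (simp_all add: omult_lift_base nz lift_base_mdom)
  then show "\<exists>b\<in>mdom (C_aff K). omult (C_aff K) (ounit (C_aff K) + omult (C_aff K) a a) b
    = ounit (C_aff K)"
    by blast
qed

definition base_gens :: "'m \<Rightarrow> (real^'n) \<times> (real^'m) \<Rightarrow> real" where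
  "base_gens i = lift_base (\<lambda>y. y $ i)"

lemma base_gens_mdom: "base_gens i \<in> mdom (C_aff K)"
  unfolding base_gens_def by (intro lift_base_mdom continuous_intros)

text \<open>The value does not depend on the point chosen in the fibre, because elements of the
  multiplicative domain are constant there.\<close>

definition eval_base :: "real^'m \<Rightarrow> ((real^'n) \<times> (real^'m) \<Rightarrow> real) \<Rightarrow> real" where
  "eval_base y = (\<lambda>z\<in>mdom (C_aff K). z (SOME x. (x, y) \<in> K, y))"

lemma eval_base_lift [simp]:
  assumes "y \<in> pi2 K" "continuous_on (pi2 K) c"
  shows "eval_base y (lift_base c) = c y"
proof -
  have "(SOME x. (x, y) \<in> K, y) \<in> K" using assms(1) by (auto simp: pi2_def intro: someI_ex)
  then show ?thesis using lift_base_mdom[OF assms(2)] by (simp add: eval_base_def)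
qed

lemma continuous_eval_base: "continuous_on (pi2 K) (\<lambda>y. eval_base y z)"
proof (cases "z \<in> mdom (C_aff K)")
  case True
  then obtain c where c: "continuous_on (pi2 K) c" "z = lift_base c" by (rule mdom_lift_base)
  then show ?thesis by (auto intro: continuous_on_eq[OF c(1)])
qed (simp add: eval_base_def)

lemma eval_base_character:
  assumes y: "y \<in> pi2 K"
  shows "eval_base y \<in> characters (C_aff K)"
proof -
  have add: "eval_base y (z + w) = eval_base y z + eval_base y w"
    and mult: "eval_base y (omult (C_aff K) z w) = eval_base y z * eval_base y w"
    and scale: "eval_base y (r *\<^sub>R z) = r * eval_base y z"
    if zw: "z \<in> mdom (C_aff K)" "w \<in> mdom (C_aff K)" for z w r
  proof -
    obtain c where c: "continuous_on (pi2 K) c" "z = lift_base c" by (rule mdom_lift_base[OF zw(1)])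
    obtain d where d: "continuous_on (pi2 K) d" "w = lift_base d" by (rule mdom_lift_base[OF zw(2)])
    have "continuous_on (pi2 K) (\<lambda>y. c y + d y)" "continuous_on (pi2 K) (\<lambda>y. c y * d y)"
      "continuous_on (pi2 K) (\<lambda>y. r * c y)"
      using c d by (intro continuous_intros; simp)+
    then show "eval_base y (z + w) = eval_base y z + eval_base y w"
      "eval_base y (omult (C_aff K) z w) = eval_base y z * eval_base y w"
      "eval_base y (r *\<^sub>R z) = r * eval_base y z"
      using y c d by (simp_all add: lift_base_add lift_base_scale omult_lift_base)
  qed
  have "eval_base y (ounit (C_aff K)) = 1" unfolding lift_base_unit using y by simp
  moreover have "eval_base y \<in> extensional (mdom (C_aff K))" unfolding eval_base_def by simp
  ultimately show ?thesis
    using add mult scale by (simp add: characters_def linear_on_def)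
qed

text \<open>If \<open>\<xi>\<close> is a character and \<open>z = c(y)\<close>, then \<open>\<xi>\<close> annihilates
  \<open>\<Sum>\<^sub>i (y\<^sub>i - \<xi>(g\<^sub>i))\<^sup>2 + (c(y) - \<xi>(z))\<^sup>2\<close>. An invertible element is not annihilated, so this
  function has a zero, at which \<open>y = (\<xi>(g\<^sub>i))\<^sub>i\<close> and \<open>c(y) = \<xi>(z)\<close>.\<close>

lemma character_is_eval:
  assumes \<xi>: "\<xi> \<in> characters (C_aff K)"
  shows "joint_values base_gens \<xi> \<in> pi2 K \<and> \<xi> = eval_base (joint_values base_gens \<xi>)"
proof -
  let ?y = "joint_values base_gens \<xi>"
  define X where "X c = \<xi> (lift_base c)" for c
  have add: "X (\<lambda>y. c y + d y) = X c + X d" and mult: "X (\<lambda>y. c y * d y) = X c * X d"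
    if "continuous_on (pi2 K) c" "continuous_on (pi2 K) d" for c d
    using charactersD[OF \<xi> lift_base_mdom lift_base_mdom, OF that] that
    by (simp_all add: X_def lift_base_add omult_lift_base)
  have const: "X (\<lambda>_. r) = r" for r
  proof -
    have "X (\<lambda>_. r) = r * X (\<lambda>_. 1)"
      using charactersD(2)[OF \<xi> lift_base_mdom[of "\<lambda>_. 1"] mdom_zero, of r]
      by (simp add: X_def lift_base_scale)
    then show ?thesis using charactersD(5)[OF \<xi> mdom_zero mdom_zero]
      by (simp add: X_def flip: lift_base_unit)
  qed
  have sq: "X (\<lambda>y. (c y - X c) * (c y - X c)) = 0" if "continuous_on (pi2 K) c" for c
  proof -
    have "X (\<lambda>y. c y + (- X c)) = 0" using add[OF that, of "\<lambda>_. - X c"] const by simp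
    then have "X (\<lambda>y. c y - X c) = 0" by simp
    then show ?thesis using mult[of "\<lambda>y. c y - X c" "\<lambda>y. c y - X c"] that
      by (simp add: continuous_on_diff)
  qed
  have comp: "?y $ i = X (\<lambda>y. y $ i)" for i by (simp add: joint_values_def base_gens_def X_def)
  have zero: "\<exists>y\<in>pi2 K. y = ?y \<and> c y = X c" if c: "continuous_on (pi2 K) c" for c
  proof -
    define s where "s I y = (\<Sum>i\<in>I. (y $ i - ?y $ i) * (y $ i - ?y $ i))" for I and y :: "real^'m"
    have sc: "continuous_on (pi2 K) (s I)" for I
      unfolding s_def by (intro continuous_intros)
    have "X (s I) = 0" for I
    proof (induction I rule: infinite_finite_induct)
      case (insert i I)
      have ci: "continuous_on (pi2 K) (\<lambda>y. y $ i)" by (intro continuous_intros)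
      have "X (s (insert i I)) = X (\<lambda>y. (y $ i - ?y $ i) * (y $ i - ?y $ i) + s I y)"
        using insert(1,2) by (simp add: s_def[abs_def])
      also have "\<dots> = 0"
        using insert(3) sq[OF ci] sc[of I] ci
        by (subst add) (auto intro!: continuous_intros simp: comp)
      finally show ?case .
    qed (use const in \<open>simp_all add: s_def[abs_def]\<close>)
    define H where "H y = s UNIV y + (c y - X c) * (c y - X c)" for y
    have Hc: "continuous_on (pi2 K) H"
      unfolding H_def by (intro continuous_intros sc c)
    have XH: "X H = 0"
      unfolding H_def[abs_def] using \<open>X (s UNIV) = 0\<close> sq[OF c] c sc
      by (subst add) (auto intro!: continuous_intros)
    have "\<exists>y\<in>pi2 K. H y = 0"
    proof (rule ccontr)
      assume nz: "\<not> (\<exists>y\<in>pi2 K. H y = 0)"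
      then have "X (\<lambda>y. H y * inverse (H y)) = X H * X (\<lambda>y. inverse (H y))"
        using Hc by (intro mult continuous_intros) auto
      moreover have "lift_base (\<lambda>y. H y * inverse (H y)) = lift_base (\<lambda>_. 1)"
        using nz by (intro lift_base_cong) auto
      then have "X (\<lambda>y. H y * inverse (H y)) = 1" using const[of 1] by (simp add: X_def)
      ultimately show False using XH by simp
    qed
    then obtain y where y: "y \<in> pi2 K" "H y = 0" by blast
    have "s UNIV y \<ge> 0" unfolding s_def by (intro sum_nonneg) auto
    then have "s UNIV y = 0" "(c y - X c) * (c y - X c) = 0"
      using y(2) zero_le_square[of "c y - X c"] unfolding H_def by linarith+
    then have "\<forall>i\<in>UNIV. (y $ i - ?y $ i) * (y $ i - ?y $ i) = 0"
      unfolding s_def by (subst (asm) sum_nonneg_eq_0_iff) auto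
    with y(1) \<open>(c y - X c) * (c y - X c) = 0\<close> show ?thesis
      by (intro bexI[of _ y]) (auto simp: vec_eq_iff)
  qed
  have yK: "?y \<in> pi2 K" using zero[of "\<lambda>_. 0"] by auto
  have "\<xi> z = eval_base ?y z" for z
  proof (cases "z \<in> mdom (C_aff K)")
    case True
    then obtain c where c: "continuous_on (pi2 K) c" "z = lift_base c" by (rule mdom_lift_base)
    then show ?thesis using zero[OF c(1)] yK by (auto simp: X_def)
  next
    case False
    then show ?thesis using \<xi> by (simp add: characters_def extensional_def eval_base_def)
  qed
  with yK show ?thesis by blast
qed

lemma joint_values_eval_base: "y \<in> pi2 K \<Longrightarrow> joint_values base_gens (eval_base y) = y"
  by (simp add: joint_values_def base_gens_def vec_eq_iff continuous_on_component)

lemma characters_C_aff: "characters (C_aff K) = eval_base ` pi2 K"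
  using character_is_eval eval_base_character by blast

lemma spectrum_C_aff: "spectrum_set (C_aff K) base_gens = pi2 K"
  unfolding spectrum_set_def characters_C_aff image_image by (simp add: joint_values_eval_base)

lemma mval_C_aff: "y \<in> pi2 K \<Longrightarrow> mval (C_aff K) base_gens z y = eval_base y z"
proof -
  assume y: "y \<in> pi2 K"
  have "(THE \<xi>. \<xi> \<in> characters (C_aff K) \<and> joint_values base_gens \<xi> = y) = eval_base y"
    using y eval_base_character joint_values_eval_base character_is_eval
      by (intro the_equality) auto
  then show ?thesis by (simp add: mval_def)
qed

text \<open>The coordinates separate the points of the base, so the Stone-Weierstrass theorem applies
  to the functions of \<open>y\<close> that belong to a given closed subalgebra.\<close>

lemma generators_C_aff: "cstar_generators (C_aff K) base_gens"
  unfolding cstar_generators_def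
proof (intro conjI allI impI)
  show "range base_gens \<subseteq> mdom (C_aff K)" using base_gens_mdom by blast
  fix S assume "subspace S \<and> S \<subseteq> mdom (C_aff K) \<and> ounit (C_aff K) \<in> S \<and>
    (\<forall>a\<in>S. \<forall>b\<in>S. omult (C_aff K) a b \<in> S) \<and>
    closedin (subtopology (ou_topology (C_aff K)) (mdom (C_aff K))) S \<and> range base_gens \<subseteq> S"
  then have S: "subspace S" "S \<subseteq> mdom (C_aff K)" "ounit (C_aff K) \<in> S"
    "\<forall>a\<in>S. \<forall>b\<in>S. omult (C_aff K) a b \<in> S"
    "closedin (subtopology (ou_topology (C_aff K)) (mdom (C_aff K))) S" "range base_gens \<subseteq> S"
    by blast+
  define R where "R = {h. continuous_on (pi2 K) h \<and> lift_base h \<in> S}"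
  interpret R: function_ring_on R "pi2 K"
  proof
    show "compact (pi2 K)" by (rule compact_base)
    show "continuous_on (pi2 K) f" if "f \<in> R" for f using that by (simp add: R_def)
    show "(\<lambda>x. f x + h x) \<in> R" if "f \<in> R" "h \<in> R" for f h
      using that subspace_add[OF S(1), of "lift_base f" "lift_base h"]
      by (auto simp: R_def lift_base_add intro: continuous_intros)
    show "(\<lambda>x. f x * h x) \<in> R" if "f \<in> R" "h \<in> R" for f h
    proof -
      have fh: "continuous_on (pi2 K) f" "continuous_on (pi2 K) h" "lift_base f \<in> S"
        "lift_base h \<in> S"
        using that by (auto simp: R_def)
      then have "omult (C_aff K) (lift_base f) (lift_base h) \<in> S" using S(4) by blast
      with fh show ?thesis by (simp add: R_def omult_lift_base continuous_on_mult)
    qed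
    show "(\<lambda>_. r) \<in> R" for r
      using subspace_scale[OF S(1) S(3), of r] unfolding lift_base_unit lift_base_scale
        by (simp add: R_def)
    show "\<exists>f\<in>R. f x \<noteq> f y" if xy: "x \<noteq> y" for x y
    proof -
      obtain i where "x $ i \<noteq> y $ i" using xy by (auto simp: vec_eq_iff)
      moreover have "(\<lambda>y. y $ i) \<in> R"
        using S(6) by (auto simp: R_def base_gens_def intro: continuous_intros)
      ultimately show ?thesis by (intro bexI[of _ "\<lambda>y. y $ i"])
    qed
  qed
  have "z \<in> S" if z: "z \<in> mdom (C_aff K)" for z
  proof -
    obtain c where c: "continuous_on (pi2 K) c" "z = lift_base c" by (rule mdom_lift_base[OF z])
    have "\<exists>b\<in>S. ou_norm (C_aff K) (z - b) < \<epsilon>" if "\<epsilon> > 0" for \<epsilon>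
    proof -
      obtain h where h: "h \<in> R" "\<forall>y\<in>pi2 K. \<bar>c y - h y\<bar> < \<epsilon> / 2"
        using R.Stone_Weierstrass_basic[OF c(1), of "\<epsilon> / 2"] \<open>\<epsilon> > 0\<close> by auto
      have "ou_norm (C_aff K) (z - lift_base h) \<le> \<epsilon> / 2"
      proof (subst C_aff_norm_le_iff)
        show "z - lift_base h \<in> caff_set K"
          unfolding c(2) using c(1) h(1) by (intro subspace_diff[OF subspace_caff] lift_base_caff)
            (auto simp: R_def)
        show "\<forall>p\<in>K. \<bar>(z - lift_base h) p\<bar> \<le> \<epsilon> / 2"
          using h(2) snd_pi2 by (force simp: c(2))
      qed (use \<open>\<epsilon> > 0\<close> in auto)
      with h(1) \<open>\<epsilon> > 0\<close> show ?thesis by (intro bexI[of _ "lift_base h"]) (auto simp: R_def)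
    qed
    then show "z \<in> S"
      using S(5) z unfolding closedin_mdom_iff[OF S(2)] by blast
  qed
  with S(2) show "S = mdom (C_aff K)" by blast
qed

lemma gelfand_C_aff: "gelfand_identification (C_aff K) base_gens"
proof -
  have "homeomorphism (characters (C_aff K)) (pi2 K) (joint_values base_gens) eval_base"
  proof
    show "continuous_on (characters (C_aff K)) (joint_values base_gens)"
      by (rule continuous_on_joint_values)
    show "continuous_on (pi2 K) eval_base"
      by (rule continuous_on_coordinatewise_then_product) (rule continuous_eval_base)
  qed (use character_is_eval eval_base_character joint_values_eval_base in auto)
  moreover have "continuous_on (pi2 K) (mval (C_aff K) base_gens z)" for z
    by (rule continuous_on_eq[OF continuous_eval_base[of z]]) (simp add: mval_C_aff)
  moreover have "ou_norm (C_aff K) z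
    = Sup (insert 0 ((\<lambda>y. \<bar>mval (C_aff K) base_gens z y\<bar>) ` pi2 K))"
    if z: "z \<in> mdom (C_aff K)" for z
  proof -
    obtain c where c: "continuous_on (pi2 K) c" "z = lift_base c" by (rule mdom_lift_base[OF z])
    let ?S = "insert 0 ((\<lambda>y. \<bar>c y\<bar>) ` pi2 K)"
    have eq: "(\<lambda>y. \<bar>mval (C_aff K) base_gens z y\<bar>) ` pi2 K = (\<lambda>y. \<bar>c y\<bar>) ` pi2 K"
      using c by (intro image_cong) (auto simp: mval_C_aff)
    have zc: "z \<in> caff_set K" using z mdom_carrier by fastforce
    have le: "\<bar>c y\<bar> \<le> ou_norm (C_aff K) z" if y: "y \<in> pi2 K" for y
    proof -
      obtain x where "(x, y) \<in> K" using y by (auto simp: pi2_def)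
      then show ?thesis using C_aff_value_le_norm[OF zc, of "(x, y)"] by (simp add: c(2))
    qed
    then have bdd: "bdd_above ?S" by (auto intro!: bdd_aboveI[of _ "ou_norm (C_aff K) z"])
    have "ou_norm (C_aff K) z \<le> Sup ?S"
    proof (subst C_aff_norm_le_iff[OF zc])
      show "0 \<le> Sup ?S" using bdd by (auto intro: cSup_upper)
      show "\<forall>p\<in>K. \<bar>z p\<bar> \<le> Sup ?S"
        using bdd by (auto simp: c(2) intro!: cSup_upper intro: pi2I)
    qed
    moreover have "Sup ?S \<le> ou_norm (C_aff K) z"
      using le by (intro cSup_least) auto
    ultimately show ?thesis unfolding eq by simp
  qed
  moreover have "\<exists>z\<in>mdom (C_aff K). \<forall>y\<in>pi2 K. mval (C_aff K) base_gens z y = f y"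
    if "continuous_on (pi2 K) f" for f
    using that lift_base_mdom[OF that] by (intro bexI[of _ "lift_base f"]) (simp_all add:
      mval_C_aff)
  ultimately show ?thesis
    unfolding gelfand_identification_def Let_def spectrum_C_aff using compact_base by blast
qed

end

section \<open>Continuous partially affine functions form a free order unit module\<close>

context compact_regular
begin

sublocale base: gelfand_space "C_aff K" base_gens
  using base_gens_mdom gelfand_C_aff by unfold_locales auto

definition coord_basis :: "'n option \<Rightarrow> (real^'n) \<times> (real^'m) \<Rightarrow> real" where
  "coord_basis i = (case i of None \<Rightarrow> lift_base (\<lambda>_. 1) | Some i \<Rightarrow> lift_aff (\<lambda>_. 0) (\<lambda>_. axis i 1))"

lemma coord_basis_caff: "coord_basis i \<in> caff_set K"
  by (auto simp: coord_basis_def split: option.split intro!: lift_aff_caff lift_base_caff)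

lemma coord_basis_unit: "coord_basis None = ounit (C_aff K)"
  by (simp only: lift_base_unit coord_basis_def option.case)

lemma coord_basis_sum:
  assumes "\<And>i. continuous_on (pi2 K) (c i)"
  shows "(\<Sum>i\<in>UNIV. omult (C_aff K) (lift_base (c i)) (coord_basis i)) =
    lift_aff (c None) (\<lambda>y. \<chi> i. c (Some i) y)"
proof -
  have None: "omult (C_aff K) (lift_base (c None)) (coord_basis None) = lift_aff (c None) (\<lambda>_. 0)"
    using omult_lift_base[OF assms, of "\<lambda>_. 1"]
      by (simp add: coord_basis_def) (simp add: lift_base_def)
  have Some: "omult (C_aff K) (lift_base (c (Some i))) (coord_basis (Some i)) =
      lift_aff (\<lambda>_. 0) (\<lambda>y. c (Some i) y *\<^sub>R axis i 1)" for i
    using omult_lift[OF assms, of "\<lambda>_. 0" "\<lambda>_. axis i 1"] by (simp add: coord_basis_def)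
  have sum: "(\<Sum>i\<in>I. lift_aff (\<lambda>_. 0) (\<lambda>y. c (Some i) y *\<^sub>R axis i 1)) =
      lift_aff (\<lambda>_. 0) (\<lambda>y. \<Sum>i\<in>I. c (Some i) y *\<^sub>R axis i 1)" if "finite I" for I
    using that
  proof (induction I rule: finite_induct)
    case empty
    show ?case by (auto simp: lift_aff_def fun_eq_iff)
  qed (simp add: lift_aff_add)
  have "(\<Sum>i\<in>UNIV. c (Some i) y *\<^sub>R axis i 1) = (\<chi> i. c (Some i) y)" for y
    by (simp add: vec_eq_iff axis_def if_distrib cong: if_cong)
  then show ?thesis
    by (simp add: sum_option None Some sum lift_aff_add)
qed

lemma module_basis_C_aff: "module_basis (C_aff K) coord_basis"
  unfolding module_basis_def
proof (intro conjI ballI)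
  show "range coord_basis \<subseteq> vcarrier (C_aff K)" using coord_basis_caff by auto
  fix a assume "a \<in> vcarrier (C_aff K)"
  then have a: "a \<in> caff_set K" by simp
  obtain b d where bd: "continuous_on (pi2 K) b" "continuous_on (pi2 K) d" "a = lift_aff b d"
    by (rule caff_coefficients[OF a])
  define c where "c i = (case i of None \<Rightarrow> b | Some i \<Rightarrow> (\<lambda>y. d y $ i))" for i
  have cc: "continuous_on (pi2 K) (c i)" for i
    using bd by (auto simp: c_def split: option.split intro: continuous_intros)
  show "\<exists>!c. range c \<subseteq> mdom (C_aff K) \<and> a = (\<Sum>i\<in>UNIV. omult (C_aff K) (c i) (coord_basis i))"
  proof (rule ex1I)
    show "range (\<lambda>i. lift_base (c i)) \<subseteq> mdom (C_aff K) \<and>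
        a = (\<Sum>i\<in>UNIV. omult (C_aff K) (lift_base (c i)) (coord_basis i))"
      using lift_base_mdom[OF cc] unfolding coord_basis_sum[OF cc] by (auto simp: c_def bd(3))
    fix c' assume c': "range c' \<subseteq> mdom (C_aff K) \<and>
        a = (\<Sum>i\<in>UNIV. omult (C_aff K) (c' i) (coord_basis i))"
    then have "\<forall>i. \<exists>h. continuous_on (pi2 K) h \<and> c' i = lift_base h"
      by (metis mdom_lift_base rangeI subsetD)
    then obtain h where h: "\<And>i. continuous_on (pi2 K) (h i)" "\<And>i. c' i = lift_base (h i)"
      by metis
    have "lift_aff b d = lift_aff (h None) (\<lambda>y. \<chi> i. h (Some i) y)"
      using c' unfolding h(2) coord_basis_sum[OF h(1)] bd(3) by blast
    then have "b y = h None y \<and> d y = (\<chi> i. h (Some i) y)" if "y \<in> pi2 K" for y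
      using lift_aff_inj that by blast
    then show "c' = (\<lambda>i. lift_base (c i))"
      unfolding fun_eq_iff[of c'] h(2)
      by (intro allI lift_base_cong) (auto simp: c_def vec_eq_iff split: option.split)
  qed
qed

sublocale base: free_basis "C_aff K" base_gens coord_basis
  using module_basis_C_aff coord_basis_unit by unfold_locales

lemma coords_lift_aff:
  assumes "continuous_on (pi2 K) b" "continuous_on (pi2 K) d"
  shows "basis_coords (C_aff K) coord_basis (lift_aff b d) =
    (\<lambda>i. case i of None \<Rightarrow> lift_base b | Some i \<Rightarrow> lift_base (\<lambda>y. d y $ i))"
proof (rule base.coords_eqI)
  define c where "c i = (case i of None \<Rightarrow> b | Some i \<Rightarrow> (\<lambda>y. d y $ i))" for i
  have cc: "continuous_on (pi2 K) (c i)" for i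
    using assms by (auto simp: c_def split: option.split intro: continuous_intros)
  have eq: "(case i of None \<Rightarrow> lift_base b | Some i \<Rightarrow> lift_base (\<lambda>y. d y $ i)) = lift_base (c i)"
    for i
    by (simp add: c_def split: option.split)
  show "(case i of None \<Rightarrow> lift_base b | Some i \<Rightarrow> lift_base (\<lambda>y. d y $ i)) \<in> mdom (C_aff K)" for i
    unfolding eq by (rule lift_base_mdom[OF cc])
  show "lift_aff b d = (\<Sum>i\<in>UNIV. omult (C_aff K)
      (case i of None \<Rightarrow> lift_base b | Some i \<Rightarrow> lift_base (\<lambda>y. d y $ i)) (coord_basis i))"
    unfolding eq coord_basis_sum[OF cc] by (simp add: c_def)
qed

lemma coord_lift_aff:
  assumes "y \<in> pi2 K" "continuous_on (pi2 K) b" "continuous_on (pi2 K) d"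
  shows "base.coord y (lift_aff b d) = (b y, d y)"
  using assms
  by (simp add: base.coord_def coords_lift_aff mval_C_aff vec_eq_iff continuous_on_component)

lemma value_coord:
  assumes "a \<in> caff_set K" "(x, y) \<in> K"
  shows "a (x, y) = (1, x) \<bullet> base.coord y a"
proof -
  obtain b d where bd: "continuous_on (pi2 K) b" "continuous_on (pi2 K) d" "a = lift_aff b d"
    by (rule caff_coefficients[OF assms(1)])
  then show ?thesis using assms(2) by (simp add: coord_lift_aff pi2I inner_commute)
qed

text \<open>The values on a ball inside a fibre determine the coefficients, and the radius of the ball
  can be chosen independently of the fibre.\<close>

lemma coefficients_bounded_by_values:
  obtains C where "C \<ge> 0" "\<And>y b a N. y \<in> pi2 K \<Longrightarrow> (\<And>x. (x, y) \<in> K \<Longrightarrow> \<bar>b + a \<bullet> x\<bar> \<le> N) \<Longrightarrow>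
    \<bar>b\<bar> \<le> C * N \<and> norm a \<le> C * N"
proof -
  obtain \<epsilon> where \<epsilon>: "\<epsilon> > 0" "\<And>y. y \<in> pi2 K \<Longrightarrow> \<exists>x. cball x \<epsilon> \<subseteq> fib K y"
    using uniform_inner_radius by blast
  have "bounded (fst ` K)"
    by (intro compact_imp_bounded compact_continuous_image cpt continuous_intros)
  then obtain B where B: "\<And>x y. (x, y) \<in> K \<Longrightarrow> norm x \<le> B" by (force simp: bounded_iff)
  define C where "C = 2 / \<epsilon> + (1 + (2 / \<epsilon>) * \<bar>B\<bar>)"
  have "\<bar>b\<bar> \<le> C * N \<and> norm a \<le> C * N"
    if y: "y \<in> pi2 K" and N: "\<And>x. (x, y) \<in> K \<Longrightarrow> \<bar>b + a \<bullet> x\<bar> \<le> N" for y b a N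
  proof -
    obtain x where x: "cball x \<epsilon> \<subseteq> fib K y" using \<epsilon>(2)[OF y] by blast
    then have xK: "(x, y) \<in> K" using subsetD[OF x, of x] \<epsilon>(1) by simp
    then have N0: "0 \<le> N" using N by (meson abs_ge_zero order_trans)
    have "x + \<epsilon> *\<^sub>R (a /\<^sub>R norm a) \<in> cball x \<epsilon>"
      using \<epsilon>(1) by (cases "a = 0") (simp_all add: dist_norm mult.assoc)
    then have "(x + \<epsilon> *\<^sub>R (a /\<^sub>R norm a), y) \<in> K" using x by auto
    from N[OF this] N[OF xK] have "\<bar>\<epsilon> * (inverse (norm a) * (a \<bullet> a))\<bar> \<le> 2 * N"
      by (simp add: inner_add_right)
    moreover have "inverse (norm a) * (a \<bullet> a) = norm a"
      by (cases "a = 0") (simp_all add: dot_square_norm power2_eq_square)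
    ultimately have "\<epsilon> * norm a \<le> 2 * N" using \<epsilon>(1) by simp
    then have na: "norm a \<le> (2 / \<epsilon>) * N" using \<epsilon>(1) by (simp add: field_simps)
    have "\<bar>b\<bar> \<le> \<bar>b + a \<bullet> x\<bar> + norm a * norm x"
      using Cauchy_Schwarz_ineq2[of a x] by linarith
    also have "\<dots> \<le> N + ((2 / \<epsilon>) * N) * \<bar>B\<bar>"
      using N[OF xK] na B[OF xK] N0 \<epsilon>(1) by (intro add_mono mult_mono) auto
    also have "\<dots> = (1 + (2 / \<epsilon>) * \<bar>B\<bar>) * N" by (simp add: algebra_simps)
    finally have nb: "\<bar>b\<bar> \<le> (1 + (2 / \<epsilon>) * \<bar>B\<bar>) * N" .
    have "0 \<le> (2 / \<epsilon>) * N" "0 \<le> (1 + (2 / \<epsilon>) * \<bar>B\<bar>) * N" using N0 \<epsilon>(1) by auto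
    then show ?thesis using na nb unfolding C_def distrib_right[of _ _ N] by linarith
  qed
  moreover have "C \<ge> 0" using \<epsilon>(1) by (simp add: C_def)
  ultimately show thesis using that by blast
qed

lemma homeomorphic_coords_C_aff:
  "homeomorphic_map (ou_topology (C_aff K))
    (product_topology (\<lambda>_. subtopology (ou_topology (C_aff K)) (mdom (C_aff K))) UNIV)
    (basis_coords (C_aff K) coord_basis)"
proof -
  obtain C where C: "C \<ge> 0" "\<And>y b a N. y \<in> pi2 K \<Longrightarrow> (\<And>x. (x, y) \<in> K \<Longrightarrow> \<bar>b + a \<bullet> x\<bar> \<le> N) \<Longrightarrow>
    \<bar>b\<bar> \<le> C * N \<and> norm a \<le> C * N"
    using coefficients_bounded_by_values by blast
  show ?thesis
  proof (rule base.coords_bounded_imp_homeomorphic)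
    fix a i assume "a \<in> vcarrier (C_aff K)"
    then have a: "a \<in> caff_set K" by simp
    let ?N = "ou_norm (C_aff K) a"
    obtain b d where bd: "continuous_on (pi2 K) b" "continuous_on (pi2 K) d" "a = lift_aff b d"
      by (rule caff_coefficients[OF a])
    have le: "\<bar>b y\<bar> \<le> C * ?N" "\<bar>d y $ i\<bar> \<le> C * ?N" if y: "y \<in> pi2 K" for y i
    proof -
      have "\<bar>b y + d y \<bullet> x\<bar> \<le> ?N" if "(x, y) \<in> K" for x
        using C_aff_value_le_norm[OF a that] that by (simp add: bd(3))
      from C(2)[OF y this] show "\<bar>b y\<bar> \<le> C * ?N" "\<bar>d y $ i\<bar> \<le> C * ?N"
        using component_le_norm_cart[of "d y" i] by auto
    qed
    have le': "ou_norm (C_aff K) (lift_base c) \<le> C * ?N"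
      if "continuous_on (pi2 K) c" "\<And>y. y \<in> pi2 K \<Longrightarrow> \<bar>c y\<bar> \<le> C * ?N" for c
      using that C(1) lift_base_caff[OF that(1)]
      by (subst C_aff_norm_le_iff) (auto dest: pi2I)
    show "ou_norm (C_aff K) (basis_coords (C_aff K) coord_basis a i) \<le> C * ?N"
      unfolding bd(3) coords_lift_aff[OF bd(1,2)] unfolding bd(3)[symmetric]
      using le bd(1,2)
      by (cases i) (auto intro!: le' continuous_on_component)
  qed
qed

subsection \<open>The fibres\<close>

lemma value_zero_iff_coord:
  assumes "a \<in> caff_set K" "y \<in> pi2 K"
  shows "(\<forall>x. (x, y) \<in> K \<longrightarrow> a (x, y) = 0) \<longleftrightarrow> base.coord y a = 0"
proof
  assume z: "\<forall>x. (x, y) \<in> K \<longrightarrow> a (x, y) = 0"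
  obtain x0 r where x0: "r > 0" "cball x0 r \<subseteq> fib K y"
    using interior_fib[OF assms(2)] by (meson all_not_in_conv mem_interior_cball)
  obtain b d where bd: "base.coord y a = (b, d)" by (cases "base.coord y a")
  have "b + d \<bullet> x = 0 + 0 \<bullet> x" if "x \<in> cball x0 r" for x
    using z value_coord[OF assms(1), of x y] x0(2) that bd by (auto simp: inner_commute)
  then have "d = 0 \<and> b = 0" by (rule affine_formula_on_ball[OF x0(1)])
  then show "base.coord y a = 0" by (simp add: bd zero_prod_def)
next
  assume "base.coord y a = 0"
  then show "\<forall>x. (x, y) \<in> K \<longrightarrow> a (x, y) = 0" using value_coord[OF assms(1)] by simp
qed

text \<open>The functions that vanish on the fibre over \<open>y\<close> form a closed order ideal, which gives one
  direction. Conversely, the coefficients of a function that vanishes on the fibre are zero at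
  \<open>y\<close>, since the fibre has interior points.\<close>

lemma fibre_ideal_C_aff:
  assumes y: "y \<in> pi2 K" and a: "a \<in> caff_set K"
  shows "a \<in> fibre_ideal (C_aff K) base_gens y \<longleftrightarrow> (\<forall>x. (x, y) \<in> K \<longrightarrow> a (x, y) = 0)"
proof
  let ?J = "{f \<in> caff_set K. \<forall>x. (x, y) \<in> K \<longrightarrow> f (x, y) = 0}"
  have "order_ideal (C_aff K) ?J"
    unfolding order_ideal_def
  proof (intro conjI ballI impI)
    show "subspace ?J"
      using subspace_caff by (auto simp: subspace_def)
    fix f j assume "f \<in> vcarrier (C_aff K)" "j \<in> ?J" "ou_le (C_aff K) 0 f \<and> ou_le (C_aff K) f j"
    then have "f \<in> caff_set K" "\<And>p. p \<in> K \<Longrightarrow> 0 \<le> f p" "\<And>p. p \<in> K \<Longrightarrow> f p \<le> j p"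
      "\<And>x. (x, y) \<in> K \<Longrightarrow> j (x, y) = 0" by (auto simp: ou_le_def)
    then show "f \<in> ?J" by (auto intro!: order_antisym) metis
  qed auto
  moreover have "closedin (ou_topology (C_aff K)) ?J"
  proof (subst closedin_ou_iff)
    show "\<forall>f\<in>vcarrier (C_aff K). (\<forall>\<epsilon>>0. \<exists>b\<in>?J. ou_norm (C_aff K) (f - b) < \<epsilon>) \<longrightarrow> f \<in> ?J"
    proof (intro ballI impI)
      fix f assume f: "f \<in> vcarrier (C_aff K)" and ap: "\<forall>\<epsilon>>0. \<exists>b\<in>?J. ou_norm (C_aff K) (f - b) < \<epsilon>"
      have "f (x, y) = 0" if xy: "(x, y) \<in> K" for x
      proof -
        have "\<bar>f (x, y)\<bar> \<le> 0 + \<epsilon>" if "\<epsilon> > 0" for \<epsilon>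
        proof -
          obtain b where b: "b \<in> ?J" "ou_norm (C_aff K) (f - b) < \<epsilon>" using ap \<open>\<epsilon> > 0\<close> by blast
          then have "f - b \<in> caff_set K" using f by (auto intro: subspace_diff[OF subspace_caff])
          from C_aff_value_le_norm[OF this xy] show ?thesis using b xy by auto
        qed
        then have "\<bar>f (x, y)\<bar> \<le> 0" by (rule field_le_epsilon)
        then show ?thesis by simp
      qed
      then show "f \<in> ?J" using f by simp
    qed
  qed auto
  moreover have "{f \<in> mdom (C_aff K). mval (C_aff K) base_gens f y = 0} \<subseteq> ?J"
  proof
    fix f assume f: "f \<in> {f \<in> mdom (C_aff K). mval (C_aff K) base_gens f y = 0}"
    then obtain c where c: "continuous_on (pi2 K) c" "f = lift_base c"
      by (auto intro: mdom_lift_base)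
    with f show "f \<in> ?J" using y by (simp add: mval_C_aff lift_base_caff)
  qed
  ultimately have "fibre_ideal (C_aff K) base_gens y \<subseteq> ?J"
    unfolding fibre_ideal_def by (rule closed_order_ideal_hull_least)
  then show "a \<in> fibre_ideal (C_aff K) base_gens y \<Longrightarrow> \<forall>x. (x, y) \<in> K \<longrightarrow> a (x, y) = 0" by blast
next
  assume "\<forall>x. (x, y) \<in> K \<longrightarrow> a (x, y) = 0"
  then have "base.coord y a = 0" using value_zero_iff_coord[OF a y] by blast
  then show "a \<in> fibre_ideal (C_aff K) base_gens y"
    using y a by (intro base.fibre_ideal_if_coord_zero) (simp_all add: spectrum_C_aff)
qed

abbreviation "fibre_at y \<equiv> fibre_ou (C_aff K) base_gens y"

abbreviation "class_at y \<equiv> fibre_class (C_aff K) base_gens y"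

lemma class_at_eq_iff:
  assumes "y \<in> pi2 K" "a \<in> caff_set K" "b \<in> caff_set K"
  shows "class_at y a = class_at y b \<longleftrightarrow> (\<forall>x. (x, y) \<in> K \<longrightarrow> a (x, y) = b (x, y))"
  using fibre_ideal_C_aff[OF assms(1) subspace_diff[OF subspace_caff assms(2,3)]]
  by (simp add: base.fibre_class_eq_iff)

lemmas class_at_linear = base.fibre_class_linear

lemma fibre_C_aff_simps:
  "vcarrier (fibre_at y) = class_at y ` caff_set K"
  "pos (fibre_at y) = class_at y ` {f \<in> caff_set K. \<forall>p\<in>K. 0 \<le> f p}"
  "ounit (fibre_at y) = class_at y (ounit (C_aff K))"
  by (simp_all add: fibre_ou_def quotient_ou_def fibre_class_def)

text \<open>A class that is nonnegative on the fibre has a representative that is nonnegative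
  everywhere.\<close>

lemma class_at_pos_iff:
  assumes y: "y \<in> pi2 K" and a: "a \<in> caff_set K"
  shows "class_at y a \<in> pos (fibre_at y) \<longleftrightarrow> (\<forall>x. (x, y) \<in> K \<longrightarrow> 0 \<le> a (x, y))"
proof
  assume "class_at y a \<in> pos (fibre_at y)"
  then obtain f where "f \<in> caff_set K" "\<forall>p\<in>K. 0 \<le> f p" "class_at y a = class_at y f"
    by (auto simp: fibre_C_aff_simps)
  then show "\<forall>x. (x, y) \<in> K \<longrightarrow> 0 \<le> a (x, y)" using class_at_eq_iff[OF y a] by auto
next
  assume pos: "\<forall>x. (x, y) \<in> K \<longrightarrow> 0 \<le> a (x, y)"
  obtain b d where bd: "continuous_on (pi2 K) b" "continuous_on (pi2 K) d" "a = lift_aff b d"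
    by (rule caff_coefficients[OF a])
  have pos': "0 \<le> b y + d y \<bullet> x" if "(x, y) \<in> K" for x using pos that by (auto simp: bd(3))
  obtain b' where b': "continuous_on (pi2 K) b'" "b' y = b y" "\<And>x y. (x, y) \<in> K \<Longrightarrow> 0
    \<le> b' y + d y \<bullet> x"
    using extend_positive[OF bd(1,2) y pos'] by blast
  have f: "lift_aff b' d \<in> caff_set K" by (rule lift_aff_caff[OF b'(1) bd(2)])
  have "class_at y a = class_at y (lift_aff b' d)"
    using class_at_eq_iff[OF y a f] b'(2) by (simp add: bd(3))
  with f b'(3) show "class_at y a \<in> pos (fibre_at y)"
    by (auto simp: fibre_C_aff_simps)
qed

lemma caff_add: "f \<in> caff_set K \<Longrightarrow> h \<in> caff_set K \<Longrightarrow> f + h \<in> caff_set K"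
  by (rule subspace_add[OF subspace_caff])

lemma caff_scale: "f \<in> caff_set K \<Longrightarrow> r *\<^sub>R f \<in> caff_set K"
  by (rule subspace_scale[OF subspace_caff])

lemma caff_diff: "f \<in> caff_set K \<Longrightarrow> h \<in> caff_set K \<Longrightarrow> f - h \<in> caff_set K"
  by (rule subspace_diff[OF subspace_caff])

lemma unit_caff': "ounit (C_aff K) \<in> caff_set K"
  using unit_carrier by simp

lemma fibre_ou_le_iff:
  assumes y: "y \<in> pi2 K" and "a \<in> caff_set K" "b \<in> caff_set K"
  shows "ou_le (fibre_at y) (class_at y a) (class_at y b) \<longleftrightarrow>
    (\<forall>x. (x, y) \<in> K \<longrightarrow> a (x, y) \<le> b (x, y))"
  using class_at_pos_iff[OF y caff_diff[OF assms(3,2)]]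
  by (simp add: ou_le_def linear_diff[OF class_at_linear])

text \<open>By \<open>class_at_pos_iff\<close> the quotient is ordered as the affine functions on the fibre; in
  particular it is Archimedean.\<close>

lemma fibre_aou_C_aff:
  assumes y: "y \<in> pi2 K"
  shows "aou_space (fibre_at y)"
proof -
  let ?q = "class_at y" and ?B = "fibre_at y"
  note lin = linear_add[OF class_at_linear] linear_scale[OF class_at_linear] linear_neg[OF
    class_at_linear]
    linear_diff[OF class_at_linear]
  have posB: "v \<in> pos ?B \<longleftrightarrow> (\<exists>a\<in>caff_set K. v = ?q a \<and> (\<forall>x. (x, y) \<in> K \<longrightarrow> 0 \<le> a (x, y)))" for v
  proof
    assume "v \<in> pos ?B"
    then obtain a where "a \<in> caff_set K" "v = ?q a" by (auto simp: fibre_C_aff_simps)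
    with \<open>v \<in> pos ?B\<close> show "\<exists>a\<in>caff_set K. v = ?q a \<and> (\<forall>x. (x, y) \<in> K \<longrightarrow> 0 \<le> a (x, y))"
      using class_at_pos_iff[OF y] by blast
  next
    assume "\<exists>a\<in>caff_set K. v = ?q a \<and> (\<forall>x. (x, y) \<in> K \<longrightarrow> 0 \<le> a (x, y))"
    then show "v \<in> pos ?B" using class_at_pos_iff[OF y] by blast
  qed
  have "subspace (vcarrier ?B)"
    unfolding fibre_C_aff_simps by (rule linear_subspace_image[OF class_at_linear subspace_caff])
  moreover have "pos ?B \<subseteq> vcarrier ?B" by (auto simp: fibre_C_aff_simps)
  moreover have "convex_cone (pos ?B)"
    using convex_cone_linear_image[of "pos (C_aff K)" ?q] aou_C_aff class_at_linear[of y]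
    by (simp add: aou_space_def fibre_C_aff_simps)
  moreover have "pos ?B \<inter> uminus ` pos ?B = {0}"
  proof (intro equalityI subsetI)
    fix v assume "v \<in> pos ?B \<inter> uminus ` pos ?B"
    then have "v \<in> pos ?B" "- v \<in> pos ?B" by auto
    then obtain a b where a: "a \<in> caff_set K" "v = ?q a" "\<And>x. (x, y) \<in> K \<Longrightarrow> 0 \<le> a (x, y)"
      and b: "b \<in> caff_set K" "- v = ?q b" "\<And>x. (x, y) \<in> K \<Longrightarrow> 0 \<le> b (x, y)"
      unfolding posB by blast
    have "?q (a + b) = ?q 0"
      using a(2) b(2) by (simp only: lin linear_0[OF class_at_linear]) (metis add.right_inverse)
    then have "\<forall>x. (x, y) \<in> K \<longrightarrow> a (x, y) + b (x, y) = 0"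
      using class_at_eq_iff[OF y caff_add[OF a(1) b(1)] subspace_0[OF subspace_caff]] by simp
    then have "\<forall>x. (x, y) \<in> K \<longrightarrow> a (x, y) = 0 (x, y)"
      using a(3) b(3) by (metis add_nonneg_eq_0_iff zero_fun_apply)
    then have "?q a = ?q 0" using class_at_eq_iff[OF y a(1) subspace_0[OF subspace_caff]] by blast
    then show "v \<in> {0}" using a(2) linear_0[OF class_at_linear] by simp
  next
    fix v :: "(real^'n) \<times> (real^'m) \<Rightarrow> real" assume "v \<in> {0}"
    moreover have "0 \<in> pos ?B"
      unfolding posB using subspace_0[OF subspace_caff] linear_0[OF class_at_linear, of y,
        symmetric]
      by (intro bexI[of _ 0]) auto
    ultimately show "v \<in> pos ?B \<inter> uminus ` pos ?B" by (auto intro!: image_eqI[of _ _ 0])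
  qed
  moreover have "\<exists>r>0. ou_le ?B (- (r *\<^sub>R ounit ?B)) v \<and> ou_le ?B v (r *\<^sub>R ounit ?B)"
    if v: "v \<in> vcarrier ?B" for v
  proof -
    obtain a where a: "a \<in> caff_set K" "v = ?q a" using v by (auto simp: fibre_C_aff_simps)
    obtain r where r: "r > 0" "\<forall>p\<in>K. \<bar>a p\<bar> \<le> r" using caff_bounded[OF a(1)] by blast
    have u: "r *\<^sub>R ounit (C_aff K) \<in> caff_set K" "- (r *\<^sub>R ounit (C_aff K)) \<in> caff_set K"
      using unit_caff' subspace_neg[OF subspace_caff]
        by (auto simp: caff_scale simp del: C_aff_simps)
    have "ou_le ?B (?q (- (r *\<^sub>R ounit (C_aff K)))) (?q a)
      \<and> ou_le ?B (?q a) (?q (r *\<^sub>R ounit (C_aff K)))"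
      unfolding fibre_ou_le_iff[OF y u(2) a(1)] fibre_ou_le_iff[OF y a(1) u(1)]
      using r(2) by (auto simp: abs_le_iff minus_le_iff)
    then show ?thesis
      using r(1) unfolding a(2) fibre_C_aff_simps(3) lin by blast
  qed
  moreover have "v \<in> pos ?B" if v: "v \<in> vcarrier ?B" and ar: "\<forall>r>0. v + r *\<^sub>R ounit ?B \<in> pos ?B"
    for v
  proof -
    obtain a where a: "a \<in> caff_set K" "v = ?q a" using v by (auto simp: fibre_C_aff_simps)
    have "0 \<le> a (x, y)" if xy: "(x, y) \<in> K" for x
    proof (rule field_le_epsilon)
      fix r :: real assume "r > 0"
      then have "?q (a + r *\<^sub>R ounit (C_aff K)) \<in> pos ?B"
        using ar unfolding a(2) fibre_C_aff_simps(3) lin by blast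
      then show "0 \<le> a (x, y) + r"
        using class_at_pos_iff[OF y caff_add[OF a(1) caff_scale[OF unit_caff']]] xy by auto
    qed
    then show ?thesis unfolding posB using a by blast
  qed
  moreover have "ounit ?B \<in> vcarrier ?B"
    unfolding fibre_C_aff_simps(1,3) by (intro imageI unit_caff')
  ultimately show ?thesis
    unfolding aou_space_def by simp
qed

text \<open>An affine function on a fibre has unique coefficients in \<open>\<real> \<times> \<real>\<^sup>n\<close>, because the fibre has
  interior points.\<close>

lemma fibre_dim_C_aff:
  assumes y: "y \<in> pi2 K"
  shows "dim (vcarrier (fibre_at y)) = CARD('n) + 1"
proof -
  define L where "L w = class_at y (base.affine_elt w)" for w :: "real \<times> (real^'n)"
  have ys: "y \<in> spectrum_set (C_aff K) base_gens" using y by (simp add: spectrum_C_aff)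
  have aff: "base.affine_elt w \<in> caff_set K" for w using base.affine_elt_carrier by simp
  have L_eq: "L w = L w' \<longleftrightarrow> w = w'" for w w'
    using class_at_eq_iff[OF y aff aff] value_zero_iff_coord[OF caff_diff[OF aff aff] y]
      base.coord_affine_elt[OF ys] base.coord_diff[OF ys, of "base.affine_elt w"
        "base.affine_elt w'"] aff
    by (auto simp: L_def)
  have "linear L"
  proof
    show "L (v + w) = L v + L w" for v w
      by (simp add: L_def base.affine_elt_def scaleR_add_left sum.distrib
          flip: linear_add[OF class_at_linear]) (simp add: algebra_simps)
    show "L (r *\<^sub>R w) = r *\<^sub>R L w" for r w
      by (simp add: L_def base.affine_elt_def scaleR_sum_right scaleR_add_right
          flip: linear_scale[OF class_at_linear])
  qed
  have img: "vcarrier (fibre_at y) = L ` UNIV"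
  proof (intro equalityI subsetI)
    fix v assume "v \<in> vcarrier (fibre_at y)"
    then obtain a where a: "a \<in> caff_set K" "v = class_at y a" by (auto simp: fibre_C_aff_simps)
    have "class_at y a = L (base.coord y a)"
      unfolding L_def class_at_eq_iff[OF y a(1) aff]
      using value_coord[OF a(1)] value_coord[OF aff] base.coord_affine_elt[OF ys] by simp
    then show "v \<in> L ` UNIV" using a by blast
  qed (auto simp: L_def fibre_C_aff_simps aff)
  have inj: "inj L" using L_eq by (auto intro: injI)
  have "independent (L ` Basis)"
    by (rule linear_independent_injective_image[OF \<open>linear L\<close> independent_Basis inj_on_subset[OF
      inj subset_UNIV]])
  then have "dim (L ` Basis) = card (L ` (Basis :: (real \<times> (real^'n)) set))"
    by (rule dim_eq_card_independent)
  also have "\<dots> = DIM(real \<times> (real^'n))"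
    by (rule card_image[OF inj_on_subset[OF inj subset_UNIV]])
  finally have "dim (L ` Basis) = CARD('n) + 1" by simp
  moreover have "L ` UNIV = span (L ` Basis)"
    using linear_span_image[OF \<open>linear L\<close>, of Basis] by simp
  ultimately show ?thesis unfolding img by simp
qed

text \<open>The quotient is ordered pointwise on the fibre, so its order unit norm is the supremum
  norm there.\<close>

lemma fibre_norm_C_aff_bounds:
  assumes y: "y \<in> pi2 K" and a: "a \<in> caff_set K"
  shows "(\<And>x. (x, y) \<in> K \<Longrightarrow> \<bar>a (x, y)\<bar> \<le> ou_norm (fibre_at y) (class_at y a))"
    and "r > 0 \<Longrightarrow> (\<And>x. (x, y) \<in> K \<Longrightarrow> \<bar>a (x, y)\<bar> \<le> r) \<Longrightarrow>
      ou_norm (fibre_at y) (class_at y a) \<le> r"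
    and "0 \<le> ou_norm (fibre_at y) (class_at y a)"
proof -
  let ?B = "fibre_at y" and ?q = "class_at y"
  let ?R = "{r. r > 0 \<and> (\<forall>x. (x, y) \<in> K \<longrightarrow> \<bar>a (x, y)\<bar> \<le> r)}"
  have "(ou_le ?B (- (r *\<^sub>R ounit ?B)) (?q a) \<and> ou_le ?B (?q a) (r *\<^sub>R ounit ?B)) \<longleftrightarrow>
      (\<forall>x. (x, y) \<in> K \<longrightarrow> \<bar>a (x, y)\<bar> \<le> r)" for r
  proof -
    have u: "r *\<^sub>R ounit (C_aff K) \<in> caff_set K" "- (r *\<^sub>R ounit (C_aff K)) \<in> caff_set K"
      using unit_caff' subspace_neg[OF subspace_caff]
        by (auto simp: caff_scale simp del: C_aff_simps)
    have eq: "r *\<^sub>R ounit ?B = ?q (r *\<^sub>R ounit (C_aff K))" "- ?q (r *\<^sub>R ounit (C_aff K))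
      = ?q (- (r *\<^sub>R ounit (C_aff K)))"
      unfolding fibre_C_aff_simps(3) linear_neg[OF class_at_linear] linear_scale[OF
        class_at_linear] by (rule refl)+
    show ?thesis
      unfolding eq fibre_ou_le_iff[OF y u(2) a] fibre_ou_le_iff[OF y a u(1)]
      by (auto simp: abs_le_iff minus_le_iff)
  qed
  moreover have "?q a \<in> vcarrier ?B" using a by (simp add: fibre_C_aff_simps)
  ultimately have norm: "ou_norm ?B (?q a) = Inf ?R"
    by (simp add: ou_norm_def)
  have ne: "?R \<noteq> {}" using caff_bounded[OF a] by blast
  show "\<bar>a (x, y)\<bar> \<le> ou_norm ?B (?q a)" if "(x, y) \<in> K" for x
    unfolding norm using that by (intro cInf_greatest[OF ne]) auto
  show "0 \<le> ou_norm ?B (?q a)"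
    unfolding norm by (intro cInf_greatest[OF ne]) auto
  show "r > 0 \<Longrightarrow> (\<And>x. (x, y) \<in> K \<Longrightarrow> \<bar>a (x, y)\<bar> \<le> r) \<Longrightarrow> ou_norm ?B (?q a) \<le> r"
    unfolding norm by (intro cInf_lower) (auto intro!: bdd_belowI[of _ 0])
qed

text \<open>The coefficients of a bounded sequence of affine functions on the fibres over \<open>y\<^sub>k\<close> are
  bounded, and a limit of a subsequence defines, with constant coefficients, the required
  element.\<close>

lemma fibre_liminf_C_aff:
  assumes yk: "\<And>k::nat. y k \<in> pi2 K" and y0: "y0 \<in> pi2 K" and lim: "y \<longlonglongrightarrow> y0"
    and v: "\<And>k. v k \<in> pos (fibre_at (y k))"
    and bdd: "bdd_above (range (\<lambda>k. ou_norm (fibre_at (y k)) (v k)))"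
  shows "\<exists>r v0 a. strict_mono r \<and> v0 \<in> pos (fibre_at y0) \<and> a \<in> vcarrier (C_aff K) \<and>
      class_at y0 a = v0 \<and>
      (\<lambda>j. ou_norm (fibre_at (y (r j))) (v (r j) - class_at (y (r j)) a)) \<longlonglongrightarrow> 0"
proof -
  have ys: "y k \<in> spectrum_set (C_aff K) base_gens" for k using yk by (simp add: spectrum_C_aff)
  have y0s: "y0 \<in> spectrum_set (C_aff K) base_gens" using y0 by (simp add: spectrum_C_aff)
  have "\<forall>k. \<exists>a. a \<in> caff_set K \<and> v k = class_at (y k) a" using v by (auto simp: fibre_C_aff_simps)
  then obtain f where f: "\<And>k. f k \<in> caff_set K" "\<And>k. v k = class_at (y k) (f k)" by metis
  have f_pos: "0 \<le> f k (x, y k)" if "(x, y k) \<in> K" for k x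
    using v[of k] class_at_pos_iff[OF yk f(1)] that by (simp add: f(2))
  obtain N where N: "\<And>k. ou_norm (fibre_at (y k)) (v k) \<le> N"
    using bdd by (auto simp: bdd_above_def)
  define w where "w k = base.coord (y k) (f k)" for k
  obtain C where "C \<ge> 0" and C: "\<And>y b a N. y \<in> pi2 K \<Longrightarrow> (\<And>x. (x, y) \<in> K \<Longrightarrow> \<bar>b + a \<bullet> x\<bar> \<le> N) \<Longrightarrow>
    \<bar>b\<bar> \<le> C * N \<and> norm a \<le> C * N"
    using coefficients_bounded_by_values by blast
  have "norm (w k) \<le> C * N + C * N" for k
  proof -
    have "\<bar>fst (w k) + snd (w k) \<bullet> x\<bar> \<le> N" if xy: "(x, y k) \<in> K" for x
    proof -
      have "fst (w k) + snd (w k) \<bullet> x = f k (x, y k)"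
        using value_coord[OF f(1) xy] by (simp add: w_def inner_prod_def inner_commute)
      then show ?thesis
        using fibre_norm_C_aff_bounds(1)[OF yk[of k] f(1)[of k] xy] N[of k] f(2)[of k] by simp
    qed
    from C[OF yk[of k] this] show ?thesis
      using norm_Pair_le[of "fst (w k)" "snd (w k)"] by simp
  qed
  then have "bounded (range w)" by (auto simp: bounded_iff)
  then obtain l r where r: "strict_mono (r :: nat \<Rightarrow> nat)" and l: "(w \<circ> r) \<longlonglongrightarrow> l"
    using bounded_imp_convergent_subsequence by blast
  define a where "a = base.affine_elt l"
  have a: "a \<in> caff_set K" using base.affine_elt_carrier by (simp add: a_def)
  have fa: "\<bar>f k (x, y k) - a (x, y k)\<bar> \<le> norm (1::real, x) * norm (w k - l)"
    if xy: "(x, y k) \<in> K" for k x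
  proof -
    have "f k (x, y k) - a (x, y k) = (1, x) \<bullet> (w k - l)"
      using value_coord[OF f(1) xy] value_coord[OF a xy] base.coord_affine_elt[OF ys, of k l]
      by (simp add: w_def a_def inner_diff_right)
    then show ?thesis by (metis Cauchy_Schwarz_ineq2)
  qed
  have "bounded (fst ` K)"
    by (intro compact_imp_bounded compact_continuous_image cpt continuous_intros)
  then obtain B where B: "\<And>x y. (x, y) \<in> K \<Longrightarrow> norm x \<le> B" by (force simp: bounded_iff)
  have nB: "norm (1::real, x) \<le> 1 + \<bar>B\<bar>" if "(x, y) \<in> K" for x y
    using norm_Pair_le[of "1::real" x] B[OF that] by simp
  have wl: "(\<lambda>j. norm (w (r j) - l)) \<longlonglongrightarrow> 0"
    using tendsto_norm_zero[OF LIM_zero[OF l]] by (simp add: comp_def)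
  have "(\<lambda>j. ou_norm (fibre_at (y (r j))) (v (r j) - class_at (y (r j)) a)) \<longlonglongrightarrow> 0"
  proof (rule tendsto_sandwich)
    have eq: "v k - class_at (y k) a = class_at (y k) (f k - a)" for k
      by (simp add: f(2) linear_diff[OF class_at_linear])
    show "\<forall>\<^sub>F j in sequentially. 0 \<le> ou_norm (fibre_at (y (r j))) (v (r j) - class_at (y (r j)) a)"
      unfolding eq using fibre_norm_C_aff_bounds(3)[OF yk caff_diff[OF f(1) a]] by simp
    \<comment> \<open>The term \<open>1 / (j + 1)\<close> keeps the bound positive, as required of the radii in the order unit
    norm.\<close>
    show "\<forall>\<^sub>F j in sequentially. ou_norm (fibre_at (y (r j))) (v (r j) - class_at (y (r j)) a)
        \<le> (1 + \<bar>B\<bar>) * norm (w (r j) - l) + inverse (real (Suc j))"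
    proof (intro always_eventually allI)
      fix j
      show "ou_norm (fibre_at (y (r j))) (v (r j) - class_at (y (r j)) a)
        \<le> (1 + \<bar>B\<bar>) * norm (w (r j) - l) + inverse (real (Suc j))"
        unfolding eq
      proof (rule fibre_norm_C_aff_bounds(2)[OF yk caff_diff[OF f(1) a]])
        show "0 < (1 + \<bar>B\<bar>) * norm (w (r j) - l) + inverse (real (Suc j))"
          by (intro add_nonneg_pos) auto
        fix x assume xy: "(x, y (r j)) \<in> K"
        have "\<bar>(f (r j) - a) (x, y (r j))\<bar> \<le> (1 + \<bar>B\<bar>) * norm (w (r j) - l)"
          using order_trans[OF fa[OF xy] mult_right_mono[OF nB[OF xy] norm_ge_zero]] by simp
        also have "\<dots> \<le> (1 + \<bar>B\<bar>) * norm (w (r j) - l) + inverse (real (Suc j))" by simp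
        finally show "\<bar>(f (r j) - a) (x, y (r j))\<bar>
          \<le> (1 + \<bar>B\<bar>) * norm (w (r j) - l) + inverse (real (Suc j))" .
      qed
    qed
    show "(\<lambda>j. (1 + \<bar>B\<bar>) * norm (w (r j) - l) + inverse (real (Suc j))) \<longlonglongrightarrow> 0"
      using tendsto_add[OF tendsto_mult_right_zero[OF wl, of "1 + \<bar>B\<bar>"]
        LIMSEQ_inverse_real_of_nat] by simp
  qed simp
  moreover have "class_at y0 a \<in> pos (fibre_at y0)"
    unfolding class_at_pos_iff[OF y0 a]
  proof (intro allI impI)
    have int_pos: "0 \<le> fst l + snd l \<bullet> x" if x: "x \<in> interior (fib K y0)" for x
    proof -
      obtain \<epsilon> \<delta> where ed: "\<epsilon> > 0" "\<delta> > 0" "\<And>y. y \<in> pi2 K \<Longrightarrow> dist y y0 < \<delta> \<Longrightarrow> cball x \<epsilon> \<subseteq> fib K y"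
        using interior_fib_persists[OF y0 x] by blast
      have "\<forall>\<^sub>F j in sequentially. dist (y (r j)) y0 < \<delta>"
        using tendstoD[OF LIMSEQ_subseq_LIMSEQ[OF lim r] ed(2)] by (simp add: comp_def)
      then have ev: "\<forall>\<^sub>F j in sequentially. 0 \<le> (1, x) \<bullet> w (r j)"
      proof (rule eventually_mono)
        fix j assume "dist (y (r j)) y0 < \<delta>"
        then have "(x, y (r j)) \<in> K" using subsetD[OF ed(3)[OF yk], of "r j" x] ed(1) by simp
        then show "0 \<le> (1, x) \<bullet> w (r j)"
          using f_pos[of x "r j"] value_coord[OF f(1), of x "y (r j)" "r j"] unfolding w_def
            by metis
      qed
      have "(\<lambda>j. (1, x) \<bullet> w (r j)) \<longlonglongrightarrow> (1, x) \<bullet> l"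
        using l unfolding comp_def by (intro tendsto_intros)
      from tendsto_lowerbound[OF this ev] show ?thesis by (simp add: inner_prod_def inner_commute)
    qed
    fix x assume xy: "(x, y0) \<in> K"
    have "interior (fib K y0) \<subseteq> {x. snd l \<bullet> x \<ge> - fst l}"
      using int_pos by fastforce
    then have "closure (interior (fib K y0)) \<subseteq> {x. snd l \<bullet> x \<ge> - fst l}"
      by (rule closure_minimal[OF _ closed_halfspace_ge])
    moreover have "x \<in> closure (interior (fib K y0))"
      using convex_closure_interior[OF convex_fib[OF y0] interior_fib[OF y0]] xy closure_subset
        by fastforce
    ultimately have "0 \<le> fst l + snd l \<bullet> x" by auto
    then show "0 \<le> a (x, y0)"
      using value_coord[OF a xy] base.coord_affine_elt[OF y0s, of l]
      by (simp add: a_def inner_prod_def inner_commute)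
  qed
  ultimately show ?thesis using r a by auto
qed

lemma fibre_conditions_C_aff: "fibre_conditions (C_aff K) base_gens (CARD('n))"
proof -
  have "a \<in> pos (C_aff K) \<longleftrightarrow> (\<forall>y\<in>pi2 K. class_at y a \<in> pos (fibre_at y))"
    if "a \<in> caff_set K" for a
    using that class_at_pos_iff[OF _ that] by (auto intro: pi2I)
  then show ?thesis
    unfolding fibre_conditions_def spectrum_C_aff
    using fibre_aou_C_aff fibre_dim_C_aff fibre_liminf_C_aff
    by (intro conjI ballI allI impI; (elim conjE)?) (simp_all del: C_aff_simps(2))
qed

theorem free_ou_module_C_aff: "free_ou_module TYPE('n) TYPE('m) (C_aff K)"
  unfolding free_ou_module_iff
  using aou_C_aff kadison_C_aff cstar_C_aff generators_C_aff gelfand_C_aff fibre_conditions_C_aff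
    module_basis_C_aff coord_basis_unit homeomorphic_coords_C_aff
  by blast

end

section \<open>The states of the module of continuous partially affine functions\<close>

lemma sum_fun_apply: "sum f I x = (\<Sum>i\<in>I. f i x)"
  by (induction I rule: infinite_finite_induct) auto

lemma affine_on_convex_image:
  assumes "affine_on S f" "convex S"
  shows "convex (f ` S)"
  unfolding convex_alt
proof (intro ballI allI impI, elim conjE)
  fix v w and t :: real assume "v \<in> f ` S" "w \<in> f ` S" "0 \<le> t" "t \<le> 1"
  then obtain x y where xy: "x \<in> S" "y \<in> S" "v = f x" "w = f y" by blast
  have "(1 - t) *\<^sub>R x + t *\<^sub>R y \<in> S"
    using convexD_alt[OF assms(2) xy(1,2) \<open>0 \<le> t\<close> \<open>t \<le> 1\<close>] .
  then show "(1 - t) *\<^sub>R v + t *\<^sub>R w \<in> f ` S"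
    using affine_onD[OF assms(1) xy(1,2) \<open>0 \<le> t\<close> \<open>t \<le> 1\<close>] xy by (metis imageI)
qed

context compact_regular
begin

lemma eval_base_value:
  assumes "z \<in> mdom (C_aff K)" "(x, y) \<in> K"
  shows "z (x, y) = eval_base y z"
  using mdom_lift_base[OF assms(1)] assms(2) by (metis eval_base_lift lift_base_in pi2I snd_conv)

lemma eval_rep: "p \<in> K \<Longrightarrow> (\<lambda>f\<in>caff_set K. f p) \<in> reps (C_aff K)"
  by simp

lemma omult_value:
  assumes "z \<in> mdom (C_aff K)" "a \<in> caff_set K" "p \<in> K"
  shows "omult (C_aff K) z a p = z p * a p"
  using omult(1)[OF assms(1), of a] omult(2)[OF assms(1), of a "\<lambda>f\<in>caff_set K. f p"]
    mdom_carrier[OF assms(1)] assms(2,3) by simp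

text \<open>A \<open>y\<close>-state is evaluation at some \<open>(x, y)\<close> with \<open>x \<in> \<real>\<^sup>n\<close>. If \<open>x\<close> were outside the fibre,
  an affine function positive on the fibre and negative at \<open>x\<close> would extend to a positive
  element with negative value.\<close>

lemma y_state_is_evaluation:
  assumes y: "y \<in> pi2 K" and \<Phi>: "\<Phi> \<in> y_states (C_aff K) base_gens y"
  obtains x where "(x, y) \<in> K" "\<And>a. a \<in> caff_set K \<Longrightarrow> \<Phi> a = a (x, y)"
proof -
  have ys: "y \<in> spectrum_set (C_aff K) base_gens" using y by (simp add: spectrum_C_aff)
  define x where "x = (\<chi> i. \<Phi> (coord_basis (Some i)))"
  have eval: "\<Phi> a = (1, x) \<bullet> base.coord y a" if "a \<in> caff_set K" for a
    using base.y_state_formula[OF ys \<Phi>, of a] that by (simp add: x_def)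
  have "(x, y) \<in> K"
  proof (rule ccontr)
    assume "(x, y) \<notin> K"
    then have "x \<notin> fib K y" by simp
    then obtain a b where ab: "a \<bullet> x < b" "\<And>z. z \<in> fib K y \<Longrightarrow> a \<bullet> z > b"
      using separating_hyperplane_closed_point[OF convex_fib[OF y] compact_imp_closed[OF
        compact_fib]] by blast
    have cont: "continuous_on (pi2 K) (\<lambda>_. - b)" "continuous_on (pi2 K) (\<lambda>_. a)"
      by (intro continuous_intros)+
    have pos: "0 \<le> - b + a \<bullet> z" if "(z, y) \<in> K" for z using ab(2)[of z] that by simp
    obtain b' where b': "continuous_on (pi2 K) b'" "b' y = - b" "\<And>z y. (z, y) \<in> K \<Longrightarrow> 0
      \<le> b' y + a \<bullet> z"
      using extend_positive[OF cont y pos] by blast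
    have f: "lift_aff b' (\<lambda>_. a) \<in> caff_set K" by (rule lift_aff_caff[OF b'(1) cont(2)])
    have "lift_aff b' (\<lambda>_. a) \<in> pos (C_aff K)" using f b'(3) by auto
    then have "0 \<le> \<Phi> (lift_aff b' (\<lambda>_. a))" using \<Phi> by (auto simp: y_states_def states_def)
    then show False
      using ab(1) b'(2) by (simp add: eval[OF f] coord_lift_aff[OF y b'(1) cont(2)] inner_commute)
  qed
  moreover have "\<Phi> a = a (x, y)" if "a \<in> caff_set K" for a
    using eval[OF that] value_coord[OF that \<open>(x, y) \<in> K\<close>] by simp
  ultimately show thesis using that by blast
qed

context
  fixes e :: "'n option \<Rightarrow> (real^'n) \<times> (real^'m) \<Rightarrow> real"
    and g :: "'m \<Rightarrow> (real^'n) \<times> (real^'m) \<Rightarrow> real"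
  assumes e: "module_basis (C_aff K) e" "e None = ounit (C_aff K)"
    and g: "cstar_generators (C_aff K) g"
begin

interpretation G: gelfand_space "C_aff K" g
  using g base.gelfand_change_generators[OF g] by unfold_locales (auto simp: cstar_generators_def)

interpretation F: free_basis "C_aff K" g e
  using e by unfold_locales

definition base_map :: "real^'m \<Rightarrow> real^'m" where
  "base_map y = joint_values g (eval_base y)"

definition fibre_map :: "real^'m \<Rightarrow> real^'n \<Rightarrow> real^'n" where
  "fibre_map y x = (\<chi> i. e (Some i) (x, y))"

lemma e_caff: "e i \<in> caff_set K"
  using F.basis_carrier by simp

lemma spectrum_base_map: "spectrum_set (C_aff K) g = base_map ` pi2 K"
  unfolding spectrum_set_def characters_C_aff base_map_def image_image by simp

lemma mval_base_map: "y \<in> pi2 K \<Longrightarrow> mval (C_aff K) g z (base_map y) = eval_base y z"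
  unfolding base_map_def by (rule G.mval_character[OF eval_base_character])

lemma continuous_base_map: "continuous_on (pi2 K) base_map"
  unfolding base_map_def joint_values_def by (intro continuous_on_vec_lambda continuous_eval_base)

lemma inj_base_map: "inj_on base_map (pi2 K)"
proof (rule inj_onI)
  fix y y' assume yy: "y \<in> pi2 K" "y' \<in> pi2 K" "base_map y = base_map y'"
  then have "eval_base y = eval_base y'"
    using inj_onD[OF G.inj_joint_values] eval_base_character unfolding base_map_def by blast
  then show "y = y'" using joint_values_eval_base yy by metis
qed

text \<open>The states over a point do not depend on the generators, and they are evaluations.\<close>

lemma y_states_base_map:
  assumes y: "y \<in> pi2 K"
  shows "(\<lambda>\<Phi>. \<chi> i. \<Phi> (e (Some i))) ` y_states (C_aff K) g (base_map y) = fibre_map y ` fib K y"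
proof (intro equalityI subsetI)
  have eq: "y_states (C_aff K) g (base_map y) = y_states (C_aff K) base_gens y"
    using y by (simp add: y_states_def mval_base_map mval_C_aff)
  {
    fix v assume "v \<in> (\<lambda>\<Phi>. \<chi> i. \<Phi> (e (Some i))) ` y_states (C_aff K) g (base_map y)"
    then obtain \<Phi> where \<Phi>: "\<Phi> \<in> y_states (C_aff K) base_gens y" "v = (\<chi> i. \<Phi> (e (Some i)))"
      unfolding eq by blast
    obtain x where x: "(x, y) \<in> K" "\<And>a. a \<in> caff_set K \<Longrightarrow> \<Phi> a = a (x, y)"
      using y_state_is_evaluation[OF y \<Phi>(1)] by blast
    then have "v = fibre_map y x" using e_caff by (simp add: \<Phi>(2) fibre_map_def)
    with x(1) show "v \<in> fibre_map y ` fib K y" by simp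
  next
    fix v assume "v \<in> fibre_map y ` fib K y"
    then obtain x where x: "(x, y) \<in> K" "v = fibre_map y x" by auto
    let ?\<Phi> = "\<lambda>f\<in>caff_set K. f (x, y)"
    have "?\<Phi> \<in> states (C_aff K)" by (rule rep_states[OF eval_rep[OF x(1)]])
    moreover have "?\<Phi> (omult (C_aff K) f a) = mval (C_aff K) g f (base_map y) * ?\<Phi> a"
      if "f \<in> mdom (C_aff K)" "a \<in> vcarrier (C_aff K)" for f a
      using that omult(1)[OF that] x(1) y
      by (simp add: omult_value eval_base_value mval_base_map)
    ultimately have "?\<Phi> \<in> y_states (C_aff K) g (base_map y)" by (simp add: y_states_def)
    moreover have "v = (\<chi> i. ?\<Phi> (e (Some i)))" using e_caff by (simp add: x(2) fibre_map_def)
    ultimately show "v \<in> (\<lambda>\<Phi>. \<chi> i. \<Phi> (e (Some i))) ` y_states (C_aff K) g (base_map y)" by blast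
  }
qed

lemma coord_state_space_C_aff:
  "coord_state_space (C_aff K) e g = (\<lambda>p. (fibre_map (snd p) (fst p), base_map (snd p))) ` K"
proof -
  have "coord_state_space (C_aff K) e g = (\<Union>y\<in>pi2 K. fibre_map y ` fib K y \<times> {base_map y})"
    unfolding coord_state_space_def spectrum_base_map using y_states_base_map by simp
  also have "\<dots> = (\<lambda>p. (fibre_map (snd p) (fst p), base_map (snd p))) ` K"
    by (force simp: pi2_def)
  finally show ?thesis .
qed

text \<open>The coefficients of an expansion in the basis are constant on a fibre; hence the basis
  separates its points.\<close>

lemma inj_fibre_map: "inj_on (fibre_map y) (fib K y)"
proof (rule inj_onI)
  fix x x' assume "x \<in> fib K y" "x' \<in> fib K y" and eq: "fibre_map y x = fibre_map y x'"
  then have K: "(x, y) \<in> K" "(x', y) \<in> K" by auto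
  have ei: "e i (x, y) = e i (x', y)" for i
    using eq K by (cases i) (auto simp: fibre_map_def vec_eq_iff e(2))
  have val: "a p = (\<Sum>i\<in>UNIV. basis_coords (C_aff K) e a i p * e i p)"
    if a: "a \<in> caff_set K" and p: "p \<in> K" for a p
  proof -
    have "a p = (\<Sum>i\<in>UNIV. omult (C_aff K) (basis_coords (C_aff K) e a i) (e i)) p"
      using F.coords_expand[of a] a by simp
    also have "\<dots> = (\<Sum>i\<in>UNIV. omult (C_aff K) (basis_coords (C_aff K) e a i) (e i) p)"
      by (rule sum_fun_apply)
    finally show ?thesis
      using a p e_caff by (simp add: omult_value)
  qed
  have "a (x, y) = a (x', y)" if a: "a \<in> caff_set K" for a
  proof -
    have "basis_coords (C_aff K) e a i (x, y) = basis_coords (C_aff K) e a i (x', y)" for i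
      using eval_base_value[OF F.coords_mdom] a K by simp
    then show ?thesis using val[OF a] K ei by simp
  qed
  from this[OF coord_basis_caff[of "Some _"]] show "x = x'"
    using K by (simp add: coord_basis_def vec_eq_iff inner_axis')
qed

text \<open>\<open>(x, y) \<mapsto> ((e\<^sub>i(x, y))\<^sub>i, (g\<^sub>j(y))\<^sub>j)\<close> is a continuous bijection from \<open>K\<close> onto the
  coordinate state space, as are its two components from the fibres and from the base; on
  compact sets these are homeomorphisms.\<close>

theorem pc_isomorphic_coord_state_space: "pc_isomorphic K (coord_state_space (C_aff K) e g)"
proof -
  let ?L = "coord_state_space (C_aff K) e g"
  define \<Theta> where "\<Theta> p = (fibre_map (snd p) (fst p), base_map (snd p))" for p
  have L: "?L = \<Theta> ` K" unfolding coord_state_space_C_aff \<Theta>_def ..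
  have \<Theta>_cont: "continuous_on K \<Theta>"
  proof -
    have "continuous_on K (e i)" for i using e_caff[of i] by (simp add: caff_set_def)
    moreover have "continuous_on K (\<lambda>p. base_map (snd p))"
      by (rule continuous_on_compose2[OF continuous_base_map]) (auto intro!: continuous_intros
        intro: pi2I)
    ultimately show ?thesis
      unfolding \<Theta>_def fibre_map_def by (intro continuous_on_Pair continuous_on_vec_lambda) auto
  qed
  have \<Theta>_inj: "inj_on \<Theta> K"
  proof (rule inj_onI)
    fix p q assume pq: "p \<in> K" "q \<in> K" "\<Theta> p = \<Theta> q"
    then have "snd p = snd q"
      using inj_onD[OF inj_base_map _ snd_pi2[OF pq(1)] snd_pi2[OF pq(2)]] by (simp add: \<Theta>_def)
    moreover from this have "fst p = fst q"
      using pq inj_onD[OF inj_fibre_map, of "snd p" "fst p" "fst q"]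
      by (cases p; cases q) (simp add: \<Theta>_def)
    ultimately show "p = q" by (rule prod_eqI[rotated])
  qed
  obtain \<Theta>' where hom\<Theta>: "homeomorphism K ?L \<Theta> \<Theta>'"
    using homeomorphism_compact[OF cpt \<Theta>_cont _ \<Theta>_inj] L by metis
  have pi2L: "pi2 ?L = base_map ` pi2 K"
    unfolding L pi2_eq \<Theta>_def by (simp add: image_image)
  obtain \<phi>' where hom\<phi>: "homeomorphism (pi2 K) (pi2 ?L) base_map \<phi>'"
    using homeomorphism_compact[OF compact_base continuous_base_map _ inj_base_map] pi2L by metis
  have fibL: "fib ?L (base_map y) = fibre_map y ` fib K y" if "y \<in> pi2 K" for y
  proof (intro equalityI subsetI)
    fix v assume "v \<in> fib ?L (base_map y)"
    then obtain p where p: "p \<in> K" "v = fibre_map (snd p) (fst p)" "base_map y = base_map (snd p)"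
      unfolding L by (auto simp: \<Theta>_def)
    then have "snd p = y" using inj_onD[OF inj_base_map _ that snd_pi2[OF p(1)]] by simp
    with p show "v \<in> fibre_map y ` fib K y" by (auto intro!: image_eqI[of _ _ "fst p"])
  qed (auto simp: L \<Theta>_def intro!: image_eqI)
  have aff: "affine_on (fib K y) (fibre_map y)" if y: "y \<in> pi2 K" for y
    unfolding affine_on_def
  proof (intro ballI)
    fix x x' and t :: real assume x: "x \<in> fib K y" "x' \<in> fib K y" "t \<in> {0..1}"
    have "affine_on (fib K y) (\<lambda>x. e (Some i) (x, y))" for i
      using e_caff[of "Some i"] y by (simp add: caff_set_def)
    from affine_onD[OF this x(1,2)] x(3)
    show "fibre_map y ((1 - t) *\<^sub>R x + t *\<^sub>R x') = (1 - t) *\<^sub>R fibre_map y x + t *\<^sub>R fibre_map y x'"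
      by (simp add: fibre_map_def vec_eq_iff)
  qed
  have "\<exists>\<theta>'. homeomorphism (fib K y) (fib ?L (base_map y)) (fibre_map y) \<theta>'" if y: "y \<in> pi2 K" for y
  proof (rule homeomorphism_compact[OF compact_fib _ fibL[OF y, symmetric] inj_fibre_map])
    have "continuous_on (fib K y) (\<lambda>x. fst (\<Theta> (x, y)))"
      by (intro continuous_on_fst continuous_on_compose2[OF \<Theta>_cont]) (auto intro!:
        continuous_intros)
    then show "continuous_on (fib K y) (fibre_map y)" by (simp add: \<Theta>_def)
  qed
  moreover have "partially_convex K" using convex_fib by (simp add: partially_convex_def)
  moreover have "partially_convex ?L"
    unfolding partially_convex_def pi2L
    using fibL affine_on_convex_image[OF aff convex_fib] by auto
  ultimately show ?thesis
    unfolding pc_isomorphic_def using hom\<Theta> hom\<phi> aff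
    by (intro conjI exI[of _ \<Theta>] exI[of _ \<Theta>'] exI[of _ fibre_map] exI[of _ base_map] exI[of _ \<phi>'])
      (auto simp: \<Theta>_def)
qed

end

end

section \<open>Reconstruction of a free order unit module from its coordinate state space\<close>

context free_ou_coords
begin

lemma compact_regular_state_space: "compact_regular state_space"
  by (intro compact_regular.intro compact_state_space regular_state_space)

interpretation S: compact_regular state_space
  by (rule compact_regular_state_space)

text \<open>The element \<open>a\<close> is represented by the function \<open>(x, y) \<mapsto> \<Phi>(a)\<close>, where \<open>\<Phi>\<close> is the \<open>y\<close>-state
  with coordinates \<open>x\<close>.\<close>

definition represent :: "'a \<Rightarrow> (real^'n) \<times> (real^'m) \<Rightarrow> real" where
  "represent a = S.lift_aff (\<lambda>y. fst (coord y a)) (\<lambda>y. snd (coord y a))"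

lemma represent_value: "(x, y) \<in> state_space \<Longrightarrow> represent a (x, y) = (1, x) \<bullet> coord y a"
  by (simp add: represent_def inner_prod_def inner_commute)

lemma continuous_coord_components:
  assumes "a \<in> vcarrier A"
  shows "continuous_on (pi2 state_space) (\<lambda>y. fst (coord y a))"
    "continuous_on (pi2 state_space) (\<lambda>y. snd (coord y a))"
  unfolding pi2_state_space using continuous_coord[OF assms] by (auto intro: continuous_intros)

lemma represent_caff: "a \<in> vcarrier A \<Longrightarrow> represent a \<in> caff_set state_space"
  unfolding represent_def by (intro S.lift_aff_caff continuous_coord_components)

lemma represent_add: "a \<in> vcarrier A \<Longrightarrow> b \<in> vcarrier A \<Longrightarrow> represent (a + b)
  = represent a + represent b"
  unfolding represent_def S.lift_aff_add
  by (rule S.lift_aff_cong) (simp add: pi2_state_space)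

lemma represent_scale: "a \<in> vcarrier A \<Longrightarrow> represent (r *\<^sub>R a) = r *\<^sub>R represent a"
  unfolding represent_def S.lift_aff_scale
  by (rule S.lift_aff_cong) (simp add: pi2_state_space)

lemma represent_diff: "a \<in> vcarrier A \<Longrightarrow> b \<in> vcarrier A \<Longrightarrow> represent (a - b)
  = represent a - represent b"
  using represent_add[of a "(-1) *\<^sub>R b"] represent_scale[of b "-1"] by simp

lemma represent_unit: "represent (ounit A) = ounit (C_aff state_space)"
  unfolding S.lift_base_unit S.lift_base_def represent_def
  by (rule S.lift_aff_cong) (simp add: pi2_state_space)

lemma represent_pos_iff: "a \<in> vcarrier A \<Longrightarrow> represent a \<in> pos (C_aff state_space) \<longleftrightarrow> a \<in> pos A"
  using represent_caff by (auto simp: pos_iff_state_space represent_value)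

text \<open>Injectivity holds because the slices have interior points, surjectivity because continuous
  partially affine functions on a regular set have continuous coefficients.\<close>

lemma bij_represent: "bij_betw represent (vcarrier A) (vcarrier (C_aff state_space))"
  unfolding bij_betw_def
proof
  show "inj_on represent (vcarrier A)"
  proof (rule inj_onI)
    fix a b assume ab: "a \<in> vcarrier A" "b \<in> vcarrier A" "represent a = represent b"
    show "a = b"
    proof (rule coord_inj[OF ab(1,2)])
      fix y assume "y \<in> Y"
      then show "coord y a = coord y b"
        using S.lift_aff_inj[OF ab(3)[unfolded represent_def], of y]
          by (simp add: pi2_state_space prod_eq_iff)
    qed
  qed
  show "represent ` vcarrier A = vcarrier (C_aff state_space)"
  proof (intro equalityI subsetI)
    fix f assume "f \<in> vcarrier (C_aff state_space)"
    then have f: "f \<in> caff_set state_space" by simp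
    obtain b c where bc: "continuous_on (pi2 state_space) b" "continuous_on (pi2 state_space) c"
      "f = S.lift_aff b c" by (rule S.caff_coefficients[OF f])
    obtain a where a: "a \<in> vcarrier A" "\<And>y. y \<in> Y \<Longrightarrow> coord y a = (b y, c y)"
      using coord_lift bc(1,2) unfolding pi2_state_space by blast
    have "f = represent a"
      unfolding bc(3) represent_def by (rule S.lift_aff_cong) (simp add: pi2_state_space a(2))
    with a(1) show "f \<in> represent ` vcarrier A" by blast
  qed (use represent_caff in auto)
qed

lemma represent_mdom:
  assumes "z \<in> mdom A"
  shows "represent z = S.lift_base (mval A g z)"
proof -
  have "coord y z = (mval A g z y, 0)" if "y \<in> Y" for y
    using coord_omult[OF that unit_carrier assms] coord_unit[OF that] assms by simp
  then show ?thesis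
    unfolding represent_def S.lift_base_def by (intro S.lift_aff_cong) (simp add: pi2_state_space)
qed

lemma continuous_mval_base: "z \<in> mdom A \<Longrightarrow> continuous_on (pi2 state_space) (mval A g z)"
  using continuous_mval by (simp add: pi2_state_space)

lemma represent_image_mdom: "represent ` mdom A = mdom (C_aff state_space)"
proof (intro equalityI subsetI)
  fix f assume "f \<in> mdom (C_aff state_space)"
  then obtain c where c: "continuous_on (pi2 state_space) c" "f = S.lift_base c"
    by (rule S.mdom_lift_base)
  obtain z where z: "z \<in> mdom A" "\<And>y. y \<in> Y \<Longrightarrow> mval A g z y = c y"
    using mval_lift c(1) unfolding pi2_state_space by blast
  have "f = represent z"
    unfolding c(2) represent_mdom[OF z(1)]
      by (rule S.lift_base_cong) (simp add: pi2_state_space z(2))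
  with z(1) show "f \<in> represent ` mdom A" by blast
qed (use represent_mdom S.lift_base_mdom continuous_mval_base in auto)

lemma represent_omult:
  assumes "z \<in> mdom A" "a \<in> vcarrier A"
  shows "represent (omult A z a) = omult (C_aff state_space) (represent z) (represent a)"
proof -
  have "omult (C_aff state_space) (represent z) (represent a) =
      S.lift_aff (\<lambda>y. mval A g z y * fst (coord y a)) (\<lambda>y. mval A g z y *\<^sub>R snd (coord y a))"
    unfolding represent_mdom[OF assms(1)] unfolding represent_def
    by (rule S.omult_lift[OF continuous_mval_base[OF assms(1)] continuous_coord_components[OF
      assms(2)]])
  also have "\<dots> = represent (omult A z a)"
    unfolding represent_def using assms by (intro S.lift_aff_cong) (simp add: pi2_state_space)
  finally show ?thesis ..
qed

text \<open>The norm is determined by the order and the unit, which are both preserved.\<close>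

lemma represent_norm:
  assumes "a \<in> vcarrier A"
  shows "ou_norm (C_aff state_space) (represent a) = ou_norm A a"
proof -
  have iff: "ou_norm (C_aff state_space) (represent a) \<le> r \<longleftrightarrow> ou_norm A a \<le> r" if "0 \<le> r" for r
  proof -
    have "represent (r *\<^sub>R ounit A + a) = r *\<^sub>R ounit (C_aff state_space) + represent a"
      "represent (r *\<^sub>R ounit A - a) = r *\<^sub>R ounit (C_aff state_space) - represent a"
      using assms by (simp_all only: represent_add represent_diff represent_scale represent_unit
          scale_carrier unit_carrier)
    then show ?thesis
      using represent_pos_iff[of "r *\<^sub>R ounit A + a"] represent_pos_iff[of "r *\<^sub>R ounit A - a"]
        represent_caff[OF assms] assms that
      by (simp add: ou_norm_le_iff_pos S.ou_norm_le_iff_pos del: C_aff_simps(2,3))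
  qed
  show ?thesis
    using iff[of "ou_norm A a"] iff[of "ou_norm (C_aff state_space) (represent a)"]
    by (simp add: S.ou_norm_nonneg)
qed

end

theorem free_ou_module_iso_C_aff:
  fixes A :: "('a::real_vector) ou_module" and e :: "'n::finite option \<Rightarrow> 'a"
    and g :: "'m::finite \<Rightarrow> 'a"
  assumes free: "free_ou_module TYPE('n) TYPE('m) A" and coords: "free_ou_coords A g e"
  shows "free_ou_module_iso TYPE('n) TYPE('m) A (C_aff (coord_state_space A e g))"
proof -
  interpret free_ou_coords A g e by (rule coords)
  interpret S: compact_regular state_space by (rule compact_regular_state_space)
  have "represent ` pos A = pos (C_aff state_space)"
  proof (intro equalityI subsetI)
    fix f assume f: "f \<in> pos (C_aff state_space)"
    then have "f \<in> vcarrier (C_aff state_space)" by simp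
    then obtain a where "a \<in> vcarrier A" "f = represent a"
      using bij_represent by (auto simp: bij_betw_def)
    with f show "f \<in> represent ` pos A" using represent_pos_iff by blast
  qed (use represent_pos_iff pos_carrier in blast)
  moreover have "linear_on (vcarrier A) represent"
    by (simp add: linear_on_def represent_add represent_scale)
  ultimately show ?thesis
    unfolding free_ou_module_iso_def
    using free S.free_ou_module_C_aff bij_represent represent_unit represent_image_mdom
      represent_norm represent_omult
    by (intro conjI exI[of _ represent]) auto
qed

text \<open>An arbitrary choice of generators and of a basis inherits the conditions that hold for the
  choice provided by the definition.\<close>

lemma free_ou_coordsI:
  fixes A :: "('a::real_vector) ou_module" and e :: "'n::finite option \<Rightarrow> 'a"
    and g :: "'m::finite \<Rightarrow> 'a"
  assumes free: "free_ou_module TYPE('n) TYPE('m) A"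
    and e: "module_basis A e" "e None = ounit A" and g: "cstar_generators A g"
  shows "free_ou_coords A g e"
proof -
  obtain g0 :: "'m \<Rightarrow> 'a" and e0 :: "'n option \<Rightarrow> 'a"
    where g0: "cstar_generators A g0" "gelfand_identification A g0"
      "fibre_conditions A g0 (CARD('n))"
      and e0: "module_basis A e0" "e0 None = ounit A"
        "homeomorphic_map (ou_topology A)
          (product_topology (\<lambda>_. subtopology (ou_topology A) (mdom A)) UNIV) (basis_coords A e0)"
    and A: "aou_space A" "kadison_embedded A"
    using free unfolding free_ou_module_iff by blast
  interpret G0: gelfand_space A g0
    using A g0 by unfold_locales (auto simp: cstar_generators_def)
  interpret F: free_basis A g e
    using G0.gelfand_change_generators[OF g] g e by unfold_locales (auto simp: cstar_generators_def)
  interpret F0: free_basis A g e0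
    using e0 by unfold_locales
  show ?thesis
    using G0.fibre_conditions_change_generators[OF g g0(3)]
      F.coords_bounded_change_basis[OF e0(1,2) F0.homeomorphic_imp_coords_bounded[OF e0(3)]]
    by unfold_locales
qed

theorem theorem1p5:
  fixes K :: "((real^'n) \<times> (real^'m)) set"
    and A :: "('a::real_vector) ou_module"
  shows "(compact K \<and> regular_partially_convex K \<longrightarrow>
            free_ou_module TYPE('n) TYPE('m) (C_aff K) \<and>
            (\<forall>(e :: 'n option \<Rightarrow> (real^'n) \<times> (real^'m) \<Rightarrow> real)
              (g :: 'm \<Rightarrow> (real^'n) \<times> (real^'m) \<Rightarrow> real).
               module_basis (C_aff K) e \<and> e None = ounit (C_aff K) \<and>
               cstar_generators (C_aff K) g \<longrightarrow>
               pc_isomorphic K (coord_state_space (C_aff K) e g)))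
       \<and> (free_ou_module TYPE('n) TYPE('m) A \<longrightarrow>
            (\<forall>(e :: 'n option \<Rightarrow> 'a) (g :: 'm \<Rightarrow> 'a).
               module_basis A e \<and> e None = ounit A \<and> cstar_generators A g \<longrightarrow>
               compact (coord_state_space A e g) \<and>
               regular_partially_convex (coord_state_space A e g) \<and>
               free_ou_module_iso TYPE('n) TYPE('m) A (C_aff (coord_state_space A e g))))"
proof (intro conjI impI allI; (elim conjE)?)
  assume "compact K" "regular_partially_convex K"
  then interpret compact_regular K by unfold_locales
  show "free_ou_module TYPE('n) TYPE('m) (C_aff K)" by (rule free_ou_module_C_aff)
  show "pc_isomorphic K (coord_state_space (C_aff K) e g)"
    if "module_basis (C_aff K) e" "e None = ounit (C_aff K)" "cstar_generators (C_aff K) g" for e g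
    by (rule pc_isomorphic_coord_state_space[OF that])
next
  fix e :: "'n option \<Rightarrow> 'a" and g :: "'m \<Rightarrow> 'a"
  assume A: "free_ou_module TYPE('n) TYPE('m) A"
    and eg: "module_basis A e" "e None = ounit A" "cstar_generators A g"
  then interpret free_ou_coords A g e by (intro free_ou_coordsI)
  show "compact (coord_state_space A e g)" by (rule compact_state_space)
  show "regular_partially_convex (coord_state_space A e g)" by (rule regular_state_space)
  show "free_ou_module_iso TYPE('n) TYPE('m) A (C_aff (coord_state_space A e g))"
    by (rule free_ou_module_iso_C_aff[OF A free_ou_coords_axioms])
qed

end
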